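(* For every one-manifold $M$, there exist uncountably many isomorphism types of countable simple subgroups of $\mathrm{Homeo}^+(M)$. Moreover, these simple groups can be realized (up to isomorphism) as the commutator subgroups of $3$-chain groups.
   Context: $\mathrm{Homeo}^+(M)$ is the group of orientation preserving homeomorphisms of $M$. For $f\in\mathrm{Homeo}^+(\mathbb{R})$, $\operatorname{supp} f=\{x: f(x)\ne x\}$. For an interval $J$, $\partial^-J$ is its left endpoint. Chain of intervals: a collection $\{J_1,\ldots,J_n\}$ of nonempty open subintervals of $\mathbb{R}$ (possibly unbounded) such that $J_i\cap J_k=\varnothing$ if $|i-k|>1$, and $J_i\cap J_{i+1}$ is a proper nonempty subinterval of both $J_i$ and $J_{i+1}$ for $1\le i\le n-1$. $n$-chain group ($n\ge 2$): a group $\langle f_1,\ldots,f_n\rangle\le\mathrm{Homeo}^+(\mathbb{R})$ where $\{\operatorname{supp} f_1,\dots,\operatorname{supp} f_n\}$ is a chain of intervals with $\partial^-\operatorname{supp} f_i<\partial^-\operatorname{supp} f_{i+1}$ for all $i<n$, $f_i(t)\ge t$ for all $t$ and $i$, and $\langle f_i,f_{i+1}\rangle\cong F$ for each $1\le i\le n-1$. Here $F=\langle \{g_i\}_{i\ge0}\mid g_i^{-1}g_jg_i=g_{j+1}\text{ for }0\le i<j\rangle$ is Thompson's group. *)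

theory Defs
  imports "HOL-Analysis.Analysis" "HOL-Algebra.Bij" "HOL-Algebra.Generated_Groups"
begin

section \<open>One-manifolds and their orientation preserving homeomorphisms\<close>

text \<open>A chart identifies an open set with a nondegenerate interval of the line. The interval may
  contain one or both of its endpoints, so that manifolds with boundary are covered as well.\<close>

definition chart :: "'a topology \<Rightarrow> 'a set \<Rightarrow> ('a \<Rightarrow> real) \<Rightarrow> bool" where
  "chart M U \<phi> \<longleftrightarrow> openin M U \<and> is_interval (\<phi> ` U) \<and> interior (\<phi> ` U) \<noteq> {} \<and>
     homeomorphic_map (subtopology M U) (top_of_set (\<phi> ` U)) \<phi>"

definition one_manifold :: "'a topology \<Rightarrow> bool" where
  "one_manifold M \<longleftrightarrow> topspace M \<noteq> {} \<and> Hausdorff_space M \<and> second_countable M \<and>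
     (\<forall>p \<in> topspace M. \<exists>U \<phi>. p \<in> U \<and> chart M U \<phi>)"

text \<open>Read in the charts of \<open>A\<close>, the map \<open>h\<close> is locally increasing at every point.\<close>

definition orientation_preserving ::
    "'a topology \<Rightarrow> ('a set \<times> ('a \<Rightarrow> real)) set \<Rightarrow> ('a \<Rightarrow> 'a) \<Rightarrow> bool" where
  "orientation_preserving M A h \<longleftrightarrow>
     (\<forall>(U, \<phi>) \<in> A. \<forall>(V, \<psi>) \<in> A. \<forall>p \<in> U. h p \<in> V \<longrightarrow>
        (\<exists>W. openin M W \<and> p \<in> W \<and> W \<subseteq> U \<and> h ` W \<subseteq> V \<and>
             (\<forall>x \<in> W. \<forall>y \<in> W. \<phi> x < \<phi> y \<longrightarrow> \<psi> (h x) < \<psi> (h y))))"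

text \<open>An orientation is given by an atlas whose transition maps are locally increasing, that is,
  by an atlas for which the identity is orientation preserving.\<close>

definition oriented_atlas :: "'a topology \<Rightarrow> ('a set \<times> ('a \<Rightarrow> real)) set \<Rightarrow> bool" where
  "oriented_atlas M A \<longleftrightarrow> (\<forall>(U, \<phi>) \<in> A. chart M U \<phi>) \<and> (\<Union>(U, \<phi>) \<in> A. U) = topspace M \<and>
     orientation_preserving M A (\<lambda>x. x)"

definition Homeo_plus ::
    "'a topology \<Rightarrow> ('a set \<times> ('a \<Rightarrow> real)) set \<Rightarrow> ('a \<Rightarrow> 'a) monoid" where
  "Homeo_plus M A = (BijGroup (topspace M))
     \<lparr>carrier := {h \<in> Bij (topspace M). homeomorphic_map M M h \<and> orientation_preserving M A h}\<rparr>"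

definition Homeo_plus_real :: "(real \<Rightarrow> real) monoid" where
  "Homeo_plus_real = Homeo_plus euclideanreal {(UNIV, \<lambda>x. x)}"


section \<open>Simple groups and isomorphism types\<close>

text \<open>The locale \<open>simple_group\<close> of HOL-Algebra only admits finite groups, because it requires
  \<open>order G > 1\<close>, and the order of an infinite group is \<open>0\<close>.\<close>

definition simple :: "('a, 'b) monoid_scheme \<Rightarrow> bool" where
  "simple G \<longleftrightarrow> group G \<and> carrier G \<noteq> {\<one>\<^bsub>G\<^esub>} \<and>
     (\<forall>N. N \<lhd> G \<longrightarrow> N = carrier G \<or> N = {\<one>\<^bsub>G\<^esub>})"

text \<open>The isomorphism classes of a family \<open>\<H>\<close> of subgroups of \<open>G\<close>.\<close>

definition iso_types :: "('a, 'b) monoid_scheme \<Rightarrow> 'a set set \<Rightarrow> 'a set set set" where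
  "iso_types G \<H> =
     \<H> // {(H, K). H \<in> \<H> \<and> K \<in> \<H> \<and> G\<lparr>carrier := H\<rparr> \<cong> G\<lparr>carrier := K\<rparr>}"


section \<open>Groups given by generators and relations, Thompson's group\<close>

text \<open>In a word, \<open>(g, True)\<close> stands for the generator \<open>g\<close> and \<open>(g, False)\<close> for its inverse. The
  relations are given as pairs of words.\<close>

type_synonym 'g word = "('g \<times> bool) list"

inductive word_eq :: "('g word \<times> 'g word) set \<Rightarrow> 'g word \<Rightarrow> 'g word \<Rightarrow> bool"
  for R where
  refl: "word_eq R u u"
| sym: "word_eq R u v \<Longrightarrow> word_eq R v u"
| trans: "word_eq R u v \<Longrightarrow> word_eq R v w \<Longrightarrow> word_eq R u w"
| cancel: "word_eq R (u @ [(g, b), (g, \<not> b)] @ v) (u @ v)"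
| relation: "(r, s) \<in> R \<Longrightarrow> word_eq R (u @ r @ v) (u @ s @ v)"

definition word_rel :: "('g word \<times> 'g word) set \<Rightarrow> ('g word \<times> 'g word) set" where
  "word_rel R = {(u, v). word_eq R u v}"

definition presented_group :: "('g word \<times> 'g word) set \<Rightarrow> 'g word set monoid" where
  "presented_group R =
     \<lparr>carrier = UNIV // word_rel R,
      mult = \<lambda>A B. (\<Union>u \<in> A. \<Union>v \<in> B. word_rel R `` {u @ v}),
      one = word_rel R `` {[]}\<rparr>"

definition Thompson_F :: "nat word set monoid" where
  "Thompson_F = presented_group
     {([(i, False), (j, True), (i, True)], [(j + 1, True)]) | i j. i < j}"


section \<open>Chain groups\<close>

definition supp :: "(real \<Rightarrow> real) \<Rightarrow> real set" where
  "supp f = {x. f x \<noteq> x}"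

definition left_endpoint :: "real set \<Rightarrow> ereal" where
  "left_endpoint J = (INF x \<in> J. ereal x)"

definition chain_of_intervals :: "nat \<Rightarrow> (nat \<Rightarrow> real set) \<Rightarrow> bool" where
  "chain_of_intervals n J \<longleftrightarrow>
     (\<forall>i \<in> {1..n}. J i \<noteq> {} \<and> open (J i) \<and> is_interval (J i)) \<and>
     (\<forall>i \<in> {1..n}. \<forall>k \<in> {1..n}. \<bar>int i - int k\<bar> > 1 \<longrightarrow> J i \<inter> J k = {}) \<and>
     (\<forall>i \<in> {1..<n}. J i \<inter> J (i + 1) \<noteq> {} \<and> is_interval (J i \<inter> J (i + 1)) \<and>
        J i \<inter> J (i + 1) \<subset> J i \<and> J i \<inter> J (i + 1) \<subset> J (i + 1))"

definition chain_group :: "nat \<Rightarrow> (real \<Rightarrow> real) set \<Rightarrow> bool" where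
  "chain_group n K \<longleftrightarrow> n \<ge> 2 \<and>
     (\<exists>f. (\<forall>i \<in> {1..n}. f i \<in> carrier Homeo_plus_real) \<and>
        K = generate Homeo_plus_real (f ` {1..n}) \<and>
        chain_of_intervals n (\<lambda>i. supp (f i)) \<and>
        (\<forall>i \<in> {1..<n}. left_endpoint (supp (f i)) < left_endpoint (supp (f (i + 1)))) \<and>
        (\<forall>i \<in> {1..n}. \<forall>t. f i t \<ge> t) \<and>
        (\<forall>i \<in> {1..<n}.
           Homeo_plus_real\<lparr>carrier := generate Homeo_plus_real {f i, f (i + 1)}\<rparr> \<cong> Thompson_F))"


section \<open>Basic facts\<close>

lemma equiv_word_rel: "equiv UNIV (word_rel R)"
  by (auto simp: equiv_def refl_on_def sym_def trans_def word_rel_def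
      intro: word_eq.refl word_eq.sym word_eq.trans)

lemma word_eq_append_right: "word_eq R u v \<Longrightarrow> word_eq R (u @ w) (v @ w)"
proof (induction rule: word_eq.induct)
  case (cancel u g b v)
  show ?case using word_eq.cancel[of R u g b "v @ w"] by simp
next
  case (relation r s u v)
  then show ?case using word_eq.relation[of r s R u "v @ w"] by simp
qed (auto intro: word_eq.refl word_eq.sym word_eq.trans)

lemma word_eq_append_left: "word_eq R u v \<Longrightarrow> word_eq R (w @ u) (w @ v)"
proof (induction rule: word_eq.induct)
  case (cancel u g b v)
  show ?case using word_eq.cancel[of R "w @ u" g b v] by simp
next
  case (relation r s u v)
  then show ?case using word_eq.relation[of r s R "w @ u" v] by simp
qed (auto intro: word_eq.refl word_eq.sym word_eq.trans)

lemma congruent2_append: "congruent2 (word_rel R) (word_rel R) (\<lambda>u v. word_rel R `` {u @ v})"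
proof (rule congruent2I')
  fix u u' v v' assume "(u, u') \<in> word_rel R" "(v, v') \<in> word_rel R"
  then have "word_eq R (u @ v) (u' @ v')"
    using word_eq.trans[OF word_eq_append_right word_eq_append_left] by (simp add: word_rel_def)
  then show "word_rel R `` {u @ v} = word_rel R `` {u' @ v'}"
    by (intro equiv_class_eq[OF equiv_word_rel]) (simp add: word_rel_def)
qed

lemma mult_presented_group:
  "word_rel R `` {u} \<otimes>\<^bsub>presented_group R\<^esub> word_rel R `` {v} = word_rel R `` {u @ v}"
  unfolding presented_group_def monoid.simps
  by (rule UN_equiv_class2[OF equiv_word_rel equiv_word_rel congruent2_append]) auto

lemma word_eq_inverse: "word_eq R (map (\<lambda>(g, b). (g, \<not> b)) (rev u) @ u) []"
proof (induction u)
  case Nil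
  show ?case by (simp add: word_eq.refl)
next
  case (Cons x u)
  obtain g b where x: "x = (g, b)" by (cases x)
  show ?case
    using word_eq.trans[OF word_eq.cancel[of R "map (\<lambda>(g, b). (g, \<not> b)) (rev u)" g "\<not> b" u] Cons.IH]
    by (simp add: x)
qed

lemma group_presented_group: "group (presented_group R)"
proof (rule groupI)
  have carr: "\<exists>u. A = word_rel R `` {u}" if "A \<in> carrier (presented_group R)" for A
    using that by (auto simp: presented_group_def quotient_def)
  have mem: "word_rel R `` {u} \<in> carrier (presented_group R)" for u
    by (auto simp: presented_group_def quotient_def)
  have one: "\<one>\<^bsub>presented_group R\<^esub> = word_rel R `` {[]}"
    by (simp add: presented_group_def)
  show "\<one>\<^bsub>presented_group R\<^esub> \<in> carrier (presented_group R)"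
    using mem one by metis
  show "A \<otimes>\<^bsub>presented_group R\<^esub> B \<in> carrier (presented_group R)"
    if "A \<in> carrier (presented_group R)" "B \<in> carrier (presented_group R)" for A B
    using carr[OF that(1)] carr[OF that(2)] by (auto simp: mult_presented_group mem)
  show "A \<otimes>\<^bsub>presented_group R\<^esub> B \<otimes>\<^bsub>presented_group R\<^esub> C =
      A \<otimes>\<^bsub>presented_group R\<^esub> (B \<otimes>\<^bsub>presented_group R\<^esub> C)"
    if "A \<in> carrier (presented_group R)" "B \<in> carrier (presented_group R)"
      "C \<in> carrier (presented_group R)" for A B C
    using carr[OF that(1)] carr[OF that(2)] carr[OF that(3)] by (auto simp: mult_presented_group)
  show "\<one>\<^bsub>presented_group R\<^esub> \<otimes>\<^bsub>presented_group R\<^esub> A = A"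
    if "A \<in> carrier (presented_group R)" for A
    using carr[OF that] by (auto simp: one mult_presented_group)
  show "\<exists>B \<in> carrier (presented_group R). B \<otimes>\<^bsub>presented_group R\<^esub> A = \<one>\<^bsub>presented_group R\<^esub>"
    if A: "A \<in> carrier (presented_group R)" for A
  proof -
    obtain u where u: "A = word_rel R `` {u}" using carr[OF A] by blast
    let ?v = "map (\<lambda>(g, b). (g, \<not> b)) (rev u)"
    have "word_rel R `` {?v @ u} = word_rel R `` {[]}"
      using word_eq_inverse[of R u] equiv_class_eq[OF equiv_word_rel] by (simp add: word_rel_def)
    then show ?thesis
      using mem one u mult_presented_group by metis
  qed
qed

lemma orientation_preservingD:
  assumes "orientation_preserving M A h" "(U, \<phi>) \<in> A" "(V, \<psi>) \<in> A" "p \<in> U" "h p \<in> V"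
  shows "\<exists>W. openin M W \<and> p \<in> W \<and> W \<subseteq> U \<and> h ` W \<subseteq> V \<and>
           (\<forall>x \<in> W. \<forall>y \<in> W. \<phi> x < \<phi> y \<longrightarrow> \<psi> (h x) < \<psi> (h y))"
proof -
  have "\<forall>(V, \<psi>) \<in> A. \<forall>p \<in> U. h p \<in> V \<longrightarrow>
      (\<exists>W. openin M W \<and> p \<in> W \<and> W \<subseteq> U \<and> h ` W \<subseteq> V \<and>
        (\<forall>x \<in> W. \<forall>y \<in> W. \<phi> x < \<phi> y \<longrightarrow> \<psi> (h x) < \<psi> (h y)))"
    using bspec[OF assms(1)[unfolded orientation_preserving_def] assms(2)] by simp
  from bspec[OF this assms(3)] assms(4,5) show ?thesis by simp
qed

lemma subgroup_Homeo_plus: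
  assumes A: "oriented_atlas M A"
  shows "subgroup (carrier (Homeo_plus M A)) (BijGroup (topspace M))"
proof -
  let ?S = "topspace M"
  have sub: "U \<subseteq> ?S" and inj: "inj_on \<phi> U" if "(U, \<phi>) \<in> A" for U \<phi>
  proof -
    have c: "chart M U \<phi>" using A that by (auto simp: oriented_atlas_def)
    then show "U \<subseteq> ?S" by (auto simp: chart_def dest: openin_subset)
    then show "inj_on \<phi> U" using c by (auto simp: chart_def homeomorphic_map_def topspace_subtopology Int_absorb1)
  qed
  have cover: "\<exists>U \<phi>. (U, \<phi>) \<in> A \<and> p \<in> U" if "p \<in> ?S" for p
    using A that unfolding oriented_atlas_def by blast
  have carr: "h \<in> carrier (Homeo_plus M A) \<longleftrightarrow>
      h \<in> Bij ?S \<and> homeomorphic_map M M h \<and> orientation_preserving M A h" for h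
    by (simp add: Homeo_plus_def)
  show ?thesis
  proof (rule subgroup.intro)
    show "carrier (Homeo_plus M A) \<subseteq> carrier (BijGroup ?S)"
      by (auto simp: Homeo_plus_def BijGroup_def)
  next
    have idop: "orientation_preserving M A (\<lambda>x. x)"
      using A by (simp add: oriented_atlas_def)
    have "orientation_preserving M A (\<lambda>x\<in>?S. x)"
      unfolding orientation_preserving_def
    proof (clarify)
      fix U \<phi> V \<psi> p
      assume *: "(U, \<phi>) \<in> A" "(V, \<psi>) \<in> A" "p \<in> U" "(\<lambda>x\<in>?S. x) p \<in> V"
      then have pV: "p \<in> V" using sub by (metis restrict_apply subsetD)
      obtain W where W: "openin M W" "p \<in> W" "W \<subseteq> U" "(\<lambda>x. x) ` W \<subseteq> V"
        "\<forall>x \<in> W. \<forall>y \<in> W. \<phi> x < \<phi> y \<longrightarrow> \<psi> x < \<psi> y"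
        using orientation_preservingD[OF idop *(1) *(2) *(3) pV] by blast
      then have "W \<subseteq> ?S" using openin_subset by blast
      then show "\<exists>W. openin M W \<and> p \<in> W \<and> W \<subseteq> U \<and> (\<lambda>x\<in>?S. x) ` W \<subseteq> V \<and>
          (\<forall>x\<in>W. \<forall>y\<in>W. \<phi> x < \<phi> y \<longrightarrow> \<psi> ((\<lambda>x\<in>?S. x) x) < \<psi> ((\<lambda>x\<in>?S. x) y))"
        using W by (intro exI[of _ W]) (auto simp: subset_iff)
    qed
    moreover have "homeomorphic_map M M (\<lambda>x\<in>?S. x)"
      using homeomorphic_map_eq[of M M id "\<lambda>x\<in>?S. x"] by simp
    ultimately show "\<one>\<^bsub>BijGroup ?S\<^esub> \<in> carrier (Homeo_plus M A)"
      by (simp add: carr BijGroup_def id_Bij)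
  next
    fix g h assume g: "g \<in> carrier (Homeo_plus M A)" and h: "h \<in> carrier (Homeo_plus M A)"
    have gop: "orientation_preserving M A g" and hop: "orientation_preserving M A h"
      using g h by (simp_all add: carr)
    have m: "g \<otimes>\<^bsub>BijGroup ?S\<^esub> h = compose ?S g h"
      using g h by (simp add: carr BijGroup_def)
    have hS: "h p \<in> ?S" if "p \<in> ?S" for p
      using h that by (auto simp: carr dest: Bij_imp_funcset)
    have "homeomorphic_map M M (compose ?S g h)"
      using g h homeomorphic_map_eq[OF homeomorphic_map_compose[of M M h M g], of "compose ?S g h"]
      by (auto simp: carr compose_def)
    moreover have "orientation_preserving M A (compose ?S g h)"
      unfolding orientation_preserving_def
    proof (clarify)
      fix U \<phi> V \<psi> p
      assume *: "(U, \<phi>) \<in> A" "(V, \<psi>) \<in> A" "p \<in> U" "compose ?S g h p \<in> V"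
      have pS: "p \<in> ?S" using * sub by blast
      obtain T \<theta> where T: "(T, \<theta>) \<in> A" "h p \<in> T" using cover[OF hS[OF pS]] by blast
      obtain W where W: "openin M W" "p \<in> W" "W \<subseteq> U" "h ` W \<subseteq> T"
        "\<forall>x \<in> W. \<forall>y \<in> W. \<phi> x < \<phi> y \<longrightarrow> \<theta> (h x) < \<theta> (h y)"
        using orientation_preservingD[OF hop *(1) T(1) *(3) T(2)] by blast
      have gV: "g (h p) \<in> V" using *(4) pS by (simp add: compose_def)
      obtain X where X: "openin M X" "h p \<in> X" "X \<subseteq> T" "g ` X \<subseteq> V"
        "\<forall>x \<in> X. \<forall>y \<in> X. \<theta> x < \<theta> y \<longrightarrow> \<psi> (g x) < \<psi> (g y)"
        using orientation_preservingD[OF gop T(1) *(2) T(2) gV] by blast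
      let ?Y = "W \<inter> {x \<in> ?S. h x \<in> X}"
      have "openin M {x \<in> ?S. h x \<in> X}"
        using h X(1) homeomorphic_imp_continuous_map openin_continuous_map_preimage carr by metis
      then have "openin M ?Y" using W(1) by blast
      then show "\<exists>W. openin M W \<and> p \<in> W \<and> W \<subseteq> U \<and> compose ?S g h ` W \<subseteq> V \<and>
          (\<forall>x\<in>W. \<forall>y\<in>W. \<phi> x < \<phi> y \<longrightarrow> \<psi> (compose ?S g h x) < \<psi> (compose ?S g h y))"
        using W(2-5) X(2-5) pS
        by (intro exI[of _ ?Y] conjI) (auto simp: compose_def image_subset_iff)
    qed
    ultimately show "g \<otimes>\<^bsub>BijGroup ?S\<^esub> h \<in> carrier (Homeo_plus M A)"
      using g h by (simp add: m carr compose_Bij)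
  next
    fix h assume h: "h \<in> carrier (Homeo_plus M A)"
    define k where "k = (\<lambda>x\<in>?S. inv_into ?S h x)"
    have hop: "orientation_preserving M A h" using h by (simp add: carr)
    have hB: "bij_betw h ?S ?S" using h by (auto simp: carr Bij_def)
    have k: "k \<in> Bij ?S" using h by (simp add: k_def carr restrict_inv_into_Bij)
    have inv: "inv\<^bsub>BijGroup ?S\<^esub> h = k" using h by (simp add: k_def carr inv_BijGroup)
    have kh: "k (h x) = x" and hk: "h (k x) = x" and kS: "k x \<in> ?S" and hS: "h x \<in> ?S"
      if "x \<in> ?S" for x
      using that hB bij_betw_inv_into_left[OF hB that] bij_betw_inv_into_right[OF hB that]
        bij_betwE[OF hB] bij_betwE[OF bij_betw_inv_into[OF hB]] by (auto simp: k_def)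
    obtain k' where k': "homeomorphic_maps M M h k'"
      using h unfolding carr homeomorphic_map_maps by blast
    have "k' x = k x" if "x \<in> ?S" for x
      using k' hk[OF that] kS[OF that] unfolding homeomorphic_maps_def by metis
    then have "homeomorphic_map M M k"
      using k' homeomorphic_maps_sym homeomorphic_maps_imp_map homeomorphic_map_eq by metis
    moreover have "orientation_preserving M A k"
      unfolding orientation_preserving_def
    proof (clarify)
      fix U \<phi> V \<psi> p
      assume *: "(U, \<phi>) \<in> A" "(V, \<psi>) \<in> A" "p \<in> U" "k p \<in> V"
      have pS: "p \<in> ?S" using * sub by blast
      have hkU: "h (k p) \<in> U" using hk[OF pS] *(3) by simp
      obtain W where W: "openin M W" "k p \<in> W" "W \<subseteq> V" "h ` W \<subseteq> U"
        "\<forall>x \<in> W. \<forall>y \<in> W. \<psi> x < \<psi> y \<longrightarrow> \<phi> (h x) < \<phi> (h y)"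
        using orientation_preservingD[OF hop *(2) *(1) *(4) hkU] by blast
      have WS: "W \<subseteq> ?S" using W(1) openin_subset by blast
      have "openin M (h ` W)"
        using h W(1) homeomorphic_imp_open_map carr unfolding open_map_def by metis
      moreover have "p \<in> h ` W" using W(2) hk[OF pS] by force
      moreover have "\<psi> (k (h x)) < \<psi> (k (h y))"
        if "x \<in> W" "y \<in> W" "\<phi> (h x) < \<phi> (h y)" for x y
      proof -
        have "\<not> \<psi> y < \<psi> x" using W(5) that by fastforce
        moreover have "\<psi> x \<noteq> \<psi> y"
          using inj[OF *(2)] that W(3) by (metis inj_onD less_irrefl subsetD)
        ultimately show ?thesis using kh that WS by (simp add: subset_iff)
      qed
      moreover have "k ` h ` W \<subseteq> V"
      proof clarify
        fix x assume "x \<in> W"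
        then show "k (h x) \<in> V" using kh[of x] subsetD[OF WS] subsetD[OF W(3)] by simp
      qed
      ultimately show "\<exists>W. openin M W \<and> p \<in> W \<and> W \<subseteq> U \<and> k ` W \<subseteq> V \<and>
          (\<forall>x\<in>W. \<forall>y\<in>W. \<phi> x < \<phi> y \<longrightarrow> \<psi> (k x) < \<psi> (k y))"
        using W(4) by (intro exI[of _ "h ` W"] conjI ballI impI) (auto simp only: image_iff)
    qed
    ultimately show "inv\<^bsub>BijGroup ?S\<^esub> h \<in> carrier (Homeo_plus M A)"
      using k by (simp add: carr inv)
  qed
qed

lemma group_Homeo_plus: "oriented_atlas M A \<Longrightarrow> group (Homeo_plus M A)"
  using subgroup.subgroup_is_group[OF subgroup_Homeo_plus group_BijGroup]
  by (simp add: Homeo_plus_def)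

lemma one_manifold_real: "one_manifold euclideanreal"
proof -
  obtain B :: "real set set" where B: "countable B" "topological_basis B"
    using ex_countable_basis by blast
  have "\<exists>V \<in> B. x \<in> V \<and> V \<subseteq> U" if "open U" "x \<in> U" for U x
    using topological_basisE[OF B(2) that] by metis
  moreover have "open V" if "V \<in> B" for V
    using topological_basis_open[OF B(2) that] .
  ultimately have "second_countable euclideanreal"
    unfolding second_countable_def using B(1) by (intro exI[of _ B]) simp
  moreover have "chart euclideanreal UNIV id"
    by (simp add: chart_def)
  ultimately show ?thesis
    unfolding one_manifold_def by (simp add: Hausdorff_space_euclidean) (metis UNIV_I)
qed

lemma orientation_preserving_real:
  "orientation_preserving euclideanreal {(UNIV, \<lambda>x. x)} h \<longleftrightarrow>
     (\<forall>p. \<exists>W. open W \<and> p \<in> W \<and> (\<forall>x \<in> W. \<forall>y \<in> W. x < y \<longrightarrow> h x < h y))"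
  by (simp add: orientation_preserving_def)

lemma oriented_atlas_real: "oriented_atlas euclideanreal {(UNIV, \<lambda>x. x)}"
proof -
  have "chart euclideanreal UNIV (\<lambda>x. x)"
    using homeomorphic_map_id[of euclideanreal euclideanreal] by (simp add: chart_def id_def)
  moreover have "orientation_preserving euclideanreal {(UNIV, \<lambda>x. x)} (\<lambda>x. x)"
    unfolding orientation_preserving_real using open_UNIV by blast
  ultimately show ?thesis
    by (simp add: oriented_atlas_def)
qed

lemma carrier_Homeo_plus_real:
  "carrier Homeo_plus_real = {h. homeomorphic_map euclideanreal euclideanreal h \<and> strict_mono h}"
proof -
  have "strict_mono h \<longleftrightarrow> orientation_preserving euclideanreal {(UNIV, \<lambda>x. x)} h"
    if h: "homeomorphic_map euclideanreal euclideanreal h" for h :: "real \<Rightarrow> real"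
  proof
    assume "strict_mono h"
    then show "orientation_preserving euclideanreal {(UNIV, \<lambda>x. x)} h"
      unfolding orientation_preserving_real strict_mono_def using open_UNIV by blast
  next
    assume "orientation_preserving euclideanreal {(UNIV, \<lambda>x. x)} h"
    then obtain W where W: "open W" "0 \<in> W" "\<And>x y. x \<in> W \<Longrightarrow> y \<in> W \<Longrightarrow> x < y \<Longrightarrow> h x < h y"
      unfolding orientation_preserving_real by metis
    obtain e where e: "e > 0" "ball 0 e \<subseteq> W" using W openE by blast
    have "e / 2 \<in> W" using e by (auto simp: subset_iff)
    then have less: "h 0 < h (e / 2)" using W e by simp
    have cont: "continuous_on UNIV h"
      using homeomorphic_imp_continuous_map[OF h] by simp
    have inj: "inj h" using h by (simp add: homeomorphic_map_def)
    have "strict_mono_on UNIV h \<or> strict_antimono_on UNIV h"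
      using injective_eq_monotone_map[of UNIV h] cont inj by simp
    then show "strict_mono h"
      using less e by (auto dest: monotone_onD[of _ _ _ h 0 "e / 2"])
  qed
  moreover have "h \<in> Bij UNIV" if "homeomorphic_map euclideanreal euclideanreal h"
    for h :: "real \<Rightarrow> real"
    using that by (auto simp: Bij_def bij_betw_def homeomorphic_map_def
        dest: quotient_imp_surjective_map)
  ultimately show ?thesis
    by (auto simp: Homeo_plus_real_def Homeo_plus_def)
qed

end

theory Submission
  imports Defs
begin

text \<open>For \<open>S \<subseteq> \<nat>\<close> let \<open>G\<^sub>S\<close> be generated by two fixed piecewise linear maps \<open>f\<^sub>1\<close>, \<open>f\<^sub>2\<close>, supported on
  \<open>(-\<infinity>, 1)\<close> and \<open>(0, 3)\<close>, and a map \<open>f\<^sub>3\<close> supported on \<open>(1, \<infinity>)\<close> into which \<open>S\<close> is encoded by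
  bumps that accumulate at \<open>1\<close>. Two maps that form a chain and push the left end of the overlap across it
  generate a copy of Thompson's group, and their commutator lies in the second derived subgroup of
  that copy; hence \<open>G\<^sub>S\<close> is a 3-chain group whose derived subgroup is perfect.
  The product \<open>f\<^sub>2 \<circ> f\<^sub>1\<close> is a translation and \<open>f\<^sub>2\<close> a doubling where it matters, so the orbit
  of \<open>1\<close> contains the dyadic numbers of the unit interval and is dense; as \<open>f\<^sub>3\<close> contracts towards
  \<open>1\<close> backwards in time, compact intervals can be moved into arbitrary open ones, even by \<open>G\<^sub>S'\<close>,
  and Higman's argument makes \<open>G\<^sub>S'\<close> simple.
  Conjugating with powers of an element that doubles near \<open>1\<close> reads off \<open>S\<close> from which conjugates
  commute with a fixed element of \<open>G\<^sub>S'\<close>. A countable group yields only countably many sets in this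
  way, so uncountably many isomorphism types occur. Elements of \<open>G\<^sub>S'\<close> have bounded support and can
  be transplanted into any chart.\<close>

section \<open>Commutators in groups\<close>

text \<open>By definition a 2-chain group is Thompson's group, so three is the least number of
  generators that leaves any freedom. The freedom lies in what the criterion for a pair ignores: it
  asks that no point moves left, that each map is the identity on a ray, and that a few points move
  far enough, but says nothing about the shape of the second map just inside its support. The germ
  of \<open>f\<^sub>3\<close> at \<open>1\<close> can therefore carry a set \<open>S\<close>. The
  encoding is self-similar under doubling, so that a single test element can examine every
  \<open>n\<close>. The main obstacle is that the convenient elements, such as translations and
  doublings, lie in \<open>G\<^sub>S\<close> while simplicity and the invariant concern
  \<open>G\<^sub>S'\<close>. It is met by commutators with elements that push supports far away: on
  any compact interval they reproduce a given element of \<open>G\<^sub>S\<close>.\<close>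

context group
begin

lemma conj_generate_closed:
  assumes S: "S \<subseteq> carrier G" and x: "x \<in> carrier G"
    and cl: "\<And>s. s \<in> S \<Longrightarrow> x \<otimes> s \<otimes> inv x \<in> S" and g: "g \<in> generate G S"
  shows "x \<otimes> g \<otimes> inv x \<in> generate G S"
  using g
proof induction
  case one
  then show ?case using x generate.one by simp
next
  case (incl h)
  then show ?case using cl generate.incl by metis
next
  case (inv h)
  then have h: "h \<in> carrier G" using S by blast
  have "x \<otimes> inv h \<otimes> inv x = inv (x \<otimes> h \<otimes> inv x)"
    using x h by (simp add: inv_mult_group m_assoc)
  then show ?case using cl[OF inv] generate.inv by metis
next
  case (eng h k)
  have hk: "h \<in> carrier G" "k \<in> carrier G" using eng generate_in_carrier[OF S] by auto
  have "inv x \<otimes> (x \<otimes> (k \<otimes> inv x)) = k \<otimes> inv x" using x hk by (simp flip: m_assoc)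
  then have "x \<otimes> (h \<otimes> k) \<otimes> inv x = (x \<otimes> h \<otimes> inv x) \<otimes> (x \<otimes> k \<otimes> inv x)"
    using x hk by (simp add: m_assoc)
  then show ?case using generate.eng eng.IH by metis
qed

text \<open>Invariance under conjugation by \<open>x\<close> is the only link between
  \<open>x\<close> and \<open>S\<close>, so the lemma applies to its own conclusion: the second
  derived subgroup of \<open>K\<close> is normalised by \<open>K\<close>.\<close>

lemma conj_derived_closed:
  assumes S: "S \<subseteq> carrier G" and x: "x \<in> carrier G"
    and cl: "\<And>s. s \<in> S \<Longrightarrow> x \<otimes> s \<otimes> inv x \<in> S" and g: "g \<in> derived G S"
  shows "x \<otimes> g \<otimes> inv x \<in> derived G S"
  unfolding derived_def
proof (rule conj_generate_closed)
  show "derived_set G S \<subseteq> carrier G" using S by (rule derived_set_in_carrier)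
  show "g \<in> generate G (derived_set G S)" using g by (simp add: derived_def)
  fix s assume "s \<in> derived_set G S"
  then obtain a b where ab: "a \<in> S" "b \<in> S" and s: "s = a \<otimes> b \<otimes> inv a \<otimes> inv b" by auto
  have c: "a \<in> carrier G" "b \<in> carrier G" using ab S by auto
  have [simp]: "inv x \<otimes> (x \<otimes> z) = z" if "z \<in> carrier G" for z
    using x that by (simp flip: m_assoc)
  have "x \<otimes> s \<otimes> inv x = (x \<otimes> a \<otimes> inv x) \<otimes> (x \<otimes> b \<otimes> inv x) \<otimes>
      inv (x \<otimes> a \<otimes> inv x) \<otimes> inv (x \<otimes> b \<otimes> inv x)"
    unfolding s using x c by (simp add: inv_mult_group m_assoc)
  then show "x \<otimes> s \<otimes> inv x \<in> derived_set G S" using cl[OF ab(1)] cl[OF ab(2)] by blast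
qed (use x in auto)

text \<open>Modulo \<open>D\<close> the generators commute, hence so do all elements of
  \<open>generate G S\<close>. The induction shows this without forming a quotient, one entry of the
  commutator at a time.\<close>

lemma commutator_mem_of_generators:
  assumes D: "subgroup D G" and S: "S \<subseteq> carrier G"
    and conj: "\<And>x d. x \<in> generate G S \<Longrightarrow> d \<in> D \<Longrightarrow> x \<otimes> d \<otimes> inv x \<in> D"
    and gen: "\<And>a b. a \<in> S \<Longrightarrow> b \<in> S \<Longrightarrow> a \<otimes> b \<otimes> inv a \<otimes> inv b \<in> D"
  shows "derived G (generate G S) \<subseteq> D"
proof -
  interpret D: subgroup D G by fact
  interpret K: subgroup "generate G S" G by (rule generate_is_subgroup[OF S])
  have conj': "inv x \<otimes> d \<otimes> x \<in> D" if "x \<in> generate G S" "d \<in> D" for x d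
    using conj[of "inv x" d] that by simp
  have left: "x \<otimes> a \<otimes> inv x \<otimes> inv a \<in> D"
    if x: "x \<in> generate G S" and a: "a \<in> generate G S"
      and T: "\<And>s. s \<in> S \<Longrightarrow> s \<otimes> a \<otimes> inv s \<otimes> inv a \<in> D" for x a
    using x
  proof induction
    case one
    then show ?case using a by simp
  next
    case (incl h)
    then show ?case by (rule T)
  next
    case (inv s)
    have s: "s \<in> carrier G" "s \<in> generate G S" using inv S by (auto intro: generate.incl)
    have "inv s \<otimes> a \<otimes> inv (inv s) \<otimes> inv a =
        inv s \<otimes> inv (s \<otimes> a \<otimes> inv s \<otimes> inv a) \<otimes> s"
      using s a K.mem_carrier[OF a] by (simp add: inv_mult_group m_assoc)
    then show ?case using conj'[OF s(2)] T[OF inv] by simp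
  next
    case (eng h k)
    have c: "h \<in> carrier G" "k \<in> carrier G" "a \<in> carrier G" using eng a by auto
    have [simp]: "inv y \<otimes> (y \<otimes> z) = z" if "y \<in> carrier G" "z \<in> carrier G" for y z
      using that by (simp flip: m_assoc)
    \<comment> \<open>The identity \<open>[h k, a] = h [k, a] h^-1 [h, a]\<close>, with both factors
      in \<open>D\<close>.\<close>
    have "(h \<otimes> k) \<otimes> a \<otimes> inv (h \<otimes> k) \<otimes> inv a =
        (h \<otimes> (k \<otimes> a \<otimes> inv k \<otimes> inv a) \<otimes> inv h) \<otimes> (h \<otimes> a \<otimes> inv h \<otimes> inv a)"
      using c by (simp add: inv_mult_group m_assoc)
    then show ?case using conj[OF eng(1)] eng by simp
  qed
  \<comment> \<open>Inverting a commutator exchanges its entries, so the induction on the first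
    entry also serves for the second.\<close>
  have swap: "y \<otimes> x \<otimes> inv y \<otimes> inv x \<in> D"
    if "x \<otimes> y \<otimes> inv x \<otimes> inv y \<in> D" "x \<in> carrier G" "y \<in> carrier G" for x y
  proof -
    have "y \<otimes> x \<otimes> inv y \<otimes> inv x = inv (x \<otimes> y \<otimes> inv x \<otimes> inv y)"
      using that by (simp add: inv_mult_group m_assoc)
    then show ?thesis using that by simp
  qed
  have "x \<otimes> y \<otimes> inv x \<otimes> inv y \<in> D"
    if xy: "x \<in> generate G S" "y \<in> generate G S" for x y
  proof (rule left[OF xy])
    fix s assume s: "s \<in> S"
    have sg: "s \<in> generate G S" using s by (rule generate.incl)
    have "y \<otimes> s \<otimes> inv y \<otimes> inv s \<in> D"
      using gen s by (intro left[OF xy(2) sg])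
    then show "s \<otimes> y \<otimes> inv s \<otimes> inv y \<in> D" using swap xy sg K.mem_carrier by blast
  qed
  then have "derived_set G (generate G S) \<subseteq> D" by blast
  then show ?thesis unfolding derived_def by (rule generate_subgroup_incl[OF _ D])
qed

text \<open>Modulo the second derived subgroup, conjugation by the derived element
  \<open>X 5 \<otimes> inv (X 1)\<close> fixes \<open>X 2 \<otimes> inv (X 1)\<close>, while the relations turn it into
  \<open>X 3 \<otimes> inv (X 1)\<close>.\<close>

lemma thompson_relations_second_derived:
  fixes X :: "nat \<Rightarrow> 'a"
  assumes K: "subgroup K G" and XK: "\<And>i. X i \<in> K"
    and rel: "\<And>i j. i < j \<Longrightarrow> inv (X i) \<otimes> X j \<otimes> X i = X (Suc j)"
  shows "X 2 \<otimes> inv (X 1) \<in> derived G (derived G K)"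
proof -
  interpret K: subgroup K G by fact
  have X [simp]: "X i \<in> carrier G" for i using XK by auto
  have canc [simp]: "inv y \<otimes> (y \<otimes> z) = z" "y \<otimes> (inv y \<otimes> z) = z"
    if "y \<in> carrier G" "z \<in> carrier G" for y z
    using that by (simp_all add: m_assoc[symmetric])
  have e: "Suc 1 = 2" "Suc 2 = 3" "Suc 3 = 4" "Suc 4 = 5" "Suc 5 = 6" by simp_all
  have r: "X j \<otimes> X i = X i \<otimes> X (Suc j)" if "i < j" for i j
  proof -
    have "X i \<otimes> X (Suc j) = X i \<otimes> (inv (X i) \<otimes> X j \<otimes> X i)" using rel[OF that] by simp
    also have "\<dots> = X j \<otimes> X i" by (simp add: m_assoc)
    finally show ?thesis by simp
  qed
  have comm: "a \<otimes> b \<otimes> inv a \<otimes> inv b \<in> derived G L" if "a \<in> L" "b \<in> L" for a b L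
    unfolding derived_def using that by (intro generate.incl) blast
  have KD: "subgroup (derived G K) G" using derived_is_subgroup K.subset by blast
  interpret KD: subgroup "derived G K" G by (rule KD)
  have diff: "X (Suc j) \<otimes> inv (X j) \<in> derived G K" if "0 < j" for j
  proof -
    have "X (Suc j) \<otimes> inv (X j) = inv (X 0) \<otimes> X j \<otimes> inv (inv (X 0)) \<otimes> inv (X j)"
      using rel[OF that] by simp
    then show ?thesis using comm[of "inv (X 0)" K "X j"] XK by simp
  qed
  have diffs: "X 5 \<otimes> inv (X 4) \<in> derived G K" "X 4 \<otimes> inv (X 3) \<in> derived G K"
    "X 3 \<otimes> inv (X 2) \<in> derived G K" "X 2 \<otimes> inv (X 1) \<in> derived G K"
    using diff[of 4, unfolded e] diff[of 3, unfolded e] diff[of 2, unfolded e]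
      diff[of 1, unfolded e] by simp_all
  define u where "u = X 5 \<otimes> inv (X 1)"
  have u: "u = (X 5 \<otimes> inv (X 4)) \<otimes> ((X 4 \<otimes> inv (X 3)) \<otimes>
      ((X 3 \<otimes> inv (X 2)) \<otimes> (X 2 \<otimes> inv (X 1))))"
    by (simp add: u_def m_assoc)
  have uD: "u \<in> derived G K"
    unfolding u using KD.m_closed[OF diffs(1) KD.m_closed[OF diffs(2) KD.m_closed[OF diffs(3,4)]]] .
  have x3: "X 3 = inv (X 1) \<otimes> X 2 \<otimes> X 1" using rel[of 1 2, unfolded e] by simp
  have y: "inv (X 1) \<otimes> (X 2 \<otimes> inv (X 1)) \<otimes> X 1 = X 3 \<otimes> inv (X 1)"
    unfolding x3 by (simp add: m_assoc)
  have x6: "X 6 = inv (X 1) \<otimes> X 5 \<otimes> X 1" using rel[of 1 5, unfolded e] by simp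
  \<comment> \<open>Conjugation by \<open>X 1\<close> and by \<open>X 3\<close> both turn
    \<open>X 5\<close> into \<open>X 6\<close>, so \<open>X 3 \<otimes> inv (X 1)\<close> commutes
    with \<open>X 5\<close>.\<close>
  have x5: "X 5 \<otimes> (X 3 \<otimes> inv (X 1)) = (X 3 \<otimes> inv (X 1)) \<otimes> X 5"
  proof -
    have "X 5 \<otimes> X 3 = X 3 \<otimes> X 6" using r[of 3 5, unfolded e] by simp
    then have "X 5 \<otimes> X 3 \<otimes> inv (X 1) = X 3 \<otimes> X 6 \<otimes> inv (X 1)" by simp
    then show ?thesis unfolding x6 by (simp add: m_assoc)
  qed
  have "u \<otimes> (X 2 \<otimes> inv (X 1)) \<otimes> inv u = X 5 \<otimes> (X 3 \<otimes> inv (X 1)) \<otimes> inv (X 5)"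
    unfolding u_def y[symmetric] by (simp add: inv_mult_group m_assoc)
  also have "\<dots> = X 3 \<otimes> inv (X 1)" unfolding x5 by (simp add: m_assoc)
  finally have "u \<otimes> (X 2 \<otimes> inv (X 1)) \<otimes> inv u \<otimes> inv (X 2 \<otimes> inv (X 1)) =
      X 3 \<otimes> inv (X 1) \<otimes> inv (X 2 \<otimes> inv (X 1))" by simp
  also have "\<dots> = X 3 \<otimes> inv (X 2)" by (simp add: inv_mult_group m_assoc)
  finally have y2: "X 3 \<otimes> inv (X 2) \<in> derived G (derived G K)"
    using comm[OF uD diffs(4)] by simp
  \<comment> \<open>Undoing the relations for \<open>X 0\<close> lowers the indices by one and
    yields the element wanted.\<close>
  have "X 0 \<otimes> (X 3 \<otimes> inv (X 2)) \<otimes> inv (X 0) \<in> derived G (derived G K)"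
  proof (rule conj_derived_closed[OF _ _ _ y2])
    fix s assume "s \<in> derived G K"
    then show "X 0 \<otimes> s \<otimes> inv (X 0) \<in> derived G K"
      using XK K.subset by (intro conj_derived_closed) auto
  qed (use KD.subset in auto)
  moreover have "X 0 \<otimes> (X 3 \<otimes> inv (X 2)) \<otimes> inv (X 0) = X 2 \<otimes> inv (X 1)"
  proof -
    have "X 3 = inv (X 0) \<otimes> X 2 \<otimes> X 0" "inv (X 0) \<otimes> X 1 \<otimes> X 0 = X 2"
      using rel[of 0 2, unfolded e] rel[of 0 1, unfolded e] by simp_all
    then have "X 3 \<otimes> inv (X 2) = inv (X 0) \<otimes> X 2 \<otimes> X 0 \<otimes> inv (inv (X 0) \<otimes> X 1 \<otimes> X 0)" by simp
    then show ?thesis by (simp add: inv_mult_group m_assoc)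
  qed
  ultimately show ?thesis by simp
qed

end

section \<open>The group of increasing homeomorphisms of the line\<close>

abbreviation hinv :: "(real \<Rightarrow> real) \<Rightarrow> real \<Rightarrow> real" where
  "hinv \<equiv> inv_into UNIV"

lemma strict_mono_inv_real:
  fixes h :: "real \<Rightarrow> real"
  assumes "strict_mono h" "surj h" shows "strict_mono (hinv h)" "surj (hinv h)"
proof -
  have b: "bij h" using assms by (auto simp: bij_def strict_mono_imp_inj_on)
  show "strict_mono (hinv h)"
    using assms bij_inv_eq_iff[OF b] by (metis strict_mono_less strict_monoI)
  show "surj (hinv h)" using b by (simp add: bij_betw_inv_into bij_is_surj)
qed

text \<open>A monotone surjection of the line has no jumps, hence is continuous, and its inverse is
  of the same kind. Membership of explicit maps becomes a matter of order alone.\<close>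

lemma mem_carrier_real:
  "h \<in> carrier Homeo_plus_real \<longleftrightarrow> strict_mono h \<and> surj h"
proof
  assume "h \<in> carrier Homeo_plus_real"
  then show "strict_mono h \<and> surj h"
    using quotient_imp_surjective_map[of euclideanreal euclideanreal h]
    by (auto simp: carrier_Homeo_plus_real homeomorphic_map_def)
next
  have cont: "continuous_on UNIV k" if "strict_mono k" "surj k" for k :: "real \<Rightarrow> real"
    using that by (intro continuous_onI_mono) (auto simp: strict_mono_less_eq)
  assume h: "strict_mono h \<and> surj h"
  then have b: "bij h" by (auto simp: bij_def strict_mono_imp_inj_on)
  have r: "h (hinv h x) = x" and l: "hinv h (h x) = x" for x
    using surj_f_inv_f[of h x] inv_f_f[of h x] b by (auto simp only: bij_def)
  have "continuous_map euclideanreal euclideanreal h"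
    "continuous_map euclideanreal euclideanreal (hinv h)"
    using cont[of h] cont[of "hinv h"] h strict_mono_inv_real[of h] by simp_all
  then have "homeomorphic_maps euclideanreal euclideanreal h (hinv h)"
    unfolding homeomorphic_maps_def using l r by simp
  then show "h \<in> carrier Homeo_plus_real"
    using h homeomorphic_maps_imp_map[of euclideanreal euclideanreal h "hinv h"]
    by (simp add: carrier_Homeo_plus_real)
qed

lemma one_real [simp]: "\<one>\<^bsub>Homeo_plus_real\<^esub> = id"
  by (auto simp: Homeo_plus_real_def Homeo_plus_def BijGroup_def)

lemma group_real: "group Homeo_plus_real"
  unfolding Homeo_plus_real_def by (rule group_Homeo_plus[OF oriented_atlas_real])

interpretation HR: group Homeo_plus_real by (rule group_real)

lemma Bij_real: "h \<in> carrier Homeo_plus_real \<Longrightarrow> h \<in> Bij UNIV"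
  by (auto simp: mem_carrier_real Bij_def bij_def strict_mono_imp_inj_on)

lemma mult_real [simp]:
  "g \<in> carrier Homeo_plus_real \<Longrightarrow> h \<in> carrier Homeo_plus_real \<Longrightarrow>
     g \<otimes>\<^bsub>Homeo_plus_real\<^esub> h = g \<circ> h"
  using Bij_real[of g] Bij_real[of h]
  by (simp add: Homeo_plus_real_def Homeo_plus_def BijGroup_def compose_def fun_eq_iff)

lemma inv_real [simp]:
  assumes "h \<in> carrier Homeo_plus_real"
  shows "inv\<^bsub>Homeo_plus_real\<^esub> h = hinv h"
proof (rule HR.inv_equality)
  have h: "strict_mono h" "surj h" "inj h"
    using assms by (auto simp: mem_carrier_real strict_mono_imp_inj_on)
  show "hinv h \<in> carrier Homeo_plus_real"
    using strict_mono_inv_real[OF h(1,2)] by (simp add: mem_carrier_real)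
  then show "hinv h \<otimes>\<^bsub>Homeo_plus_real\<^esub> h = \<one>\<^bsub>Homeo_plus_real\<^esub>"
    using h assms by (simp add: inv_o_cancel)
qed (use assms in simp)

text \<open>Later proofs quote these rules by position: 5 to 7 compare values of \<open>h\<close>, 8
  and 9 cancel, 10 to 14 move \<open>hinv h\<close> to the other side of a comparison.\<close>

lemma real_carrier_simps:
  assumes "h \<in> carrier Homeo_plus_real"
  shows "inj h" "surj h" "bij h" "strict_mono h"
    "h x < h y \<longleftrightarrow> x < y" "h x \<le> h y \<longleftrightarrow> x \<le> y" "h x = h y \<longleftrightarrow> x = y"
    "hinv h (h x) = x" "h (hinv h x) = x"
    "hinv h x < y \<longleftrightarrow> x < h y" "x < hinv h y \<longleftrightarrow> h x < y"
    "hinv h x \<le> y \<longleftrightarrow> x \<le> h y" "x \<le> hinv h y \<longleftrightarrow> h x \<le> y"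
    "hinv h x = y \<longleftrightarrow> x = h y"
proof -
  have h: "strict_mono h" "surj h" using assms by (auto simp: mem_carrier_real)
  show "inj h" "surj h" "bij h" "strict_mono h"
    using h by (auto simp: strict_mono_imp_inj_on bij_def)
  show less: "h x < h y \<longleftrightarrow> x < y" for x y using h(1) by (rule strict_mono_less)
  show le: "h x \<le> h y \<longleftrightarrow> x \<le> y" for x y using h(1) by (rule strict_mono_less_eq)
  show eq: "h x = h y \<longleftrightarrow> x = y" for x y using h(1) by (rule strict_mono_eq)
  show "hinv h (h x) = x" for x using \<open>inj h\<close> by simp
  show r: "h (hinv h x) = x" for x using \<open>surj h\<close> by (simp add: surj_f_inv_f)
  show "hinv h x < y \<longleftrightarrow> x < h y" "x < hinv h y \<longleftrightarrow> h x < y"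
    "hinv h x \<le> y \<longleftrightarrow> x \<le> h y" "x \<le> hinv h y \<longleftrightarrow> h x \<le> y"
    "hinv h x = y \<longleftrightarrow> x = h y"
    using less[of "hinv h x" y] less[of x "hinv h y"] le[of "hinv h x" y] le[of x "hinv h y"]
      eq[of "hinv h x" y] r by auto
qed

lemma comp_real_closed [simp]:
  "g \<in> carrier Homeo_plus_real \<Longrightarrow> h \<in> carrier Homeo_plus_real \<Longrightarrow>
     g \<circ> h \<in> carrier Homeo_plus_real"
  using HR.m_closed[of g h] by simp

lemma inv_real_closed [simp]:
  "h \<in> carrier Homeo_plus_real \<Longrightarrow> hinv h \<in> carrier Homeo_plus_real"
  using HR.inv_closed[of h] by simp

lemma id_real_closed [simp]: "id \<in> carrier Homeo_plus_real"
  using HR.one_closed by simp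

lemma subgroup_real_closed:
  assumes "subgroup K Homeo_plus_real"
  shows "id \<in> K" "g \<in> K \<Longrightarrow> h \<in> K \<Longrightarrow> g \<circ> h \<in> K" "h \<in> K \<Longrightarrow> hinv h \<in> K"
    "h \<in> K \<Longrightarrow> h \<in> carrier Homeo_plus_real" "h \<in> K \<Longrightarrow> h ^^ n \<in> K"
proof -
  interpret K: subgroup K Homeo_plus_real by fact
  show "id \<in> K" using K.one_closed by simp
  show c: "g \<circ> h \<in> K" if "g \<in> K" "h \<in> K" for g h
    using K.m_closed[OF that] K.mem_carrier that by simp
  show "h \<in> K \<Longrightarrow> hinv h \<in> K" using K.m_inv_closed[of h] K.mem_carrier by simp
  show "h \<in> K \<Longrightarrow> h \<in> carrier Homeo_plus_real" by (rule K.mem_carrier)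
  show "h \<in> K \<Longrightarrow> h ^^ n \<in> K" using c \<open>id \<in> K\<close> by (induction n) auto
qed

section \<open>Recognizing Thompson's group\<close>

primrec word_value :: "('a, 'b) monoid_scheme \<Rightarrow> ('g \<Rightarrow> 'a) \<Rightarrow> 'g word \<Rightarrow> 'a" where
  "word_value G x [] = \<one>\<^bsub>G\<^esub>"
| "word_value G x (a # w) =
     (if snd a then x (fst a) else inv\<^bsub>G\<^esub> (x (fst a))) \<otimes>\<^bsub>G\<^esub> word_value G x w"

context group
begin

lemma word_value_closed: "range x \<subseteq> carrier G \<Longrightarrow> word_value G x w \<in> carrier G"
  by (induction w) (auto simp: image_subset_iff)

lemma word_value_append:
  assumes "range x \<subseteq> carrier G"
  shows "word_value G x (u @ v) = word_value G x u \<otimes> word_value G x v"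
  using assms word_value_closed[OF assms]
  by (induction u) (auto simp: m_assoc image_subset_iff)

lemma word_value_word_eq:
  assumes x: "range x \<subseteq> carrier G"
    and rel: "\<And>r s. (r, s) \<in> R \<Longrightarrow> word_value G x r = word_value G x s"
    and eq: "word_eq R u v"
  shows "word_value G x u = word_value G x v"
  using eq
proof induction
  case (cancel u g b v)
  have "word_value G x [(g, b), (g, \<not> b)] = \<one>"
    using x by (simp add: image_subset_iff)
  then have "word_value G x ([(g, b), (g, \<not> b)] @ v) = word_value G x v"
    using word_value_closed[OF x] by (simp only: word_value_append[OF x] l_one)
  then show ?case by (simp only: word_value_append[OF x])
next
  case (relation r s u v)
  then show ?case using rel by (simp add: word_value_append[OF x])
qed auto

lemma range_word_value:
  assumes x: "range x \<subseteq> carrier G"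
  shows "range (word_value G x) = generate G (range x)"
proof
  have [simp]: "x i \<in> carrier G" for i using x by blast
  have "word_value G x w \<in> generate G (range x)" for w
    by (induction w) (auto intro: generate.intros)
  then show "range (word_value G x) \<subseteq> generate G (range x)" by blast
  show "generate G (range x) \<subseteq> range (word_value G x)"
  proof
    fix g assume "g \<in> generate G (range x)"
    then show "g \<in> range (word_value G x)"
    proof induction
      case one
      have "\<one> = word_value G x []" by simp
      then show ?case by blast
    next
      case (incl h)
      then obtain i where "h = x i" by blast
      then have "h = word_value G x [(i, True)]" by simp
      then show ?case by blast
    next
      case (inv h)
      then obtain i where "h = x i" by blast
      then have "inv h = word_value G x [(i, False)]" by simp
      then show ?case by blast
    next
      case (eng g h)
      then obtain u v where "g = word_value G x u" "h = word_value G x v" by blast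
      then have "g \<otimes> h = word_value G x (u @ v)" by (simp add: word_value_append[OF x])
      then show ?case by blast
    qed
  qed
qed

text \<open>Evaluation of words descends to the presented group by \<open>rel\<close>, is onto the
  generated subgroup, and has trivial kernel by \<open>faithful\<close>.\<close>

lemma generate_iso_presented_group:
  assumes x: "range x \<subseteq> carrier G"
    and rel: "\<And>r s. (r, s) \<in> R \<Longrightarrow> word_value G x r = word_value G x s"
    and faithful: "\<And>w. word_value G x w = \<one> \<Longrightarrow> word_eq R w []"
  shows "G\<lparr>carrier := generate G (range x)\<rparr> \<cong> presented_group R"
proof -
  let ?P = "presented_group R" and ?K = "G\<lparr>carrier := generate G (range x)\<rparr>"
  define \<psi> where "\<psi> A = word_value G x (SOME u. u \<in> A)" for A :: "'c word set"
  have \<psi>: "\<psi> (word_rel R `` {u}) = word_value G x u" for u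
  proof -
    have "u \<in> word_rel R `` {u}" by (simp add: word_rel_def word_eq.refl)
    then have "(SOME v. v \<in> word_rel R `` {u}) \<in> word_rel R `` {u}" by (rule someI)
    then have "word_eq R u (SOME v. v \<in> word_rel R `` {u})" by (simp add: word_rel_def)
    from word_value_word_eq[OF x rel this] show ?thesis by (simp add: \<psi>_def)
  qed
  have carr: "\<exists>u. A = word_rel R `` {u}" if "A \<in> carrier ?P" for A
    using that by (auto simp: presented_group_def quotient_def)
  have mem: "word_rel R `` {u} \<in> carrier ?P" for u
    by (auto simp: presented_group_def quotient_def)
  have K: "group ?K" using generate_is_subgroup[OF x] subgroup.subgroup_is_group by blast
  have hom: "\<psi> \<in> hom ?P ?K"
  proof (rule homI)
    fix A assume "A \<in> carrier ?P"
    then obtain u where "A = word_rel R `` {u}" using carr by blast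
    then show "\<psi> A \<in> carrier ?K" using range_word_value[OF x] by (auto simp: \<psi>)
  next
    fix A B assume "A \<in> carrier ?P" "B \<in> carrier ?P"
    then obtain u v where "A = word_rel R `` {u}" "B = word_rel R `` {v}" using carr by blast
    then show "\<psi> (A \<otimes>\<^bsub>?P\<^esub> B) = \<psi> A \<otimes>\<^bsub>?K\<^esub> \<psi> B"
      by (simp add: mult_presented_group \<psi> word_value_append[OF x])
  qed
  interpret \<psi>: group_hom ?P ?K \<psi>
    by (intro group_hom.intro group_hom_axioms.intro K hom group_presented_group)
  have "A = \<one>\<^bsub>?P\<^esub>" if A: "A \<in> carrier ?P" "\<psi> A = \<one>" for A
  proof -
    obtain u where u: "A = word_rel R `` {u}" using A(1) carr by blast
    then have "word_eq R u []" using A(2) by (intro faithful) (simp add: \<psi>)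
    then show ?thesis
      using equiv_class_eq[OF equiv_word_rel, of u "[]" R]
      by (simp add: u presented_group_def word_rel_def)
  qed
  then have "inj_on \<psi> (carrier ?P)"
    using \<psi>.inj_iff_trivial_ker by (auto simp: kernel_def)
  moreover have "\<psi> ` carrier ?P = carrier ?K"
  proof -
    have "\<psi> ` carrier ?P = range (word_value G x)"
    proof (intro equalityI subsetI)
      fix g assume "g \<in> \<psi> ` carrier ?P"
      then obtain A where A: "A \<in> carrier ?P" "g = \<psi> A" by blast
      obtain u where "A = word_rel R `` {u}" using carr[OF A(1)] by blast
      then have "g = word_value G x u" using A(2) \<psi> by simp
      then show "g \<in> range (word_value G x)" by blast
    next
      fix g assume "g \<in> range (word_value G x)"
      then obtain u where "g = word_value G x u" by blast
      then have "g = \<psi> (word_rel R `` {u})" using \<psi> by simp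
      then show "g \<in> \<psi> ` carrier ?P" using mem by blast
    qed
    then show ?thesis using range_word_value[OF x] by simp
  qed
  ultimately have "?P \<cong> ?K" using hom by (auto simp: is_iso_def iso_def bij_betw_def)
  then show ?thesis using group.iso_sym[OF group_presented_group] by blast
qed

end

section \<open>Normal forms of words in Thompson's group\<close>

definition pos_word :: "nat list \<Rightarrow> nat word" where
  "pos_word p = map (\<lambda>i. (i, True)) p"

text \<open>The reversal makes this the formal inverse of \<open>pos_word p\<close>, so that
  \<open>pos_word p @ neg_word q\<close> stands for a fraction of positive words.\<close>

definition neg_word :: "nat list \<Rightarrow> nat word" where
  "neg_word p = map (\<lambda>i. (i, False)) (rev p)"

definition Thompson_relations :: "(nat word \<times> nat word) set" where
  "Thompson_relations = {([(i, False), (j, True), (i, True)], [(j + 1, True)]) | i j. i < j}"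

abbreviation thompson_eq :: "nat word \<Rightarrow> nat word \<Rightarrow> bool" (infix \<open>\<simeq>\<close> 50) where
  "u \<simeq> v \<equiv> word_eq Thompson_relations u v"

declare word_eq.trans [trans]

lemma word_eq_append_both:
  "word_eq R u v \<Longrightarrow> word_eq R (a @ u @ b) (a @ v @ b)"
  by (intro word_eq_append_left word_eq_append_right)

lemma word_eq_cancel_left: "word_eq R ((g, b) # (g, \<not> b) # v) v"
  using word_eq.cancel[of R "[]" g b v] by simp

lemma Thompson_swap_pos:
  assumes "i < j" shows "(j, True) # (i, True) # w \<simeq> (i, True) # (Suc j, True) # w"
proof -
  have "([(i, False), (j, True), (i, True)], [(j + 1, True)]) \<in> Thompson_relations"
    using assms by (auto simp: Thompson_relations_def)
  note r = word_eq.relation[OF this, of "[(i, True)]" w]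
  have "(j, True) # (i, True) # w \<simeq> (i, True) # (i, False) # (j, True) # (i, True) # w"
    using word_eq.sym[OF word_eq_cancel_left[of _ i True]] by simp
  also have "\<dots> \<simeq> (i, True) # (Suc j, True) # w"
    using r by simp
  finally show ?thesis .
qed

lemma Thompson_swap_neg_less:
  assumes "i < j" shows "(i, False) # (j, True) # w \<simeq> (Suc j, True) # (i, False) # w"
proof -
  have "(i, False) # (j, True) # w \<simeq> (i, False) # (j, True) # (i, True) # (i, False) # w"
    using word_eq.sym[OF word_eq.cancel[of _ "[(i, False), (j, True)]" i True w]] by simp
  also have "\<dots> \<simeq> (i, False) # (i, True) # (Suc j, True) # (i, False) # w"
    using word_eq_append_left[OF Thompson_swap_pos[OF assms], of "[(i, False)]"] by simp
  also have "\<dots> \<simeq> (Suc j, True) # (i, False) # w"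
    using word_eq_cancel_left[of _ i False] by simp
  finally show ?thesis .
qed

lemma Thompson_swap_neg_greater:
  assumes "i < j" shows "(j, False) # (i, True) # w \<simeq> (i, True) # (Suc j, False) # w"
proof -
  have "(j, False) # (i, True) # w \<simeq> (j, False) # (i, True) # (Suc j, True) # (Suc j, False) # w"
    using word_eq.sym[OF word_eq.cancel[of _ "[(j, False), (i, True)]" "Suc j" True w]] by simp
  also have "\<dots> \<simeq> (j, False) # (j, True) # (i, True) # (Suc j, False) # w"
    using word_eq.sym[OF word_eq_append_left[OF Thompson_swap_pos[OF assms], of "[(j, False)]"]]
    by simp
  also have "\<dots> \<simeq> (i, True) # (Suc j, False) # w"
    using word_eq_cancel_left[of _ j False] by simp
  finally show ?thesis .
qed

text \<open>Insertion sort: a letter too large for its place moves right, and each smaller letter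
  that it passes raises it by one.\<close>

lemma pos_word_sorted: "\<exists>q. sorted q \<and> pos_word p \<simeq> pos_word q"
proof (induction p)
  case Nil
  show ?case by (intro exI[of _ "[]"]) (simp add: word_eq.refl)
next
  case (Cons k p)
  \<comment> \<open>The inserted letter changes during the recursion, so a bound on the letters of
    the result is part of the induction; it keeps \<open>i # r\<close> sorted.\<close>
  have insert: "\<exists>r. sorted r \<and> (\<forall>m \<in> set r. m \<ge> k \<or> m \<in> set q) \<and>
      (k, True) # pos_word q \<simeq> pos_word r" if "sorted q" for k q
    using that
  proof (induction q arbitrary: k)
    case Nil
    show ?case by (intro exI[of _ "[k]"]) (simp add: pos_word_def word_eq.refl)
  next
    case (Cons i q)
    show ?case
    proof (cases "k \<le> i")
      case True
      then show ?thesis using Cons.prems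
        by (intro exI[of _ "k # i # q"]) (auto simp: pos_word_def word_eq.refl)
    next
      case False
      then have ik: "i < k" by simp
      obtain r where r: "sorted r" "\<forall>m \<in> set r. m \<ge> Suc k \<or> m \<in> set q"
          "(Suc k, True) # pos_word q \<simeq> pos_word r"
        using Cons.IH[of "Suc k"] Cons.prems by auto
      have "(k, True) # (i, True) # pos_word q \<simeq> (i, True) # (Suc k, True) # pos_word q"
        by (rule Thompson_swap_pos[OF ik])
      moreover have "(i, True) # (Suc k, True) # pos_word q \<simeq> (i, True) # pos_word r"
        using word_eq_append_left[OF r(3), of "[(i, True)]"] by simp
      ultimately have "(k, True) # (i, True) # pos_word q \<simeq> (i, True) # pos_word r"
        by (rule word_eq.trans)
      moreover have "sorted (i # r)" using r ik Cons.prems by fastforce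
      ultimately show ?thesis
        using r(2) ik by (intro exI[of _ "i # r"]) (auto simp: pos_word_def)
    qed
  qed
  obtain q where q: "sorted q" "pos_word p \<simeq> pos_word q" using Cons.IH by blast
  obtain r where r: "sorted r" "(k, True) # pos_word q \<simeq> pos_word r"
    using insert[OF q(1)] by blast
  have "pos_word (k # p) \<simeq> (k, True) # pos_word q"
    using word_eq_append_left[OF q(2), of "[(k, True)]"] by (simp add: pos_word_def)
  also note r(2)
  finally show ?case using r(1) by blast
qed

text \<open>An inverse letter can be moved through a positive word: each swap leaves one positive
  letter in front and one inverse letter facing a shorter word, unless the two letters
  cancel.\<close>

lemma Thompson_fraction: "\<exists>p q. w \<simeq> pos_word p @ neg_word q"
proof (induction w)
  case Nil
  show ?case by (intro exI[of _ "[]"]) (simp add: pos_word_def neg_word_def word_eq.refl)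
next
  case (Cons a w)
  have push: "\<exists>p' q'. (k, False) # pos_word p \<simeq> pos_word p' @ neg_word q'" for k p
  proof (induction p arbitrary: k)
    case Nil
    show ?case
      by (intro exI[of _ "[]"] exI[of _ "[k]"]) (simp add: pos_word_def neg_word_def word_eq.refl)
  next
    case (Cons i p)
    have step: ?case
      if 1: "(k, False) # (i, True) # pos_word p \<simeq> (j, True) # (l, False) # pos_word p" for j l
    proof -
      obtain p' q' where "(l, False) # pos_word p \<simeq> pos_word p' @ neg_word q'"
        using Cons.IH by blast
      note pq = word_eq_append_left[OF this, of "[(j, True)]"]
      note 1
      also have "(j, True) # (l, False) # pos_word p \<simeq> pos_word (j # p') @ neg_word q'"
        using pq by (simp add: pos_word_def)
      finally have "(k, False) # pos_word (i # p) \<simeq> pos_word (j # p') @ neg_word q'"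
        by (simp add: pos_word_def)
      then show ?thesis by blast
    qed
    consider "i < k" | "i = k" | "k < i" by linarith
    then show ?case
    proof cases
      case 1
      show ?thesis by (rule step[OF Thompson_swap_neg_greater[OF 1]])
    next
      case 2
      then have "(k, False) # pos_word (i # p) \<simeq> pos_word p @ neg_word []"
        using word_eq_cancel_left[of _ k False "pos_word p"]
        by (simp add: pos_word_def neg_word_def)
      then show ?thesis by blast
    next
      case 3
      show ?thesis by (rule step[OF Thompson_swap_neg_less[OF 3]])
    qed
  qed
  obtain k b where a: "a = (k, b)" by (cases a)
  obtain p q where pq: "w \<simeq> pos_word p @ neg_word q" using Cons.IH by blast
  have aw: "a # w \<simeq> a # pos_word p @ neg_word q"
    using word_eq_append_left[OF pq, of "[a]"] by simp
  show ?case
  proof (cases b)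
    case True
    then have "a # w \<simeq> pos_word (k # p) @ neg_word q" using aw by (simp add: a pos_word_def)
    then show ?thesis by blast
  next
    case False
    obtain p' q' where "(k, False) # pos_word p \<simeq> pos_word p' @ neg_word q'" using push by blast
    then have "((k, False) # pos_word p) @ neg_word q \<simeq> (pos_word p' @ neg_word q') @ neg_word q"
      by (rule word_eq_append_right)
    then have "a # pos_word p @ neg_word q \<simeq> pos_word p' @ neg_word (q @ q')"
      using False by (simp add: a neg_word_def)
    from word_eq.trans[OF aw this] show ?thesis by blast
  qed
qed

lemma pos_word_neg_word: "word_eq R (pos_word p @ neg_word p) []"
proof (induction p)
  case Nil
  show ?case by (simp add: pos_word_def neg_word_def word_eq.refl)
next
  case (Cons i p)
  have "word_eq R ([(i, True)] @ (pos_word p @ neg_word p) @ [(i, False)])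
      ([(i, True)] @ [] @ [(i, False)])"
    by (rule word_eq_append_both[OF Cons.IH])
  then have "word_eq R (pos_word (i # p) @ neg_word (i # p)) [(i, True), (i, False)]"
    by (simp add: pos_word_def neg_word_def)
  also have "word_eq R [(i, True), (i, False)] []"
    using word_eq_cancel_left[of R i True "[]"] by simp
  finally show ?case .
qed

section \<open>Faithful actions of Thompson's group on the line\<close>

lemma word_value_pos_real:
  assumes "range X \<subseteq> carrier Homeo_plus_real"
  shows "word_value Homeo_plus_real X (pos_word (i # p)) t =
    X i (word_value Homeo_plus_real X (pos_word p) t)"
  using assms HR.word_value_closed[OF assms]
  by (simp add: pos_word_def image_subset_iff)

text \<open>Distinct sorted positive words are separated by the points \<open>t i\<close>: after cancelling a
  common prefix only the word that starts with the smaller letter \<open>i\<close> moves \<open>t i\<close>.\<close>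

lemma sorted_pos_words_separated:
  assumes X: "range X \<subseteq> carrier Homeo_plus_real"
    and le: "\<And>i s. X i s \<le> s"
    and moved: "\<And>i. X i (t i) < t i" and fixed: "\<And>i j. i < j \<Longrightarrow> X j (t i) = t i"
    and "sorted p" "sorted q"
    and "word_value Homeo_plus_real X (pos_word p) = word_value Homeo_plus_real X (pos_word q)"
  shows "p = q"
proof -
  let ?v = "\<lambda>p. word_value Homeo_plus_real X (pos_word p)"
  have nil: "?v [] s = s" for s by (simp add: pos_word_def)
  note cons = word_value_pos_real[OF X]
  have vle: "?v p s \<le> s" for p s
  proof (induction p)
    case (Cons i p)
    then show ?case using le[of i "?v p s"] by (simp add: cons)
  qed (simp add: nil)
  have vfix: "?v p (t i) = t i" if "\<forall>j \<in> set p. i < j" for p i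
    using that by (induction p) (simp_all add: nil cons fixed)
  have vmove: "?v (i # p) (t i) < t i" for i p
  proof -
    have "X i (?v p (t i)) \<le> X i (t i)"
      using X vle by (simp add: image_subset_iff real_carrier_simps)
    then show ?thesis using moved[of i] by (simp add: cons)
  qed
  show ?thesis
    using assms(5-7)
  proof (induction p arbitrary: q)
    case Nil
    show ?case
    proof (cases q)
      case (Cons j q')
      then show ?thesis using Nil vmove[of j q'] nil[of "t j"] by simp
    qed simp
  next
    case (Cons i p)
    show ?case
    proof (cases q)
      case Nil
      then show ?thesis using Cons vmove[of i p] nil[of "t i"] by simp
    next
      case q: (Cons j q')
      consider "i < j" | "j < i" | "i = j" by linarith
      then show ?thesis
      proof cases
        case 1
        then have "?v q (t i) = t i" using Cons.prems q by (intro vfix) auto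
        then show ?thesis using vmove[of i p] Cons.prems by simp
      next
        case 2
        then have "?v (i # p) (t j) = t j" using Cons.prems by (intro vfix) auto
        then show ?thesis using vmove[of j q'] Cons.prems q by simp
      next
        case 3
        have "?v p s = ?v q' s" for s
        proof -
          have "?v (i # p) s = ?v q s" using Cons.prems by simp
          then show ?thesis using X 3 q by (simp add: cons image_subset_iff real_carrier_simps)
        qed
        then have "p = q'" using Cons.prems q by (intro Cons.IH) auto
        then show ?thesis using 3 q by simp
      qed
    qed
  qed
qed

text \<open>Every word is a fraction of two positive words, which may be sorted. If its value is
  trivial, both have the same value and, being separated by the points \<open>t i\<close>, are
  equal; the relations then cancel the fraction.\<close>

lemma Thompson_recognition:
  assumes X: "range X \<subseteq> carrier Homeo_plus_real"
    and rel: "\<And>i j s. i < j \<Longrightarrow> X j (X i s) = X i (X (Suc j) s)"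
    and le: "\<And>i s. X i s \<le> s"
    and moved: "\<And>i. X i (t i) < t i" and fixed: "\<And>i j. i < j \<Longrightarrow> X j (t i) = t i"
  shows "Homeo_plus_real\<lparr>carrier := generate Homeo_plus_real (range X)\<rparr> \<cong> Thompson_F"
proof -
  have Xc [simp]: "X i \<in> carrier Homeo_plus_real" for i using X by auto
  let ?v = "word_value Homeo_plus_real X"
  have value_rel: "?v r = ?v s" if rs: "(r, s) \<in> Thompson_relations" for r s
  proof -
    obtain i j where ij: "i < j" "r = [(i, False), (j, True), (i, True)]" "s = [(Suc j, True)]"
      using rs by (auto simp: Thompson_relations_def)
    have "hinv (X i) (X j (X i s)) = X (Suc j) s" for s
      using rel[OF ij(1)] by (simp add: real_carrier_simps)
    then show ?thesis using ij by (simp add: fun_eq_iff)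
  qed
  show ?thesis
    unfolding Thompson_F_def Thompson_relations_def[symmetric]
  proof (rule HR.generate_iso_presented_group[OF X])
    fix w assume w: "?v w = \<one>\<^bsub>Homeo_plus_real\<^esub>"
    obtain p q where pq: "w \<simeq> pos_word p @ neg_word q" using Thompson_fraction by blast
    obtain p' where p': "sorted p'" "pos_word p \<simeq> pos_word p'" using pos_word_sorted by blast
    obtain q' where q': "sorted q'" "pos_word q \<simeq> pos_word q'" using pos_word_sorted by blast
    have veq: "?v u = ?v v" if "u \<simeq> v" for u v
      using HR.word_value_word_eq[OF X value_rel that] .
    have "?v (pos_word p @ neg_word q) = ?v (pos_word q @ neg_word q)"
      using w veq[OF pq] veq[OF pos_word_neg_word[of _ q]] by simp
    then have "?v (pos_word p) = ?v (pos_word q)"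
      using HR.word_value_closed[OF X] by (simp only: HR.word_value_append[OF X] HR.right_cancel)
    then have "?v (pos_word p') = ?v (pos_word q')"
      using veq[OF p'(2)] veq[OF q'(2)] by simp
    then have "p' = q'"
      using sorted_pos_words_separated[OF X le moved fixed p'(1) q'(1)] by blast
    then have "pos_word q' \<simeq> pos_word q" "pos_word p \<simeq> pos_word q'"
      using p'(2) word_eq.sym[OF q'(2)] by simp_all
    then have "pos_word p \<simeq> pos_word q" using word_eq.trans by blast
    note pq
    also have "pos_word p @ neg_word q \<simeq> pos_word q @ neg_word q"
      by (rule word_eq_append_right) fact
    also have "pos_word q @ neg_word q \<simeq> []" by (rule pos_word_neg_word)
    finally show "w \<simeq> []" .
  qed (rule value_rel)
qed

text \<open>The hypotheses say that \<open>f\<close> and \<open>g\<close> form a chain whose overlap is crossed by \<open>g \<circ> f\<close>.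
  The generators of Thompson's group are \<open>x\<^sub>0 = (g \<circ> f)\<inverse>\<close>, \<open>x\<^sub>1 = g\<inverse>\<close> and the conjugates of \<open>x\<^sub>1\<close>
  under powers of \<open>x\<^sub>0\<close>; from \<open>x\<^sub>2\<close> on they commute with \<open>f\<close>, which gives the relations.\<close>

lemma chain_pair_Thompson:
  assumes f: "f \<in> carrier Homeo_plus_real" and g: "g \<in> carrier Homeo_plus_real"
    and f_ge: "\<And>s. s \<le> f s" and g_ge: "\<And>s. s \<le> g s"
    and f_fix: "\<And>s. b \<le> s \<Longrightarrow> f s = s" and g_fix: "\<And>s. s \<le> c \<Longrightarrow> g s = s"
    and cross: "b \<le> g (f c)" and r: "r \<le> c" "r < f r"
    and g_moves: "g (f c) < g (g (f c))"
  shows "Homeo_plus_real\<lparr>carrier := generate Homeo_plus_real {f, g}\<rparr> \<cong> Thompson_F" (is ?iso)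
    and "g \<circ> f \<circ> hinv g \<circ> hinv f \<in>
      derived Homeo_plus_real (derived Homeo_plus_real (generate Homeo_plus_real {f, g}))" (is ?der)
proof -
  define T where "T = g \<circ> f"
  \<comment> \<open>\<open>Y n\<close> is the conjugate of \<open>hinv g\<close> by
    \<open>T ^^ n\<close> and fixes everything up to \<open>(T ^^ n) c\<close>. Inverses are taken
    so that all generators move points down while conjugation by \<open>hinv (X 0) = T\<close>
    pushes supports up.\<close>
  define Y where "Y n = ((\<lambda>y. T \<circ> y \<circ> hinv T) ^^ n) (hinv g)" for n
  define X where "X i = (case i of 0 \<Rightarrow> hinv T | Suc n \<Rightarrow> Y n)" for i
  have T: "T \<in> carrier Homeo_plus_real" using f g by (simp add: T_def)
  note Ts = real_carrier_simps[OF T] and gs = real_carrier_simps[OF g]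
  note fs = real_carrier_simps[OF f]
  have Y0: "Y 0 = hinv g" and YS: "Y (Suc n) = T \<circ> Y n \<circ> hinv T" for n
    by (simp_all add: Y_def)
  have X0: "X 0 = hinv T" and XS: "X (Suc n) = Y n" for n by (simp_all add: X_def)
  have Yc: "Y n \<in> carrier Homeo_plus_real" for n
  proof (induction n)
    case (Suc n)
    then show ?case unfolding YS using T by (intro comp_real_closed inv_real_closed)
  qed (use g in \<open>simp add: Y0\<close>)
  note Ys = real_carrier_simps[OF Yc]
  have T_ge: "s \<le> T s" for s
    using f_ge[of s] g_ge[of "f s"] by (simp add: T_def)
  have Tn_mono: "(T ^^ m) s \<le> (T ^^ n) s" if "m \<le> n" for m n s
    using that
  proof (induction n rule: dec_induct)
    case (step k)
    then show ?case using T_ge[of "(T ^^ k) s"] by simp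
  qed simp
  have Y_fix: "Y n s = s" if "s \<le> (T ^^ n) c" for n s
    using that
  proof (induction n arbitrary: s)
    case 0
    then show ?case using g_fix[of s] by (simp add: Y0 gs)
  next
    case (Suc n)
    have "Y n (hinv T s) = hinv T s" using Suc.prems by (intro Suc.IH) (simp add: Ts)
    then show ?case by (simp add: YS Ts)
  qed
  have Y_fix_b: "Y n s = s" if "0 < n" "s \<le> b" for n s
  proof (rule Y_fix)
    \<comment> \<open>The crossing hypothesis: from \<open>n = 1\<close> on, \<open>Y n\<close>
      moves only points beyond \<open>b\<close>, where \<open>f\<close> is the identity.\<close>
    have "b \<le> (T ^^ 1) c" using cross by (simp add: T_def)
    also have "\<dots> \<le> (T ^^ n) c" using that by (intro Tn_mono) simp
    finally show "s \<le> (T ^^ n) c" using that by simp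
  qed
  have Y_le: "Y n s \<le> s" for n s
  proof (induction n arbitrary: s)
    case 0
    then show ?case using g_ge[of s] by (simp add: Y0 gs)
  next
    case (Suc n)
    show ?case using Suc[of "hinv T s"] by (simp add: YS flip: Ts(13))
  qed
  have comm: "f (Y n s) = Y n (f s)" if "0 < n" for n s
  proof (cases "b \<le> s")
    case True
    then have "Y n b \<le> Y n s" by (simp add: Ys)
    then have "b \<le> Y n s" using Y_fix_b[OF that, of b] by simp
    then show ?thesis using True f_fix by simp
  next
    case False
    then have "f s \<le> f b" by (simp add: fs)
    then have "f s \<le> b" using f_fix[of b] by simp
    then show ?thesis using False Y_fix_b[OF that] by simp
  qed
  have Y_rel: "Y n (Y m s) = Y m (Y (Suc n) s)" if "m < n" for m n s
    using that
  proof (induction m arbitrary: n s)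
    case 0
    \<comment> \<open>Since \<open>f\<close> commutes with \<open>Y n\<close>, conjugating
      \<open>Y n\<close> by \<open>T = g \<circ> f\<close> is the same as conjugating it by
      \<open>g\<close>; this is the relation for \<open>X 1\<close>.\<close>
    have "hinv T s = hinv f (hinv g s)" by (simp add: T_def Ts gs fs flip: o_def)
        (simp add: T_def[symmetric] Ts, simp add: T_def gs fs)
    then have "Y (Suc n) s = g (Y n (hinv g s))"
      using comm[OF 0, of "hinv f (hinv g s)"] by (simp add: YS T_def fs)
    then show ?case by (simp add: Y0 gs)
  next
    case (Suc m)
    then obtain k where k: "n = Suc k" "m < k" by (cases n) auto
    show ?case using Suc.IH[OF k(2), of "hinv T s"] by (simp add: k YS Ts)
  qed
  have X_range: "range X \<subseteq> carrier Homeo_plus_real"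
    using T Yc by (auto simp: X_def split: nat.split)
  have X_rel: "X j (X i s) = X i (X (Suc j) s)" if ij: "i < j" for i j s
  proof -
    obtain n where n: "j = Suc n" using ij by (cases j) auto
    show ?thesis
    proof (cases i)
      case 0
      then show ?thesis by (simp add: n X0 XS YS Ts)
    next
      case (Suc m)
      then show ?thesis using Y_rel[of m n s] ij by (simp add: n XS)
    qed
  qed
  \<comment> \<open>\<open>Y n\<close> moves \<open>(T ^^ Suc n) c\<close>, and all later ones fix
    it because their supports lie beyond that point. The point \<open>r \<le> c\<close> is moved by
    \<open>T\<close> and fixed by every \<open>Y n\<close>.\<close>
  define t where "t i = (case i of 0 \<Rightarrow> r | Suc n \<Rightarrow> (T ^^ Suc n) c)" for i
  have Y_moved: "Y n ((T ^^ Suc n) c) < (T ^^ Suc n) c" for n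
  proof (induction n)
    case 0
    then show ?case using g_moves by (simp add: Y0 T_def gs)
  next
    case (Suc n)
    then show ?case by (simp add: YS Ts)
  qed
  have fg: "{f, g} \<subseteq> carrier Homeo_plus_real" using f g by simp
  have X_gen: "X i \<in> generate Homeo_plus_real {f, g}" for i
  proof -
    note cl = subgroup_real_closed[OF HR.generate_is_subgroup[OF fg]]
    have fg': "f \<in> generate Homeo_plus_real {f, g}" "g \<in> generate Homeo_plus_real {f, g}"
      by (auto intro: generate.incl)
    then have TK: "T \<in> generate Homeo_plus_real {f, g}" unfolding T_def by (intro cl)
    have "Y n \<in> generate Homeo_plus_real {f, g}" for n
    proof (induction n)
      case (Suc n)
      then show ?case unfolding YS using TK by (intro cl)
    qed (use fg' in \<open>simp add: Y0 cl\<close>)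
    then show ?thesis using TK by (cases i) (simp_all add: X0 XS cl)
  qed
  show ?iso
  proof -
    have "Homeo_plus_real\<lparr>carrier := generate Homeo_plus_real (range X)\<rparr> \<cong> Thompson_F"
    proof (rule Thompson_recognition[OF X_range X_rel])
      show "X i s \<le> s" for i s
        using Y_le T_ge by (cases i) (simp_all add: X0 XS Ts)
      show "X i (t i) < t i" for i
      proof (cases i)
        case 0
        then show ?thesis using r(2) g_ge[of "f r"] by (simp add: X0 t_def Ts) (simp add: T_def)
      next
        case (Suc n)
        then show ?thesis using Y_moved[of n] by (simp add: XS t_def)
      qed
      fix i j :: nat assume ij: "i < j"
      then obtain n where n: "j = Suc n" by (cases j) auto
      have "t i \<le> (T ^^ n) c"
      proof (cases i)
        case 0
        then show ?thesis using r Tn_mono[of 0 n c] by (simp add: t_def)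
      next
        case (Suc m)
        then show ?thesis using Tn_mono[of "Suc m" n c] ij n by (simp add: t_def)
      qed
      then show "X j (t i) = t i" using Y_fix by (simp add: n XS)
    qed
    moreover have "generate Homeo_plus_real (range X) = generate Homeo_plus_real {f, g}"
    proof
      have "range X \<subseteq> generate Homeo_plus_real {f, g}" using X_gen by blast
      then show "generate Homeo_plus_real (range X) \<subseteq> generate Homeo_plus_real {f, g}"
        by (rule HR.generate_subgroup_incl[OF _ HR.generate_is_subgroup[OF fg]])
    next
      note cl = subgroup_real_closed[OF HR.generate_is_subgroup[OF X_range]]
      have x: "X 0 \<in> generate Homeo_plus_real (range X)" "X (Suc 0) \<in> generate Homeo_plus_real (range X)"
        by (auto intro: generate.incl)
      have "g = hinv (X (Suc 0))"
        using gs by (simp add: XS Y0 fun_eq_iff inv_inv_eq)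
      then have 1: "g \<in> generate Homeo_plus_real (range X)" using cl(3)[OF x(2)] by simp
      have "f = X (Suc 0) \<circ> hinv (X 0)"
        using Ts gs by (simp add: XS X0 Y0 fun_eq_iff inv_inv_eq) (simp add: T_def gs)
      then have "f \<in> generate Homeo_plus_real (range X)" using cl(2)[OF x(2) cl(3)[OF x(1)]] by simp
      with 1 have "{f, g} \<subseteq> generate Homeo_plus_real (range X)" by simp
      then show "generate Homeo_plus_real {f, g} \<subseteq> generate Homeo_plus_real (range X)"
        by (rule HR.generate_subgroup_incl[OF _ HR.generate_is_subgroup[OF X_range]])
    qed
    ultimately show ?thesis by simp
  qed
  show ?der
  proof -
    have X: "X i \<in> carrier Homeo_plus_real" for i using X_range by blast
    have e: "1 = Suc 0" "2 = Suc (Suc 0)" by simp_all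
    have "inv\<^bsub>Homeo_plus_real\<^esub> X i \<otimes>\<^bsub>Homeo_plus_real\<^esub> X j \<otimes>\<^bsub>Homeo_plus_real\<^esub> X i = X (Suc j)"
      if "i < j" for i j
    proof -
      have "hinv (X i) (X j (X i s)) = X (Suc j) s" for s
        using X_rel[OF that, of s] by (simp add: real_carrier_simps[OF X])
      then show ?thesis using X by (simp add: fun_eq_iff)
    qed
    from HR.thompson_relations_second_derived[where X = X, OF HR.generate_is_subgroup[OF fg] X_gen this]
    have "X (Suc (Suc 0)) \<circ> hinv (X (Suc 0)) \<in>
        derived Homeo_plus_real (derived Homeo_plus_real (generate Homeo_plus_real {f, g}))"
      using X by (simp add: e)
    \<comment> \<open>Here \<open>X 2 = T g^-1 T^-1\<close>, \<open>X 1 = g^-1\<close> and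
      \<open>T^-1 g = f^-1\<close>.\<close>
    moreover have "X (Suc (Suc 0)) \<circ> hinv (X (Suc 0)) = g \<circ> f \<circ> hinv g \<circ> hinv f"
    proof
      fix s
      have "hinv T (g s) = hinv f s" by (simp add: Ts) (simp add: T_def fs)
      then show "(X (Suc (Suc 0)) \<circ> hinv (X (Suc 0))) s = (g \<circ> f \<circ> hinv g \<circ> hinv f) s"
        using gs by (simp add: XS YS Y0 inv_inv_eq) (simp add: T_def)
    qed
    ultimately show ?thesis by simp
  qed
qed

section \<open>Simple groups of homeomorphisms of the line\<close>

lemma commutator_mem_derived:
  assumes K: "subgroup K Homeo_plus_real" and ab: "a \<in> K" "b \<in> K"
  shows "a \<circ> b \<circ> hinv a \<circ> hinv b \<in> derived Homeo_plus_real K"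
proof -
  note cl = subgroup_real_closed[OF K]
  have "a \<otimes>\<^bsub>Homeo_plus_real\<^esub> b \<otimes>\<^bsub>Homeo_plus_real\<^esub> inv\<^bsub>Homeo_plus_real\<^esub> a
      \<otimes>\<^bsub>Homeo_plus_real\<^esub> inv\<^bsub>Homeo_plus_real\<^esub> b \<in> derived Homeo_plus_real K"
    unfolding derived_def using ab by (intro generate.incl) blast
  then show ?thesis using cl(4)[OF ab(1)] cl(4)[OF ab(2)] by simp
qed

text \<open>The inverse of a commutator is the commutator with its entries exchanged, so the
  induction has no case for inverses.\<close>

lemma derived_real_induct [consumes 2, case_names id comm comp]:
  assumes K: "subgroup K Homeo_plus_real" and g: "g \<in> derived Homeo_plus_real K"
    and id: "P id"
    and comm: "\<And>a b. a \<in> K \<Longrightarrow> b \<in> K \<Longrightarrow> P (a \<circ> b \<circ> hinv a \<circ> hinv b)"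
    and comp: "\<And>a b. a \<in> derived Homeo_plus_real K \<Longrightarrow> b \<in> derived Homeo_plus_real K \<Longrightarrow>
      P a \<Longrightarrow> P b \<Longrightarrow> P (a \<circ> b)"
  shows "P g"
proof -
  note cl = subgroup_real_closed[OF K]
  have KC: "K \<subseteq> carrier Homeo_plus_real" using cl(4) by blast
  have D: "derived Homeo_plus_real K \<subseteq> carrier Homeo_plus_real"
    using HR.derived_in_carrier[OF KC] .
  have comm': "P (a \<otimes>\<^bsub>Homeo_plus_real\<^esub> b \<otimes>\<^bsub>Homeo_plus_real\<^esub> inv\<^bsub>Homeo_plus_real\<^esub> a
      \<otimes>\<^bsub>Homeo_plus_real\<^esub> inv\<^bsub>Homeo_plus_real\<^esub> b)" if "a \<in> K" "b \<in> K" for a b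
    using comm[OF that] cl(4)[OF that(1)] cl(4)[OF that(2)] by simp
  show ?thesis
    using g unfolding derived_def
  proof induction
    case one
    then show ?case using id by (simp only: one_real)
  next
    case (incl h)
    then show ?case using comm' by blast
  next
    case (inv h)
    then obtain a b where ab: "a \<in> K" "b \<in> K" and h: "h = a \<otimes>\<^bsub>Homeo_plus_real\<^esub> b
      \<otimes>\<^bsub>Homeo_plus_real\<^esub> inv\<^bsub>Homeo_plus_real\<^esub> a \<otimes>\<^bsub>Homeo_plus_real\<^esub> inv\<^bsub>Homeo_plus_real\<^esub> b"
      by blast
    have "a \<in> carrier Homeo_plus_real" "b \<in> carrier Homeo_plus_real" using ab cl(4) by blast+
    then have "inv\<^bsub>Homeo_plus_real\<^esub> h = b \<otimes>\<^bsub>Homeo_plus_real\<^esub> a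
      \<otimes>\<^bsub>Homeo_plus_real\<^esub> inv\<^bsub>Homeo_plus_real\<^esub> b \<otimes>\<^bsub>Homeo_plus_real\<^esub> inv\<^bsub>Homeo_plus_real\<^esub> a"
      unfolding h
      by (simp add: HR.inv_mult_group HR.m_assoc del: mult_real inv_real)
    then show ?case using comm'[OF ab(2,1)] by simp
  next
    case (eng h k)
    then have "h \<in> derived Homeo_plus_real K" "k \<in> derived Homeo_plus_real K"
      by (simp_all add: derived_def)
    note hk = this
    have "P (h \<circ> k)" using comp[OF hk eng.IH] .
    then show ?case using mult_real[OF subsetD[OF D hk(1)] subsetD[OF D hk(2)]] by (simp only:)
  qed
qed

text \<open>Higman's argument: if \<open>n\<close> moves an interval off itself, then a conjugate \<open>m\<close> of \<open>n\<close>
  moves the supports of two given elements \<open>a\<close>, \<open>b\<close> off themselves, and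
  \<open>[a, b] = [[a, m], b]\<close>.\<close>

lemma simple_real:
  assumes D: "subgroup D Homeo_plus_real"
    and bounded: "\<And>h. h \<in> D \<Longrightarrow> \<exists>x y. \<forall>t. t < x \<or> y < t \<longrightarrow> h t = t"
    and trans: "\<And>x y u v. x < y \<Longrightarrow> u < v \<Longrightarrow> \<exists>h \<in> D. u < h x \<and> h y < v"
    and perfect: "D \<subseteq> derived Homeo_plus_real D"
    and nontrivial: "D \<noteq> {id}"
  shows "simple (Homeo_plus_real\<lparr>carrier := D\<rparr>)"
  unfolding simple_def
proof (intro conjI allI impI)
  let ?D = "Homeo_plus_real\<lparr>carrier := D\<rparr>"
  note cl = subgroup_real_closed[OF D]
  show "group ?D" using subgroup.subgroup_is_group[OF D group_real] .
  show "carrier ?D \<noteq> {\<one>\<^bsub>?D\<^esub>}" using nontrivial by simp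
  fix N assume N: "N \<lhd> ?D"
  then interpret N: normal N ?D .
  note Nsub = normal_imp_subgroup[OF N]
  have ND: "N \<subseteq> D" using N.subset by simp
  have Nc: "h \<in> carrier Homeo_plus_real" if "h \<in> N" for h using ND cl(4) that by blast
  have Ninv: "hinv h \<in> N" if "h \<in> N" for h
    using subgroup.m_inv_closed[OF Nsub that] HR.m_inv_consistent[OF D subsetD[OF ND that]]
      inv_real[OF Nc[OF that]] by (simp only:)
  have Ncomp: "g \<circ> h \<in> N" if "g \<in> N" "h \<in> N" for g h
    using subgroup.m_closed[OF Nsub that] Nc that by simp
  have Nconj: "h \<circ> n \<circ> hinv h \<in> N" if "h \<in> D" "n \<in> N" for h n
    using N.inv_op_closed2[of h n] HR.m_inv_consistent[OF D] that Nc cl(4)[OF that(1)] by simp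
  show "N = carrier ?D \<or> N = {\<one>\<^bsub>?D\<^esub>}"
  proof (rule disjCI)
    assume "N \<noteq> {\<one>\<^bsub>?D\<^esub>}"
    moreover have "id \<in> N" using subgroup.one_closed[OF Nsub] by simp
    ultimately obtain n where n: "n \<in> N" "n \<noteq> id" by auto
    then obtain s where s: "n s \<noteq> s" by (auto simp: fun_eq_iff)
    note ns = real_carrier_simps[OF Nc[OF n(1)]]
    \<comment> \<open>The interval between \<open>s\<close> and \<open>n s\<close>: as
      \<open>n\<close> is increasing, its image is the adjacent interval between \<open>n s\<close>
      and \<open>n (n s)\<close>.\<close>
    define u where "u = min s (n s)"
    define v where "v = max s (n s)"
    have uv: "u < v" using s by (auto simp: u_def v_def)
    have off: "n t \<le> u \<or> v \<le> n t" if "u < t" "t < v" for t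
      using that ns(5)[of s t] ns(5)[of t s] ns(5)[of "n s" t] ns(5)[of t "n s"]
      by (auto simp: u_def v_def min_def max_def split: if_splits)
    have comm: "a \<circ> b \<circ> hinv a \<circ> hinv b \<in> N" if a: "a \<in> D" and b: "b \<in> D" for a b
    proof -
      obtain x1 y1 where x1: "\<And>t. t < x1 \<or> y1 < t \<Longrightarrow> a t = t" using bounded[OF a] by blast
      obtain x2 y2 where x2: "\<And>t. t < x2 \<or> y2 < t \<Longrightarrow> b t = t" using bounded[OF b] by blast
      define x where "x = min x1 x2"
      define y where "y = max (max y1 y2) (x + 1)"
      have xy: "x < y" by (simp add: y_def)
      have afix: "a t = t" and bfix: "b t = t" if "t < x \<or> y < t" for t
        using x1[of t] x2[of t] that by (auto simp: x_def y_def)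
      obtain h where h: "h \<in> D" "u < h x" "h y < v" using trans[OF xy uv] by blast
      define m where "m = hinv h \<circ> n \<circ> h"
      have mN: "m \<in> N"
        using Nconj[OF cl(3)[OF h(1)] n(1)] real_carrier_simps(3)[OF cl(4)[OF h(1)]]
        by (simp add: m_def inv_inv_eq)
      note hs = real_carrier_simps[OF cl(4)[OF h(1)]]
      note as = real_carrier_simps[OF cl(4)[OF a]]
      note bs = real_carrier_simps[OF cl(4)[OF b]]
      note ms = real_carrier_simps[OF Nc[OF mN]]
      have moff: "m t < x \<or> y < m t" if "x \<le> t" "t \<le> y" for t
      proof -
        have "u < h t" "h t < v" using that h(2,3) hs(6)[of x t] hs(6)[of t y] by linarith+
        then have "n (h t) < h x \<or> h y < n (h t)" using off[of "h t"] h(2,3) by linarith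
        then show ?thesis by (simp add: m_def hs)
      qed
      have bm: "b (m t) = m t" and am: "a (m t) = m t" if "x \<le> t" "t \<le> y" for t
        using afix bfix moff[OF that] by auto
      \<comment> \<open>\<open>k\<close> is supported in the image of \<open>[x, y]\<close> under
        \<open>m\<close>, which is disjoint from \<open>[x, y]\<close>; hence it commutes with
        \<open>b\<close>.\<close>
      define k where "k = m \<circ> hinv a \<circ> hinv m"
      have kb: "k (b t) = b (k t)" for t
      proof (cases "x \<le> hinv m t \<and> hinv m t \<le> y")
        case True
        have 1: "b t = t" using bm[of "hinv m t"] True by (simp add: ms)
        have "\<not> (hinv a (hinv m t) < x \<or> y < hinv a (hinv m t))"
        proof
          assume out: "hinv a (hinv m t) < x \<or> y < hinv a (hinv m t)"
          from afix[OF this] have "hinv a (hinv m t) = hinv m t" by (simp only: as(9))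
          then show False using out True by linarith
        qed
        then have "x \<le> hinv a (hinv m t)" "hinv a (hinv m t) \<le> y" by linarith+
        then have "b (k t) = k t" using bm by (simp add: k_def)
        then show ?thesis using 1 by simp
      next
        case False
        then have "a (hinv m t) = hinv m t" using afix[of "hinv m t"] by linarith
        then have "hinv a (hinv m t) = hinv m t" by (simp only: as(14))
        then have 1: "k t = t" by (simp add: k_def ms)
        have "\<not> (x \<le> hinv m (b t) \<and> hinv m (b t) \<le> y)"
        proof
          assume "x \<le> hinv m (b t) \<and> hinv m (b t) \<le> y"
          then have "b (b t) = b t" using bm[of "hinv m (b t)"] by (simp add: ms)
          then have "b t = t" by (simp add: bs)
          then show False using False \<open>x \<le> hinv m (b t) \<and> hinv m (b t) \<le> y\<close> by simp
        qed
        then have "a (hinv m (b t)) = hinv m (b t)" using afix[of "hinv m (b t)"] by linarith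
        then have "hinv a (hinv m (b t)) = hinv m (b t)" by (simp only: as(14))
        then have "k (b t) = b t" by (simp add: k_def ms)
        then show ?thesis using 1 by simp
      qed
      \<comment> \<open>\<open>w = [a, m]\<close> lies in \<open>N\<close> by normality, and
        \<open>[w, b] = [a, b]\<close> because the second factor \<open>k\<close> of
        \<open>w\<close> commutes with \<open>b\<close>.\<close>
      define w where "w = a \<circ> k"
      have w: "w \<in> N"
      proof -
        have "w = (a \<circ> m \<circ> hinv a) \<circ> hinv m" by (simp add: w_def k_def o_assoc)
        then show ?thesis using Ncomp[OF Nconj[OF a mN] Ninv[OF mN]] by simp
      qed
      note ws = real_carrier_simps[OF Nc[OF w]]
      have kc: "k \<in> carrier Homeo_plus_real"
        unfolding k_def using cl(4)[OF a] Nc[OF mN] by (intro comp_real_closed inv_real_closed)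
      have "w \<circ> (b \<circ> hinv w \<circ> hinv b) \<in> N" using Ncomp[OF w Nconj[OF b Ninv[OF w]]] .
      moreover have "w \<circ> (b \<circ> hinv w \<circ> hinv b) = a \<circ> b \<circ> hinv a \<circ> hinv b"
      proof
        fix t
        define r where "r = hinv w (hinv b t)"
        have "w r = hinv b t" by (simp add: r_def ws)
        then have "hinv b t = a (k r)" by (simp add: w_def)
        then have "hinv a (hinv b t) = k r" by (simp add: as)
        then show "(w \<circ> (b \<circ> hinv w \<circ> hinv b)) t = (a \<circ> b \<circ> hinv a \<circ> hinv b) t"
          using kb[of r] by (simp add: r_def[symmetric]) (simp add: w_def)
      qed
      ultimately show ?thesis by simp
    qed
    \<comment> \<open>Perfectness enters here: \<open>N\<close> contains all commutators of elements
      of \<open>D\<close>, and these generate \<open>D\<close>.\<close>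
    have "D \<subseteq> N"
    proof
      fix g assume "g \<in> D"
      then have "g \<in> derived Homeo_plus_real D" using perfect by blast
      then show "g \<in> N"
        by (rule derived_real_induct[OF D, where P = "\<lambda>g. g \<in> N"]) (rule \<open>id \<in> N\<close> comm Ncomp; assumption)+
    qed
    then show "N = carrier ?D" using ND by simp
  qed
qed

text \<open>If \<open>p s p^-1\<close> is the identity on the interval, then the commutator
  \<open>s (p s^-1 p^-1)\<close> agrees with \<open>s\<close> there. For products and inverses the
  interval is transported by the inner factor.\<close>

lemma derived_agrees_on_interval:
  assumes S: "S \<subseteq> carrier Homeo_plus_real"
    and off: "\<And>s x y. s \<in> S \<Longrightarrow> \<exists>p \<in> generate Homeo_plus_real S. \<forall>t. x \<le> t \<and> t \<le> y \<longrightarrow>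
      p (s (hinv p t)) = t"
    and g: "g \<in> generate Homeo_plus_real S"
  shows "\<exists>h \<in> derived Homeo_plus_real (generate Homeo_plus_real S).
    \<forall>t. x \<le> t \<and> t \<le> y \<longrightarrow> h t = g t"
proof -
  let ?K = "generate Homeo_plus_real S"
  have K: "subgroup ?K Homeo_plus_real" using HR.generate_is_subgroup[OF S] .
  note cl = subgroup_real_closed[OF K]
  have "subgroup (derived Homeo_plus_real ?K) Homeo_plus_real"
    using HR.derived_is_subgroup cl(4) by blast
  note dcl = subgroup_real_closed[OF this]
  have gen: "\<exists>h \<in> derived Homeo_plus_real ?K. \<forall>t. x \<le> t \<and> t \<le> y \<longrightarrow> h t = s t"
    if s: "s \<in> S" for s x y
  proof -
    obtain p where p: "p \<in> ?K" "\<And>t. x \<le> t \<and> t \<le> y \<Longrightarrow> p (s (hinv p t)) = t"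
      using off[OF s] by blast
    have sK: "s \<in> ?K" using s by (rule generate.incl)
    note ps = real_carrier_simps[OF cl(4)[OF p(1)]]
    note ss = real_carrier_simps[OF cl(4)[OF sK]]
    have "(s \<circ> p \<circ> hinv s \<circ> hinv p) t = s t" if "x \<le> t \<and> t \<le> y" for t
    proof -
      have "s (hinv p t) = hinv p t" using p(2)[OF that] ps by metis
      then have "hinv s (hinv p t) = hinv p t" by (simp add: ss)
      then show ?thesis by (simp add: ps)
    qed
    then show ?thesis using commutator_mem_derived[OF K sK p(1)] by blast
  qed
  show ?thesis
    using g
  proof (induction arbitrary: x y)
    case one
    show ?case by (intro bexI[of _ id]) (use dcl(1) in auto)
  next
    case (incl s)
    then show ?case by (rule gen)
  next
    case (inv s)
    have sc: "s \<in> carrier Homeo_plus_real" using inv S by blast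
    note ss = real_carrier_simps[OF sc]
    obtain h where h: "h \<in> derived Homeo_plus_real ?K"
      "\<And>t. hinv s x \<le> t \<and> t \<le> hinv s y \<Longrightarrow> h t = s t" using gen[OF inv] by blast
    note hs = real_carrier_simps[OF dcl(4)[OF h(1)]]
    have "hinv h t = (inv\<^bsub>Homeo_plus_real\<^esub> s) t" if "x \<le> t \<and> t \<le> y" for t
      using h(2)[of "hinv s t"] that sc by (simp add: ss hs)
    then show ?case using dcl(3)[OF h(1)] by blast
  next
    case (eng f g)
    obtain h where h: "h \<in> derived Homeo_plus_real ?K" "\<And>t. x \<le> t \<and> t \<le> y \<Longrightarrow> h t = g t"
      using eng.IH(2) by blast
    obtain k where k: "k \<in> derived Homeo_plus_real ?K"
      "\<And>t. g x \<le> t \<and> t \<le> g y \<Longrightarrow> k t = f t" using eng.IH(1) by blast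
    have "(k \<circ> h) t = (f \<otimes>\<^bsub>Homeo_plus_real\<^esub> g) t" if "x \<le> t \<and> t \<le> y" for t
      using that h(2)[OF that] k(2)[of "g t"] real_carrier_simps(6)[OF cl(4)[OF eng.hyps(2)]]
        cl(4)[OF eng.hyps(1)] cl(4)[OF eng.hyps(2)] by simp
    then show ?case using dcl(2)[OF k(1) h(1)] by blast
  qed
qed

section \<open>A family of 3-chain groups indexed by sets of natural numbers\<close>

definition left_map :: "real \<Rightarrow> real" where
  "left_map t = (if t \<le> -1 then t + 1 else if t \<le> 1 then (t + 1) / 2 else t)"

text \<open>The slope 2 on \<open>[0, 1]\<close> undoes the slope 1/2 of \<open>left_map\<close> on
  \<open>[-1, 1]\<close>, which makes \<open>mid_map \<circ> left_map\<close> translation by one on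
  \<open>(-\<infinity>, 1]\<close>. The end \<open>3\<close> is where \<open>right_map S\<close>
  sends \<open>mid_map 1 = 2\<close>.\<close>

definition mid_map :: "real \<Rightarrow> real" where
  "mid_map t = (if t \<le> 0 then t else if t \<le> 1 then 2 * t else if t \<le> 3 then (t + 3) / 2 else t)"

text \<open>Just right of \<open>1\<close> this is \<open>2 * t - 1\<close>, and so is the conjugate
  of \<open>mid_map\<close> by the translation; comparing the two isolates \<open>bump S\<close>.
  Beyond \<open>2\<close> it is a translation, so that germs at infinity commute.\<close>

definition doubling_map :: "real \<Rightarrow> real" where
  "doubling_map t = (if t \<le> 1 then t else if t \<le> 2 then 2 * t - 1 else t + 1)"

text \<open>The homeomorphism \<open>bump S\<close> moves exactly the points of the intervals
  \<open>(1 + 2\<^sup>-\<^sup>n\<^sup>-\<^sup>2, 1 + 2\<^sup>-\<^sup>n\<^sup>-\<^sup>1)\<close> with \<open>n \<in> S\<close>; the elements that expand around \<open>1\<close> by powers of \<open>2\<close>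
  recover \<open>S\<close> from it.\<close>

definition gaps :: "nat set \<Rightarrow> real set" where
  "gaps S = {t. \<forall>n \<in> S. \<not> (1 + 1 / 2 ^ (n + 2) < t \<and> t < 1 + 1 / 2 ^ (n + 1))}"

definition bump :: "nat set \<Rightarrow> real \<Rightarrow> real" where
  "bump S t = t + infdist t (gaps S) / 2"

text \<open>\<open>bump S\<close> fixes all of \<open>gaps S\<close>. The factor
  \<open>doubling_map\<close> moves every point beyond \<open>1\<close>, so the support is a full
  ray for every \<open>S\<close>.\<close>

definition right_map :: "nat set \<Rightarrow> real \<Rightarrow> real" where
  "right_map S = doubling_map \<circ> bump S"

definition chain :: "nat set \<Rightarrow> (real \<Rightarrow> real) set" where
  "chain S = generate Homeo_plus_real {left_map, mid_map, right_map S}"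

section \<open>The generators as homeomorphisms of the line\<close>

lemma mem_carrier_realI:
  assumes "strict_mono f" "\<And>y. f (g y) = y" shows "f \<in> carrier Homeo_plus_real"
  unfolding mem_carrier_real using assms(1) surjI[of f g, OF assms(2)] by (rule conjI)

lemma left_map_closed: "left_map \<in> carrier Homeo_plus_real"
proof -
  have "strict_mono left_map"
    by (rule strict_monoI) (auto simp: left_map_def)
  moreover have "left_map (if y \<le> 0 then y - 1 else if y \<le> 1 then 2 * y - 1 else y) = y" for y
    by (auto simp: left_map_def)
  ultimately show ?thesis by (rule mem_carrier_realI)
qed

lemma mid_map_closed: "mid_map \<in> carrier Homeo_plus_real"
proof -
  have "strict_mono mid_map"
    by (rule strict_monoI) (auto simp: mid_map_def)
  moreover have "mid_map (if y \<le> 0 then y else if y \<le> 2 then y / 2 else if y \<le> 3 then 2 * y - 3 else y) = y" for y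
    by (auto simp: mid_map_def)
  ultimately show ?thesis by (rule mem_carrier_realI)
qed

lemma doubling_map_closed: "doubling_map \<in> carrier Homeo_plus_real"
proof -
  have "strict_mono doubling_map"
    by (rule strict_monoI) (auto simp: doubling_map_def)
  moreover have "doubling_map (if y \<le> 1 then y else if y \<le> 3 then (y + 1) / 2 else y - 1) = y" for y
    by (auto simp: doubling_map_def field_simps)
  ultimately show ?thesis by (rule mem_carrier_realI)
qed

lemma gaps_le_1: "t \<le> 1 \<Longrightarrow> t \<in> gaps S"
  by (auto simp: gaps_def)

lemma gaps_ge: "3 / 2 \<le> t \<Longrightarrow> t \<in> gaps S"
proof -
  have le: "1 / 2 ^ (n + 1) \<le> (1 / 2 :: real)" for n :: nat
    by (simp add: field_simps)
  have "t \<in> gaps S" if "3 / 2 \<le> t"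
    unfolding gaps_def
  proof clarify
    fix n assume "t < 1 + 1 / 2 ^ (n + 1)"
    then show False using le[of n] that by linarith
  qed
  then show "3 / 2 \<le> t \<Longrightarrow> t \<in> gaps S" .
qed

lemma gaps_closed_interval:
  assumes "n \<notin> S" "1 + 1 / 2 ^ (n + 2) \<le> t" "t \<le> 1 + 1 / 2 ^ (n + 1)"
  shows "t \<in> gaps S"
proof -
  have "\<not> (1 + 1 / 2 ^ (m + 2) < t \<and> t < 1 + 1 / 2 ^ (m + 1))" if "m \<in> S" for m
  proof (cases "m < n")
    case True
    then have "1 / 2 ^ (n + 1) \<le> (1 / 2 ^ (m + 2) :: real)"
      by (intro divide_left_mono power_increasing) auto
    then show ?thesis using assms by simp
  next
    case False
    then have "n < m" using that assms by (cases "m = n") auto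
    then have "1 / 2 ^ (m + 1) \<le> (1 / 2 ^ (n + 2) :: real)"
      by (intro divide_left_mono power_increasing) auto
    then show ?thesis using assms by simp
  qed
  then show ?thesis by (auto simp: gaps_def)
qed

lemma gaps_endpoint: "1 + 1 / 2 ^ (n + 1) \<in> gaps S"
proof -
  have "\<not> (1 + 1 / 2 ^ (m + 2) < 1 + 1 / (2 :: real) ^ (n + 1) \<and> 1 + 1 / 2 ^ (n + 1) < 1 + 1 / (2 :: real) ^ (m + 1))" for m :: nat
  proof (cases "m < n")
    case True
    then have "1 / 2 ^ (n + 1) \<le> (1 / 2 ^ (m + 2) :: real)"
      by (intro divide_left_mono power_increasing) auto
    then show ?thesis by simp
  next
    case False
    then have "1 / 2 ^ (m + 1) \<le> (1 / 2 ^ (n + 1) :: real)"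
      by (intro divide_left_mono power_increasing) auto
    then show ?thesis by simp
  qed
  then show ?thesis unfolding gaps_def by blast
qed

lemma bump_fixed: "t \<in> gaps S \<Longrightarrow> bump S t = t"
  by (simp add: bump_def)

lemma bump_ge: "t \<le> bump S t"
  by (simp add: bump_def infdist_nonneg)

text \<open>The distance to a set is 1-Lipschitz, so adding half of it preserves strict order.
  Outside \<open>[1, 3 / 2]\<close> the map is the identity, and inside the intermediate value
  theorem gives surjectivity.\<close>

lemma bump_closed: "bump S \<in> carrier Homeo_plus_real"
proof -
  have "bump S x < bump S y" if "x < y" for x y
    using infdist_triangle_abs[of x "gaps S" y] that by (auto simp: bump_def dist_real_def)
  moreover have "\<exists>t. bump S t = y" for y
  proof (cases "y \<le> 1 \<or> 3 / 2 \<le> y")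
    case True
    then show ?thesis using bump_fixed[of y S] gaps_le_1 gaps_ge by blast
  next
    case False
    have "continuous_on {1..3/2} (bump S)"
      unfolding bump_def by (intro continuous_intros) auto
    moreover have "bump S 1 = 1" "bump S (3 / 2) = 3 / 2"
      by (simp_all add: bump_fixed gaps_le_1 gaps_ge)
    ultimately show ?thesis using IVT'[of "bump S" 1 y "3 / 2"] False by auto
  qed
  ultimately show ?thesis
    unfolding mem_carrier_real by (metis strict_monoI surj_def)
qed

text \<open>The point is the midpoint of the interval of index \<open>n\<close>, whose radius is
  \<open>1 / 8 / 2 ^ n\<close>; half of this radius takes \<open>3 / 8\<close> to
  \<open>7 / 16\<close>.\<close>

lemma bump_moved:
  assumes "n \<in> S"
  shows "bump S (1 + 3 / 8 / 2 ^ n) = 1 + 7 / 16 / 2 ^ n"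
proof -
  let ?t = "1 + 3 / 8 / 2 ^ n :: real"
  have ends: "?t - 1 / 8 / 2 ^ n = 1 + 1 / 2 ^ (n + 2)" "?t + 1 / 8 / 2 ^ n = 1 + 1 / 2 ^ (n + 1)"
    by (simp_all add: field_simps)
  have "infdist ?t (gaps S) \<le> dist ?t (1 + 1 / 2 ^ (n + 1))"
    by (rule infdist_le[OF gaps_endpoint])
  then have "infdist ?t (gaps S) \<le> 1 / 8 / 2 ^ n"
    unfolding ends(2)[symmetric] by (simp add: dist_real_def)
  moreover have "1 / 8 / 2 ^ n \<le> infdist ?t (gaps S)"
  proof -
    have "1 / 8 / 2 ^ n \<le> dist ?t a" if "a \<in> gaps S" for a
    proof -
      have "\<not> (?t - 1 / 8 / 2 ^ n < a \<and> a < ?t + 1 / 8 / 2 ^ n)"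
        using that assms unfolding ends gaps_def by blast
      then show ?thesis by (auto simp: dist_real_def)
    qed
    moreover have "gaps S \<noteq> {}" using gaps_le_1 by blast
    ultimately show ?thesis unfolding infdist_notempty[OF \<open>gaps S \<noteq> {}\<close>]
      by (intro cINF_greatest) auto
  qed
  ultimately have "infdist ?t (gaps S) = 1 / 8 / 2 ^ n" by simp
  then show ?thesis by (simp add: bump_def field_simps)
qed

lemma right_map_closed: "right_map S \<in> carrier Homeo_plus_real"
  unfolding right_map_def by (intro comp_real_closed doubling_map_closed bump_closed)

lemma right_map_ge_doubling: "doubling_map t \<le> right_map S t"
  using bump_ge[of t S] real_carrier_simps(6)[OF doubling_map_closed, of t "bump S t"]
  by (simp add: right_map_def)

lemma right_map_values:
  "t \<le> 1 \<Longrightarrow> right_map S t = t" "2 \<le> t \<Longrightarrow> right_map S t = t + 1"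
  using bump_fixed[OF gaps_le_1, of t S] bump_fixed[OF gaps_ge, of t S]
  by (simp_all add: right_map_def doubling_map_def)

section \<open>The 3-chain condition\<close>

lemma chain_supports:
  "supp left_map = {..<1}" "supp mid_map = {0<..<3}" "supp (right_map S) = {1<..}"
proof -
  show "supp left_map = {..<1}" by (auto simp: supp_def left_map_def)
  show "supp mid_map = {0<..<3}" by (auto simp: supp_def mid_map_def)
  have "t < right_map S t" if "1 < t" for t
    using right_map_ge_doubling[of t S] that by (simp add: doubling_map_def split: if_splits)
  moreover have "right_map S t = t" if "\<not> 1 < t" for t
    using that by (simp add: right_map_values)
  ultimately have "right_map S t \<noteq> t \<longleftrightarrow> 1 < t" for t
    by (metis less_irrefl)
  then show "supp (right_map S) = {1<..}"
    unfolding supp_def by auto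
qed

lemma chain_maps_ge: "t \<le> left_map t" "t \<le> mid_map t" "t \<le> right_map S t"
proof -
  show "t \<le> left_map t" "t \<le> mid_map t" by (auto simp: left_map_def mid_map_def)
  have "t \<le> doubling_map t" by (auto simp: doubling_map_def)
  then show "t \<le> right_map S t" using right_map_ge_doubling[of t S] by simp
qed

lemma chain_pairs_Thompson:
  shows "Homeo_plus_real\<lparr>carrier := generate Homeo_plus_real {left_map, mid_map}\<rparr> \<cong> Thompson_F"
    and "mid_map \<circ> left_map \<circ> hinv mid_map \<circ> hinv left_map \<in>
      derived Homeo_plus_real (derived Homeo_plus_real (generate Homeo_plus_real {left_map, mid_map}))"
    and "Homeo_plus_real\<lparr>carrier := generate Homeo_plus_real {mid_map, right_map S}\<rparr> \<cong> Thompson_F"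
    and "right_map S \<circ> mid_map \<circ> hinv (right_map S) \<circ> hinv mid_map \<in>
      derived Homeo_plus_real (derived Homeo_plus_real (generate Homeo_plus_real {mid_map, right_map S}))"
proof -
  note l = left_map_closed mid_map_closed chain_maps_ge(1) chain_maps_ge(2)
  have L: "1 \<le> s \<Longrightarrow> left_map s = s" "s \<le> 0 \<Longrightarrow> mid_map s = s" for s
    by (auto simp: left_map_def mid_map_def)
  \<comment> \<open>Parameters \<open>b = 1\<close>, \<open>c = 0\<close>, \<open>r = -1\<close>:
    \<open>0\<close> goes to \<open>1 / 2\<close> and then to \<open>1\<close>, so the product
    carries the left end of the overlap exactly to its right end.\<close>
  have vl: "1 \<le> mid_map (left_map 0)" "(-1 :: real) \<le> 0" "-1 < left_map (-1)"
    "mid_map (left_map 0) < mid_map (mid_map (left_map 0))"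
    by (simp_all add: left_map_def mid_map_def)
  show "Homeo_plus_real\<lparr>carrier := generate Homeo_plus_real {left_map, mid_map}\<rparr> \<cong> Thompson_F"
    by (rule chain_pair_Thompson(1)[OF l L vl])
  show "mid_map \<circ> left_map \<circ> hinv mid_map \<circ> hinv left_map \<in>
      derived Homeo_plus_real (derived Homeo_plus_real (generate Homeo_plus_real {left_map, mid_map}))"
    by (rule chain_pair_Thompson(2)[OF l L vl])
  note r = mid_map_closed right_map_closed chain_maps_ge(2) chain_maps_ge(3)
  have R: "3 \<le> s \<Longrightarrow> mid_map s = s" "s \<le> 1 \<Longrightarrow> right_map S s = s" for s
    by (auto simp: mid_map_def right_map_values)
  \<comment> \<open>Parameters \<open>b = 3\<close>, \<open>c = 1\<close>, \<open>r = 1 / 2\<close>: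
    \<open>1\<close> goes to \<open>2\<close> and then to \<open>3\<close>. At \<open>2\<close> and
    \<open>3\<close> the value of \<open>right_map S\<close> does not depend on
    \<open>S\<close>.\<close>
  have vr: "3 \<le> right_map S (mid_map 1)" "(1 / 2 :: real) \<le> 1" "1 / 2 < mid_map (1 / 2)"
    "right_map S (mid_map 1) < right_map S (right_map S (mid_map 1))"
    by (simp_all add: mid_map_def right_map_values)
  show "Homeo_plus_real\<lparr>carrier := generate Homeo_plus_real {mid_map, right_map S}\<rparr> \<cong> Thompson_F"
    by (rule chain_pair_Thompson(1)[OF r R vr])
  show "right_map S \<circ> mid_map \<circ> hinv (right_map S) \<circ> hinv mid_map \<in>
      derived Homeo_plus_real (derived Homeo_plus_real (generate Homeo_plus_real {mid_map, right_map S}))"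
    by (rule chain_pair_Thompson(2)[OF r R vr])
qed

lemma chain_gens_closed: "{left_map, mid_map, right_map S} \<subseteq> carrier Homeo_plus_real"
  by (simp add: left_map_closed mid_map_closed right_map_closed)

lemma subgroup_chain: "subgroup (chain S) Homeo_plus_real"
  unfolding chain_def by (rule HR.generate_is_subgroup[OF chain_gens_closed])

lemma chain_gens_mem: "left_map \<in> chain S" "mid_map \<in> chain S" "right_map S \<in> chain S"
  unfolding chain_def by (auto intro: generate.incl)

lemma subgroup_derived_chain: "subgroup (derived Homeo_plus_real (chain S)) Homeo_plus_real"
  using HR.derived_is_subgroup subgroup.subset[OF subgroup_chain] by blast

lemma chain_group_chain: "chain_group 3 (chain S)"
proof -
  define f where "f i = (if i = 1 then left_map else if i = 2 then mid_map else right_map S)" for i :: nat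
  have one3: "{1..3} = {1, 2, 3 :: nat}" "{Suc 0..3} = {1, 2, 3 :: nat}" and one2: "{1..<3} = {1, 2 :: nat}" by auto
  have f: "f 1 = left_map" "f 2 = mid_map" "f 3 = right_map S" "f (1 + 1) = mid_map"
    "f (2 + 1) = right_map S" "f (Suc 0) = left_map" "f (Suc (Suc 0)) = mid_map"
    by (simp_all add: f_def)
  have "left_endpoint {..<1} \<le> ereal (- 1)" "left_endpoint {0<..<3} \<le> ereal (1 / 2)"
    unfolding left_endpoint_def by (rule INF_lower; simp)+
  moreover have "ereal 0 \<le> left_endpoint {0<..<3}" "ereal 1 \<le> left_endpoint {1<..}"
    unfolding left_endpoint_def by (rule INF_greatest; simp)+
  moreover have "ereal (- 1) < ereal 0" "ereal (1 / 2) < ereal 1" by simp_all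
  ultimately have ends: "left_endpoint {..<1} < left_endpoint {0<..<3}"
    "left_endpoint {0<..<3} < left_endpoint {1<..}"
    by (metis le_less_trans less_le_trans)+
  have inter: "{..<1} \<inter> {0<..<3} = {0<..<1::real}" "{0<..<3} \<inter> {1<..} = {1<..<3::real}"
    "{..<1} \<inter> {1<..} = ({} :: real set)" "{1<..} \<inter> {..<1} = ({} :: real set)"
    by auto
  have intervals: "is_interval {..<1 :: real}" "is_interval {0<..<3 :: real}" "is_interval {1 :: real<..}"
    "is_interval {0<..<1 :: real}" "is_interval {1<..<3 :: real}"
    by (auto simp: is_interval_1)
  have proper: "{0<..<1::real} \<subset> {..<1}" "{0<..<1::real} \<subset> {0<..<3}"
    "{1<..<3::real} \<subset> {0<..<3}" "{1 :: real<..<3} \<subset> {1<..}"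
    by (force simp: psubset_eq set_eq_iff)+
  have nonempty: "{..<1 :: real} \<noteq> {}" "{0<..<3 :: real} \<noteq> {}" "{1 :: real<..} \<noteq> {}"
    "{0<..<1::real} \<noteq> {}" "{1<..<3::real} \<noteq> {}"
    by (auto simp: dense)
  have "chain_of_intervals 3 (\<lambda>i. supp (f i))"
    unfolding chain_of_intervals_def one3 one2
    using intervals proper nonempty by (simp add: f chain_supports inter one3)
  moreover have "\<forall>i \<in> {1..<3}. left_endpoint (supp (f i)) < left_endpoint (supp (f (i + 1)))"
    unfolding one2 by (simp add: f chain_supports ends)
  moreover have "\<forall>i \<in> {1..3}. f i \<in> carrier Homeo_plus_real"
    using chain_gens_closed[of S] by (simp add: one3 f)
  moreover have "chain S = generate Homeo_plus_real (f ` {1..3})"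
    by (simp add: chain_def one3 f)
  moreover have "\<forall>i \<in> {1..3}. \<forall>t. f i t \<ge> t"
    by (simp add: one3 f chain_maps_ge)
  moreover have "\<forall>i \<in> {1..<3}.
      Homeo_plus_real\<lparr>carrier := generate Homeo_plus_real {f i, f (i + 1)}\<rparr> \<cong> Thompson_F"
    unfolding one2 using chain_pairs_Thompson(1,3) by (simp add: f)
  ultimately show ?thesis
    unfolding chain_group_def by (intro conjI exI[of _ f]) simp_all
qed

section \<open>Dynamics of the chain groups\<close>

lemma shift_map:
  "t \<le> 1 \<Longrightarrow> (mid_map \<circ> left_map) t = t + 1"
  "t \<le> 2 \<Longrightarrow> hinv (mid_map \<circ> left_map) t = t - 1"
proof -
  have cl: "mid_map \<circ> left_map \<in> carrier Homeo_plus_real"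
    by (intro comp_real_closed mid_map_closed left_map_closed)
  show *: "(mid_map \<circ> left_map) t = t + 1" if "t \<le> 1" for t
    using that by (auto simp: mid_map_def left_map_def)
  then show "hinv (mid_map \<circ> left_map) t = t - 1" if "t \<le> 2"
    using *[of "t - 1"] that by (simp only: real_carrier_simps(14)[OF cl])
qed

lemma shift_map_pow: "t + real n \<le> 2 \<Longrightarrow> ((mid_map \<circ> left_map) ^^ n) t = t + real n"
proof (induction n)
  case (Suc n)
  then show ?case using shift_map(1)[of "t + real n"] by simp
qed simp

lemma shift_map_mem: "mid_map \<circ> left_map \<in> chain S"
  by (intro subgroup_real_closed(2)[OF subgroup_chain] chain_gens_mem)

text \<open>Induction on the exponent: \<open>m / 2 ^ n\<close> in \<open>[0, 2]\<close> is reached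
  from \<open>[0, 1]\<close> by at most one translation, and \<open>hinv mid_map\<close> halves
  it.\<close>

lemma dyadic_orbit: "m \<le> 2 ^ n \<Longrightarrow> \<exists>g \<in> chain S. g 1 = real m / 2 ^ n"
proof (induction n arbitrary: m)
  case 0
  note cl = subgroup_real_closed[OF subgroup_chain[of S]]
  have "hinv (mid_map \<circ> left_map) 1 = real 0 / 2 ^ 0" using shift_map(2)[of 1] by simp
  then have 1: "\<exists>g \<in> chain S. g 1 = real 0 / 2 ^ 0" using cl(3)[OF shift_map_mem] by blast
  have "id 1 = real 1 / 2 ^ 0" by simp
  then have 2: "\<exists>g \<in> chain S. g 1 = real 1 / 2 ^ 0" using cl(1) by blast
  have "m = 0 \<or> m = 1" using 0 by auto
  then show ?case using 1 2 by (elim disjE) simp_all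
next
  case (Suc n)
  note cl = subgroup_real_closed[OF subgroup_chain[of S]]
  note ms = real_carrier_simps[OF mid_map_closed]
  have half: "hinv mid_map t = t / 2" if "0 \<le> t" "t \<le> 2" for t
    unfolding ms(14) using that by (auto simp: mid_map_def)
  have "\<exists>g \<in> chain S. g 1 = real m / 2 ^ n"
  proof (cases "m \<le> 2 ^ n")
    case True
    then show ?thesis by (rule Suc.IH)
  next
    case False
    define k where "k = m - 2 ^ n"
    have k: "m = k + 2 ^ n" "k \<le> 2 ^ n" using False Suc.prems by (auto simp: k_def)
    obtain g where g: "g \<in> chain S" "g 1 = real k / 2 ^ n" using Suc.IH[OF k(2)] by blast
    have "real k \<le> 2 ^ n" using k(2) by simp
    then have "g 1 \<le> 1" using g(2) by (simp add: divide_le_eq)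
    then have "(mid_map \<circ> left_map \<circ> g) 1 = g 1 + 1" using shift_map(1)[of "g 1"] by simp
    also have "\<dots> = real m / 2 ^ n" unfolding g(2) k(1) by (simp add: add_divide_distrib)
    finally show ?thesis using cl(2)[OF shift_map_mem g(1)] by blast
  qed
  then obtain g where g: "g \<in> chain S" "g 1 = real m / 2 ^ n" by blast
  have "real m \<le> 2 ^ Suc n" using Suc.prems by (simp only: of_nat_le_numeral_power_cancel_iff)
  then have "real m \<le> 2 * 2 ^ n" by simp
  then have "g 1 \<le> 2" "0 \<le> g 1" using g(2) by (simp_all add: divide_le_eq)
  then have "(hinv mid_map \<circ> g) 1 = real m / 2 ^ Suc n" using half[of "g 1"] g(2) by simp
  then show ?case using cl(2)[OF cl(3)[OF chain_gens_mem(2)] g(1)] by blast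
qed

lemma right_map_pow_unbounded:
  assumes "1 < e" shows "\<exists>m. z < (right_map S ^^ m) e"
proof -
  \<comment> \<open>\<open>doubling_map\<close> displaces \<open>t > 1\<close> by
    \<open>min (t - 1) 1\<close>, which does not decrease along an orbit, and
    \<open>right_map S\<close> moves points at least as far.\<close>
  define d where "d = min (e - 1) 1"
  have d: "0 < d" using assms by (simp add: d_def)
  have step: "t + d \<le> right_map S t" if "e \<le> t" for t
  proof -
    have "t + d \<le> doubling_map t" using that assms by (auto simp: doubling_map_def d_def)
    then show ?thesis using right_map_ge_doubling[of t S] by simp
  qed
  have ge: "e + real m * d \<le> (right_map S ^^ m) e" for m
  proof (induction m)
    case (Suc m)
    have "0 \<le> real m * d" using d by simp
    then have "e \<le> (right_map S ^^ m) e" using Suc by linarith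
    then show ?case using step[of "(right_map S ^^ m) e"] Suc by (simp add: algebra_simps)
  qed simp
  obtain m where "z - e < real m * d" using reals_Archimedean3[OF d] by blast
  then have "z < (right_map S ^^ m) e" using ge[of m] by linarith
  then show ?thesis by blast
qed

lemma right_map_contract:
  assumes "1 < e" "1 < z"
  shows "\<exists>g \<in> chain S. g z < e \<and> (\<forall>t > 1. 1 < g t)"
proof -
  note cl = subgroup_real_closed[OF subgroup_chain[of S]]
  obtain m where m: "z < (right_map S ^^ m) e" using right_map_pow_unbounded[OF assms(1)] by blast
  have mem: "right_map S ^^ m \<in> chain S" by (intro cl(5) chain_gens_mem)
  note ps = real_carrier_simps[OF cl(4)[OF mem]]
  have one: "(right_map S ^^ m) 1 = 1" by (induction m) (simp_all add: right_map_values)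
  have "hinv (right_map S ^^ m) z < e" using m by (simp only: ps)
  moreover have "1 < hinv (right_map S ^^ m) t" if "1 < t" for t
    using that one by (simp only: ps)
  ultimately show ?thesis using cl(3)[OF mem] by blast
qed

lemma chain_push_right: "\<exists>g \<in> chain S. 1 < g x"
proof (cases "1 < x")
  case True
  then show ?thesis using subgroup_real_closed(1)[OF subgroup_chain] by (intro bexI[of _ id]) auto
next
  case False
  define n where "n = nat (\<lfloor>1 - x\<rfloor> + 1)"
  have "real n = of_int \<lfloor>1 - x\<rfloor> + 1" using False by (simp add: n_def)
  then have "1 < x + real n" "x + real n \<le> 2" by linarith+
  then have "1 < ((mid_map \<circ> left_map) ^^ n) x" by (simp only: shift_map_pow)
  then show ?thesis using subgroup_real_closed(5)[OF subgroup_chain shift_map_mem] by blast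
qed

text \<open>An element \<open>h\<close> carries \<open>u\<close> into \<open>(0, 1)\<close>; a
  dyadic number slightly above \<open>h u\<close> lies in the orbit, and \<open>hinv h\<close>
  brings it back between \<open>u\<close> and \<open>v\<close>.\<close>

lemma orbit_of_1_dense:
  assumes "u < v" shows "\<exists>g \<in> chain S. u < g 1 \<and> g 1 < v"
proof -
  note cl = subgroup_real_closed[OF subgroup_chain[of S]]
  obtain a where a: "a \<in> chain S" "1 < a u" using chain_push_right by blast
  obtain b where b: "b \<in> chain S" "b (a u) < 2" "\<forall>t > 1. 1 < b t"
    using right_map_contract[of 2 "a u"] a(2) by auto
  define h where "h = hinv (mid_map \<circ> left_map) \<circ> b \<circ> a"
  have h: "h \<in> chain S" unfolding h_def by (intro cl shift_map_mem a b)
  note hs = real_carrier_simps[OF cl(4)[OF h]]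
  have "h u = b (a u) - 1" using shift_map(2)[of "b (a u)"] b(2) by (simp add: h_def)
  then have u: "0 < h u" "h u < 1" using a b by auto
  \<comment> \<open>Capped at \<open>1\<close> because \<open>dyadic_orbit\<close> reaches only the
    unit interval.\<close>
  define w where "w = min (h v) 1"
  have w: "h u < w" "w \<le> 1" using assms u by (auto simp: w_def hs)
  obtain n where n: "1 / 2 ^ n < w - h u"
    using real_arch_pow_inv[of "w - h u" "1 / 2"] w by (auto simp: power_one_over)
  define m where "m = nat (\<lfloor>h u * 2 ^ n\<rfloor> + 1)"
  have "0 \<le> h u * 2 ^ n" using u by simp
  then have m: "real m = of_int \<lfloor>h u * 2 ^ n\<rfloor> + 1" by (simp add: m_def)
  have lt: "h u < real m / 2 ^ n"
  proof -
    have "h u * 2 ^ n < real m" using m by linarith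
    then show ?thesis by (simp add: less_divide_eq)
  qed
  have gt: "real m / 2 ^ n < w"
  proof -
    have "real m \<le> h u * 2 ^ n + 1" using m by linarith
    then have "real m / 2 ^ n \<le> (h u * 2 ^ n + 1) / 2 ^ n" by (intro divide_right_mono) auto
    also have "\<dots> = h u + 1 / 2 ^ n" by (simp add: add_divide_distrib)
    finally show ?thesis using n by linarith
  qed
  have "real m / 2 ^ n < 1" using gt w(2) by linarith
  then have "m \<le> 2 ^ n" by (simp add: divide_less_eq)
  then obtain g where g: "g \<in> chain S" "g 1 = real m / 2 ^ n" using dyadic_orbit by blast
  have "u < hinv h (g 1)" "hinv h (g 1) < v"
    unfolding hs(10,11) using lt gt g(2) by (auto simp: w_def)
  then show ?thesis using cl(2)[OF cl(3)[OF h] g(1)] by (intro bexI[of _ "hinv h \<circ> g"]) auto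
qed

text \<open>With \<open>g 1\<close> between \<open>u\<close> and \<open>v\<close>, it suffices to
  bring \<open>[x, y]\<close> strictly between \<open>1\<close> and \<open>hinv g v\<close>: push it
  past \<open>1\<close>, then contract it towards \<open>1\<close> by a negative power of
  \<open>right_map S\<close>.\<close>

lemma chain_transitive:
  assumes "x \<le> y" "u < v" shows "\<exists>g \<in> chain S. u < g x \<and> g y < v"
proof -
  note cl = subgroup_real_closed[OF subgroup_chain[of S]]
  obtain g where g: "g \<in> chain S" "u < g 1" "g 1 < v" using orbit_of_1_dense[OF assms(2)] by blast
  note gs = real_carrier_simps[OF cl(4)[OF g(1)]]
  obtain a where a: "a \<in> chain S" "1 < a x" using chain_push_right by blast
  have ay: "1 < a y" using a(2) real_carrier_simps(6)[OF cl(4)[OF a(1)], of x y] assms(1) by simp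
  have v: "1 < hinv g v" using g(3) by (simp only: gs)
  obtain b where b: "b \<in> chain S" "b (a y) < hinv g v" "\<forall>t > 1. 1 < b t"
    using right_map_contract[OF v ay] by blast
  have "1 < b (a x)" using a(2) b(3) by simp
  then have "g 1 < g (b (a x))" by (simp only: gs)
  then have "u < (g \<circ> b \<circ> a) x" using g(2) by simp
  moreover have "(g \<circ> b \<circ> a) y < v" using b(2) by (simp add: gs)
  moreover have "g \<circ> b \<circ> a \<in> chain S" by (intro cl g a b)
  ultimately show ?thesis by blast
qed

text \<open>Each generator is the identity on a ray, and transitivity supplies a conjugating element
  that stretches this ray over the given interval.\<close>

lemma derived_chain_agrees:
  assumes "g \<in> chain S"
  shows "\<exists>h \<in> derived Homeo_plus_real (chain S). \<forall>t. x \<le> t \<and> t \<le> y \<longrightarrow> h t = g t"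
  unfolding chain_def
proof (rule derived_agrees_on_interval[OF chain_gens_closed _ assms[unfolded chain_def]])
  fix s and x y :: real
  assume s: "s \<in> {left_map, mid_map, right_map S}"
  note cl = subgroup_real_closed[OF subgroup_chain[of S]]
  have move: "\<exists>p \<in> chain S. \<forall>t. x \<le> t \<and> t \<le> y \<longrightarrow> p (s (hinv p t)) = t"
    if "\<And>t. a < t \<Longrightarrow> s t = t" for a s
  proof -
    obtain p where p: "p \<in> chain S" "p a < x"
      using chain_transitive[of a a "x - 1" x] by auto
    note ps = real_carrier_simps[OF cl(4)[OF p(1)]]
    have "p (s (hinv p t)) = t" if "x \<le> t" for t
    proof -
      have "a < hinv p t" using p(2) that by (simp only: ps)
      then show ?thesis using \<open>\<And>t. a < t \<Longrightarrow> s t = t\<close> by (simp add: ps)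
    qed
    then show ?thesis using p(1) by blast
  qed
  have move': "\<exists>p \<in> chain S. \<forall>t. x \<le> t \<and> t \<le> y \<longrightarrow> p (s (hinv p t)) = t"
    if "\<And>t. t < a \<Longrightarrow> s t = t" for a s
  proof -
    obtain p where p: "p \<in> chain S" "y < p a"
      using chain_transitive[of a a y "y + 1"] by auto
    note ps = real_carrier_simps[OF cl(4)[OF p(1)]]
    have "p (s (hinv p t)) = t" if "t \<le> y" for t
    proof -
      have "hinv p t < a" using p(2) that by (simp only: ps)
      then show ?thesis using \<open>\<And>t. t < a \<Longrightarrow> s t = t\<close> by (simp add: ps)
    qed
    then show ?thesis using p(1) by blast
  qed
  have "left_map t = t" if "1 < t" for t using that by (simp add: left_map_def)
  moreover have "mid_map t = t" if "3 < t" for t using that by (simp add: mid_map_def)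
  moreover have "right_map S t = t" if "t < 1" for t using that by (simp add: right_map_values)
  ultimately show "\<exists>p \<in> generate Homeo_plus_real {left_map, mid_map, right_map S}.
      \<forall>t. x \<le> t \<and> t \<le> y \<longrightarrow> p (s (hinv p t)) = t"
    unfolding chain_def[symmetric]
    using s move[of 1 left_map] move[of 3 mid_map] move'[of 1 "right_map S"] by blast
qed

lemma derived_chain_transitive:
  assumes "x < y" "u < v" shows "\<exists>h \<in> derived Homeo_plus_real (chain S). u < h x \<and> h y < v"
proof -
  obtain g where g: "g \<in> chain S" "u < g x" "g y < v"
    using chain_transitive[of x y u v] assms by auto
  obtain h where "h \<in> derived Homeo_plus_real (chain S)" "\<forall>t. x \<le> t \<and> t \<le> y \<longrightarrow> h t = g t"
    using derived_chain_agrees[OF g(1)] by blast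
  then show ?thesis using g assms by (intro bexI[of _ h]) auto
qed

text \<open>Near \<open>-\<infinity>\<close> and near \<open>+\<infinity>\<close> all elements of the chain group are translations, so
  commutators are trivial there.\<close>

lemma chain_germs:
  assumes "g \<in> chain S"
  shows "\<exists>a b x y. (\<forall>t < x. g t = t + a) \<and> (\<forall>t > y. g t = t + b)"
  using assms[unfolded chain_def]
proof induction
  case one
  show ?case by (intro exI[of _ 0]) simp
next
  case (incl s)
  moreover have "\<forall>t < -1. left_map t = t + 1" "\<forall>t > 1. left_map t = t + 0"
    "\<forall>t < 0. mid_map t = t + 0" "\<forall>t > 3. mid_map t = t + 0"
    "\<forall>t < 1. right_map S t = t + 0" "\<forall>t > 2. right_map S t = t + 1"
    by (simp_all add: left_map_def mid_map_def right_map_values)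
  ultimately show ?case by blast
next
  case (inv s)
  have "\<exists>a b x y. (\<forall>t < x. s t = t + a) \<and> (\<forall>t > y. s t = t + b)"
  proof -
    have "\<forall>t < -1. left_map t = t + 1" "\<forall>t > 1. left_map t = t + 0"
      "\<forall>t < 0. mid_map t = t + 0" "\<forall>t > 3. mid_map t = t + 0"
      "\<forall>t < 1. right_map S t = t + 0" "\<forall>t > 2. right_map S t = t + 1"
      by (simp_all add: left_map_def mid_map_def right_map_values)
    then show ?thesis using inv by blast
  qed
  then obtain a b x y where s: "\<And>t. t < x \<Longrightarrow> s t = t + a" "\<And>t. t > y \<Longrightarrow> s t = t + b" by blast
  have sc: "s \<in> carrier Homeo_plus_real" using inv chain_gens_closed by blast
  note ss = real_carrier_simps[OF sc]
  have "\<forall>t < x + a. hinv s t = t + (- a)" "\<forall>t > y + b. hinv s t = t + (- b)"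
    unfolding ss(14) using s by simp_all
  then show ?case unfolding inv_real[OF sc] by blast
next
  case (eng g h)
  then have cl: "g \<in> carrier Homeo_plus_real" "h \<in> carrier Homeo_plus_real"
    using HR.generate_in_carrier[OF chain_gens_closed] by blast+
  obtain a b x y where g: "\<And>t. t < x \<Longrightarrow> g t = t + a" "\<And>t. t > y \<Longrightarrow> g t = t + b"
    using eng.IH(1) by blast
  obtain a' b' x' y' where h: "\<And>t. t < x' \<Longrightarrow> h t = t + a'" "\<And>t. t > y' \<Longrightarrow> h t = t + b'"
    using eng.IH(2) by blast
  have "\<forall>t < min x' (x - a'). (g \<circ> h) t = t + (a' + a)"
    "\<forall>t > max y' (y - b'). (g \<circ> h) t = t + (b' + b)"
    using g h by simp_all
  then show ?case unfolding mult_real[OF cl] by blast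
qed

lemma derived_chain_bounded:
  assumes "g \<in> derived Homeo_plus_real (chain S)"
  shows "\<exists>x y. \<forall>t. t < x \<or> y < t \<longrightarrow> g t = t"
proof (rule derived_real_induct[OF subgroup_chain assms, where P = "\<lambda>g. \<exists>x y. \<forall>t. t < x \<or> y < t \<longrightarrow> g t = t"])
  show "\<exists>x y. \<forall>t. t < x \<or> y < t \<longrightarrow> id t = t" by simp
next
  fix g h assume g: "g \<in> chain S" and h: "h \<in> chain S"
  note cl = subgroup_real_closed[OF subgroup_chain[of S]]
  note gs = real_carrier_simps[OF cl(4)[OF g]] and hs = real_carrier_simps[OF cl(4)[OF h]]
  obtain a b x y where G: "\<And>t. t < x \<Longrightarrow> g t = t + a" "\<And>t. t > y \<Longrightarrow> g t = t + b"
    using chain_germs[OF g] by blast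
  obtain a' b' x' y' where H: "\<And>t. t < x' \<Longrightarrow> h t = t + a'" "\<And>t. t > y' \<Longrightarrow> h t = t + b'"
    using chain_germs[OF h] by blast
  have Gi: "hinv g t = t - a" if "t < x + a" for t
    unfolding gs(14) using G(1)[of "t - a"] that by simp
  have Gj: "hinv g t = t - b" if "y + b < t" for t
    unfolding gs(14) using G(2)[of "t - b"] that by simp
  have Hi: "hinv h t = t - a'" if "t < x' + a'" for t
    unfolding hs(14) using H(1)[of "t - a'"] that by simp
  have Hj: "hinv h t = t - b'" if "y' + b' < t" for t
    unfolding hs(14) using H(2)[of "t - b'"] that by simp
  \<comment> \<open>Below \<open>l\<close> each of the four factors is evaluated where it is a
    translation; \<open>r\<close> is the counterpart at the other end.\<close>
  define l where "l = min (x' + a') (min (x + a + a') (min (x' + a + a') (x + a)))"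
  define r where "r = max (y' + b') (max (y + b + b') (max (y' + b + b') (y + b)))"
  have "(g \<circ> h \<circ> hinv g \<circ> hinv h) t = t" if "t < l \<or> r < t" for t
    using that
  proof
    assume "t < l"
    then show ?thesis using Hi[of t] Gi[of "t - a'"] H(1)[of "t - a' - a"] G(1)[of "t - a"]
      by (simp add: l_def)
  next
    assume "r < t"
    then show ?thesis using Hj[of t] Gj[of "t - b'"] H(2)[of "t - b' - b"] G(2)[of "t - b"]
      by (simp add: r_def)
  qed
  then show "\<exists>x y. \<forall>t. t < x \<or> y < t \<longrightarrow> (g \<circ> h \<circ> hinv g \<circ> hinv h) t = t" by blast
next
  fix g h :: "real \<Rightarrow> real"
  assume "\<exists>x y. \<forall>t. t < x \<or> y < t \<longrightarrow> g t = t" "\<exists>x y. \<forall>t. t < x \<or> y < t \<longrightarrow> h t = t"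
  then obtain x y x' y' where "\<And>t. t < x \<or> y < t \<Longrightarrow> g t = t" "\<And>t. t < x' \<or> y' < t \<Longrightarrow> h t = t"
    by blast
  then have "\<forall>t. t < min x x' \<or> max y y' < t \<longrightarrow> (g \<circ> h) t = t" by simp
  then show "\<exists>x y. \<forall>t. t < x \<or> y < t \<longrightarrow> (g \<circ> h) t = t" by blast
qed

text \<open>Take the second derived subgroup as \<open>D\<close> in
  \<open>commutator_mem_of_generators\<close>. Commutators of neighbouring generators come from the
  two copies of Thompson's group, and the outer generators commute because their supports are
  disjoint.\<close>

lemma derived_chain_perfect:
  "derived Homeo_plus_real (chain S) \<subseteq> derived Homeo_plus_real (derived Homeo_plus_real (chain S))"
    (is "_ \<subseteq> ?D")
proof -
  note cl = subgroup_real_closed[OF subgroup_chain[of S]]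
  note dcl = subgroup_real_closed[OF subgroup_derived_chain[of S]]
  have KC: "chain S \<subseteq> carrier Homeo_plus_real" using cl(4) by blast
  have DC: "derived Homeo_plus_real (chain S) \<subseteq> carrier Homeo_plus_real" using dcl(4) by blast
  have D: "subgroup ?D Homeo_plus_real" using HR.derived_is_subgroup[OF DC] .
  have sub: "derived Homeo_plus_real (derived Homeo_plus_real L) \<subseteq> ?D" if "L \<subseteq> chain S" for L
    by (intro HR.mono_derived that)
  have gen_sub: "generate Homeo_plus_real L \<subseteq> chain S" if "L \<subseteq> {left_map, mid_map, right_map S}" for L
    unfolding chain_def by (rule HR.mono_generate[OF that])
  have lm: "mid_map \<circ> left_map \<circ> hinv mid_map \<circ> hinv left_map \<in> ?D"
    using chain_pairs_Thompson(2) sub[OF gen_sub[of "{left_map, mid_map}"]] by blast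
  have mr: "right_map S \<circ> mid_map \<circ> hinv (right_map S) \<circ> hinv mid_map \<in> ?D"
    using chain_pairs_Thompson(4)[of S] sub[OF gen_sub[of "{mid_map, right_map S}"]] by blast
  have lr: "right_map S \<circ> left_map \<circ> hinv (right_map S) \<circ> hinv left_map = id"
  proof
    fix t
    note ls = real_carrier_simps[OF left_map_closed]
    note rs = real_carrier_simps[OF right_map_closed[of S]]
    have comm: "left_map (right_map S s) = right_map S (left_map s)" for s
    proof (cases "s \<le> 1")
      case True
      then have "left_map s \<le> 1" by (auto simp: left_map_def)
      then show ?thesis using True by (simp add: right_map_values)
    next
      case False
      then have "1 < right_map S s" using chain_maps_ge(3)[of s S] by simp
      then show ?thesis using False by (simp add: left_map_def)
    qed
    show "(right_map S \<circ> left_map \<circ> hinv (right_map S) \<circ> hinv left_map) t = id t"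
      using comm[of "hinv (right_map S) (hinv left_map t)"] by (simp add: ls rs)
  qed
  have inv: "b \<circ> a \<circ> hinv b \<circ> hinv a \<in> ?D"
    if ab: "a \<circ> b \<circ> hinv a \<circ> hinv b \<in> ?D" "a \<in> carrier Homeo_plus_real" "b \<in> carrier Homeo_plus_real" for a b
  proof -
    have c: "a \<circ> b \<circ> hinv a \<circ> hinv b \<in> carrier Homeo_plus_real"
      using subgroup_real_closed(4)[OF D ab(1)] .
    have "hinv (a \<circ> b \<circ> hinv a \<circ> hinv b) = b \<circ> a \<circ> hinv b \<circ> hinv a"
    proof
      fix t show "hinv (a \<circ> b \<circ> hinv a \<circ> hinv b) t = (b \<circ> a \<circ> hinv b \<circ> hinv a) t"
        unfolding real_carrier_simps(14)[OF c]
        by (simp add: real_carrier_simps[OF ab(2)] real_carrier_simps[OF ab(3)])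
    qed
    then show ?thesis using subgroup_real_closed(3)[OF D ab(1)] by simp
  qed
  have self: "a \<circ> a \<circ> hinv a \<circ> hinv a \<in> ?D" if "a \<in> carrier Homeo_plus_real" for a
  proof -
    have "a \<circ> a \<circ> hinv a \<circ> hinv a = id"
      using real_carrier_simps[OF that] by (simp add: fun_eq_iff)
    then show ?thesis using subgroup_real_closed(1)[OF D] by (simp only:)
  qed
  have lr': "right_map S \<circ> left_map \<circ> hinv (right_map S) \<circ> hinv left_map \<in> ?D"
    unfolding lr using subgroup_real_closed(1)[OF D] .
  note c = left_map_closed mid_map_closed right_map_closed[of S]
  show ?thesis
    unfolding chain_def
  proof (rule HR.commutator_mem_of_generators[OF D[unfolded chain_def] chain_gens_closed])
    fix a b assume ab: "a \<in> {left_map, mid_map, right_map S}" "b \<in> {left_map, mid_map, right_map S}"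
    then have abc: "a \<in> carrier Homeo_plus_real" "b \<in> carrier Homeo_plus_real" using c by auto
    have "a \<circ> b \<circ> hinv a \<circ> hinv b \<in> ?D"
      using ab(1)
    proof (elim insertE emptyE)
      assume a: "a = left_map"
      show ?thesis using ab(2) unfolding a
        by (elim insertE emptyE; hypsubst) (rule self[OF c(1)] inv[OF lm c(2,1)] inv[OF lr' c(3,1)])+
    next
      assume a: "a = mid_map"
      show ?thesis using ab(2) unfolding a
        by (elim insertE emptyE; hypsubst) (rule self[OF c(2)] lm inv[OF mr c(3,2)])+
    next
      assume a: "a = right_map S"
      show ?thesis using ab(2) unfolding a
        by (elim insertE emptyE; hypsubst) (rule self[OF c(3)] mr lr')+
    qed
    then show "a \<otimes>\<^bsub>Homeo_plus_real\<^esub> b \<otimes>\<^bsub>Homeo_plus_real\<^esub> inv\<^bsub>Homeo_plus_real\<^esub> a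
        \<otimes>\<^bsub>Homeo_plus_real\<^esub> inv\<^bsub>Homeo_plus_real\<^esub> b \<in> derived Homeo_plus_real
          (derived Homeo_plus_real (generate Homeo_plus_real {left_map, mid_map, right_map S}))"
      unfolding chain_def using abc by simp
  next
    fix x d assume x: "x \<in> generate Homeo_plus_real {left_map, mid_map, right_map S}"
      and d: "d \<in> derived Homeo_plus_real
        (derived Homeo_plus_real (generate Homeo_plus_real {left_map, mid_map, right_map S}))"
    show "x \<otimes>\<^bsub>Homeo_plus_real\<^esub> d \<otimes>\<^bsub>Homeo_plus_real\<^esub> inv\<^bsub>Homeo_plus_real\<^esub> x \<in> derived Homeo_plus_real
        (derived Homeo_plus_real (generate Homeo_plus_real {left_map, mid_map, right_map S}))"
    proof (rule HR.conj_derived_closed[OF DC[unfolded chain_def] _ _ d])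
      have xS: "x \<in> chain S" using x by (simp add: chain_def)
      show "x \<in> carrier Homeo_plus_real" using cl(4)[OF xS] .
      fix s assume s: "s \<in> derived Homeo_plus_real (generate Homeo_plus_real {left_map, mid_map, right_map S})"
      show "x \<otimes>\<^bsub>Homeo_plus_real\<^esub> s \<otimes>\<^bsub>Homeo_plus_real\<^esub> inv\<^bsub>Homeo_plus_real\<^esub> x
          \<in> derived Homeo_plus_real (generate Homeo_plus_real {left_map, mid_map, right_map S})"
      proof (rule HR.conj_derived_closed[OF KC[unfolded chain_def] \<open>x \<in> carrier Homeo_plus_real\<close> _ s])
        fix k assume "k \<in> generate Homeo_plus_real {left_map, mid_map, right_map S}"
        then show "x \<otimes>\<^bsub>Homeo_plus_real\<^esub> k \<otimes>\<^bsub>Homeo_plus_real\<^esub> inv\<^bsub>Homeo_plus_real\<^esub> x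
            \<in> generate Homeo_plus_real {left_map, mid_map, right_map S}"
          using x HR.generate_m_inv_closed[OF chain_gens_closed x] by (intro generate.eng)
      qed
    qed
  qed
qed

section \<open>An invariant that distinguishes uncountably many isomorphism types\<close>

definition commuting_sets :: "('a, 'b) monoid_scheme \<Rightarrow> nat set set" where
  "commuting_sets G = (\<lambda>(a, b, c). {n. c \<otimes>\<^bsub>G\<^esub> (inv\<^bsub>G\<^esub> (a [^]\<^bsub>G\<^esub> n) \<otimes>\<^bsub>G\<^esub> b \<otimes>\<^bsub>G\<^esub> a [^]\<^bsub>G\<^esub> n) =
      (inv\<^bsub>G\<^esub> (a [^]\<^bsub>G\<^esub> n) \<otimes>\<^bsub>G\<^esub> b \<otimes>\<^bsub>G\<^esub> a [^]\<^bsub>G\<^esub> n) \<otimes>\<^bsub>G\<^esub> c}) ` (carrier G \<times> carrier G \<times> carrier G)"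

lemma countable_commuting_sets: "countable (carrier G) \<Longrightarrow> countable (commuting_sets G)"
  unfolding commuting_sets_def by (intro countable_image countable_SIGMA) auto

lemma commuting_sets_iso:
  assumes "group G" "group H" "G \<cong> H"
  shows "commuting_sets G \<subseteq> commuting_sets H"
proof -
  obtain h where h: "h \<in> iso G H" using assms(3) by (auto simp: is_iso_def)
  interpret h: group_hom G H h
    using assms h by (auto simp: group_hom_def group_hom_axioms_def iso_def)
  have inj: "inj_on h (carrier G)" using h by (auto simp: iso_def bij_betw_def)
  show ?thesis
  proof
    fix X assume "X \<in> commuting_sets G"
    then obtain a b c where abc: "a \<in> carrier G" "b \<in> carrier G" "c \<in> carrier G"
      and X: "X = {n. c \<otimes>\<^bsub>G\<^esub> (inv\<^bsub>G\<^esub> (a [^]\<^bsub>G\<^esub> n) \<otimes>\<^bsub>G\<^esub> b \<otimes>\<^bsub>G\<^esub> a [^]\<^bsub>G\<^esub> n) =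
        (inv\<^bsub>G\<^esub> (a [^]\<^bsub>G\<^esub> n) \<otimes>\<^bsub>G\<^esub> b \<otimes>\<^bsub>G\<^esub> a [^]\<^bsub>G\<^esub> n) \<otimes>\<^bsub>G\<^esub> c}"
      by (auto simp: commuting_sets_def)
    have conj: "inv\<^bsub>H\<^esub> (h a [^]\<^bsub>H\<^esub> n) \<otimes>\<^bsub>H\<^esub> h b \<otimes>\<^bsub>H\<^esub> h a [^]\<^bsub>H\<^esub> n =
        h (inv\<^bsub>G\<^esub> (a [^]\<^bsub>G\<^esub> n) \<otimes>\<^bsub>G\<^esub> b \<otimes>\<^bsub>G\<^esub> a [^]\<^bsub>G\<^esub> n)" for n :: nat
      using abc by (simp add: h.hom_nat_pow)
    have "X = {n. h c \<otimes>\<^bsub>H\<^esub> (inv\<^bsub>H\<^esub> (h a [^]\<^bsub>H\<^esub> n) \<otimes>\<^bsub>H\<^esub> h b \<otimes>\<^bsub>H\<^esub> h a [^]\<^bsub>H\<^esub> n) =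
        (inv\<^bsub>H\<^esub> (h a [^]\<^bsub>H\<^esub> n) \<otimes>\<^bsub>H\<^esub> h b \<otimes>\<^bsub>H\<^esub> h a [^]\<^bsub>H\<^esub> n) \<otimes>\<^bsub>H\<^esub> h c}"
      unfolding X conj
    proof (rule Collect_cong)
      fix n :: nat
      define z where "z = inv\<^bsub>G\<^esub> (a [^]\<^bsub>G\<^esub> n) \<otimes>\<^bsub>G\<^esub> b \<otimes>\<^bsub>G\<^esub> a [^]\<^bsub>G\<^esub> n"
      have z: "z \<in> carrier G" unfolding z_def using abc by simp
      have "h c \<otimes>\<^bsub>H\<^esub> h z = h z \<otimes>\<^bsub>H\<^esub> h c \<longleftrightarrow> h (c \<otimes>\<^bsub>G\<^esub> z) = h (z \<otimes>\<^bsub>G\<^esub> c)"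
        using abc(3) z by simp
      also have "\<dots> \<longleftrightarrow> c \<otimes>\<^bsub>G\<^esub> z = z \<otimes>\<^bsub>G\<^esub> c"
        using abc(3) z by (intro inj_on_eq_iff[OF inj] h.G.m_closed)
      finally show "(c \<otimes>\<^bsub>G\<^esub> (inv\<^bsub>G\<^esub> (a [^]\<^bsub>G\<^esub> n) \<otimes>\<^bsub>G\<^esub> b \<otimes>\<^bsub>G\<^esub> a [^]\<^bsub>G\<^esub> n) =
          inv\<^bsub>G\<^esub> (a [^]\<^bsub>G\<^esub> n) \<otimes>\<^bsub>G\<^esub> b \<otimes>\<^bsub>G\<^esub> a [^]\<^bsub>G\<^esub> n \<otimes>\<^bsub>G\<^esub> c) =
          (h c \<otimes>\<^bsub>H\<^esub> h (inv\<^bsub>G\<^esub> (a [^]\<^bsub>G\<^esub> n) \<otimes>\<^bsub>G\<^esub> b \<otimes>\<^bsub>G\<^esub> a [^]\<^bsub>G\<^esub> n) =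
          h (inv\<^bsub>G\<^esub> (a [^]\<^bsub>G\<^esub> n) \<otimes>\<^bsub>G\<^esub> b \<otimes>\<^bsub>G\<^esub> a [^]\<^bsub>G\<^esub> n) \<otimes>\<^bsub>H\<^esub> h c)"
        unfolding z_def by blast
    qed
    then show "X \<in> commuting_sets H"
      unfolding commuting_sets_def using abc
      by (intro image_eqI[where x = "(h a, h b, h c)"]) simp_all
  qed
qed

section \<open>Recovering \<open>S\<close> from the derived subgroup\<close>

lemma derived_chain_conj:
  assumes x: "x \<in> chain S" and d: "d \<in> derived Homeo_plus_real (chain S)"
  shows "x \<circ> d \<circ> hinv x \<in> derived Homeo_plus_real (chain S)"
proof -
  note cl = subgroup_real_closed[OF subgroup_chain[of S]]
  note dc = subgroup_real_closed(4)[OF subgroup_derived_chain[of S] d]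
  have "x \<otimes>\<^bsub>Homeo_plus_real\<^esub> d \<otimes>\<^bsub>Homeo_plus_real\<^esub> inv\<^bsub>Homeo_plus_real\<^esub> x
      \<in> derived Homeo_plus_real (chain S)"
  proof (rule HR.conj_derived_closed[OF _ cl(4)[OF x] _ d])
    show "chain S \<subseteq> carrier Homeo_plus_real" using cl(4) by blast
    fix k assume k: "k \<in> chain S"
    then have "x \<circ> k \<circ> hinv x \<in> chain S" by (intro cl x)
    then show "x \<otimes>\<^bsub>Homeo_plus_real\<^esub> k \<otimes>\<^bsub>Homeo_plus_real\<^esub> inv\<^bsub>Homeo_plus_real\<^esub> x \<in> chain S"
      using cl(4)[OF x] cl(4)[OF k] by simp
  qed
  then show ?thesis using cl(4)[OF x] dc by simp
qed

text \<open>The interval is fitted to a bump magnified to \<open>(5 / 4, 3 / 2)\<close>: it starts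
  at the midpoint \<open>11 / 8\<close>, which such a bump moves into the interval, and it stays
  inside the region that is fixed when the bump is absent.\<close>

lemma derived_chain_interval_support:
  "\<exists>c \<in> derived Homeo_plus_real (chain S). \<forall>t. c t = t \<longleftrightarrow> t \<le> 11 / 8 \<or> 3 / 2 \<le> t"
proof -
  note cl = subgroup_real_closed[OF subgroup_chain[of S]]
  note ls = real_carrier_simps[OF left_map_closed]
  note ms = real_carrier_simps[OF mid_map_closed]
  define k where "k = hinv mid_map \<circ> left_map \<circ> hinv (hinv mid_map) \<circ> hinv left_map"
  have k: "k \<in> derived Homeo_plus_real (chain S)"
    unfolding k_def
    by (rule commutator_mem_derived[OF subgroup_chain cl(3)[OF chain_gens_mem(2)] chain_gens_mem(1)])
  \<comment> \<open>\<open>left_map\<close> and \<open>mid_map\<close> fail to commute exactly at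
    the points of \<open>(-1, 1)\<close>, and \<open>left_map\<close> carries these to
    \<open>(0, 1)\<close>.\<close>
  have k_fix: "k t = t \<longleftrightarrow> t \<le> 0 \<or> 1 \<le> t" for t
  proof -
    obtain s where s: "t = left_map s" using ls(2) by blast
    have "k t = hinv mid_map (left_map (mid_map s))"
      unfolding s k_def by (simp add: ls ms inv_inv_eq)
    then have "k t = t \<longleftrightarrow> left_map (mid_map s) = mid_map (left_map s)"
      unfolding s by (simp only: ms(14))
    also have "\<dots> \<longleftrightarrow> s \<le> -1 \<or> 1 \<le> s"
      by (auto simp: left_map_def mid_map_def field_simps split: if_splits)
    also have "\<dots> \<longleftrightarrow> t \<le> 0 \<or> 1 \<le> t"
      unfolding s by (auto simp: left_map_def split: if_splits)
    finally show ?thesis .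
  qed
  define T where "T = mid_map \<circ> left_map"
  \<comment> \<open>Chosen to carry \<open>(0, 1)\<close> to \<open>(11 / 8, 3 / 2)\<close>. The
    successive images of \<open>0\<close> are \<open>1 / 2\<close>, \<open>3 / 4\<close>,
    \<open>-1 / 4\<close>, \<open>3 / 8\<close>, \<open>11 / 8\<close>; those of \<open>1\<close>
    are \<open>1\<close>, \<open>1\<close>, \<open>0\<close>, \<open>1 / 2\<close>,
    \<open>3 / 2\<close>.\<close>
  define w where "w = T \<circ> left_map \<circ> hinv T \<circ> left_map \<circ> left_map"
  have T: "T \<in> chain S" unfolding T_def by (rule shift_map_mem)
  have w: "w \<in> chain S" unfolding w_def by (intro cl T chain_gens_mem)
  note ws = real_carrier_simps[OF cl(4)[OF w]]
  have "hinv T (3 / 4) = - 1 / 4" "hinv T 1 = 0" "T (3 / 8) = 11 / 8" "T (1 / 2) = 3 / 2"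
    unfolding T_def by (simp_all only: shift_map)
  then have w01: "w 0 = 11 / 8" "w 1 = 3 / 2"
    by (simp_all add: w_def left_map_def)
  have "(w \<circ> k \<circ> hinv w) t = t \<longleftrightarrow> t \<le> 11 / 8 \<or> 3 / 2 \<le> t" for t
  proof -
    have "(w \<circ> k \<circ> hinv w) t = t \<longleftrightarrow> k (hinv w t) = hinv w t"
      using ws(14)[of t "k (hinv w t)"] by auto
    also have "\<dots> \<longleftrightarrow> t \<le> 11 / 8 \<or> 3 / 2 \<le> t"
      unfolding k_fix ws(12,13) w01 ..
    finally show ?thesis .
  qed
  then show ?thesis using derived_chain_conj[OF w k] by blast
qed

text \<open>On \<open>[1, 3 / 2]\<close> the element \<open>a\<close> halves the distance to
  \<open>1\<close> and \<open>b\<close> is \<open>bump S\<close>. Conjugation by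
  \<open>a ^^ n\<close> magnifies \<open>b\<close> by \<open>2 ^ n\<close> about \<open>1\<close>,
  which moves the interval of index \<open>n\<close> to \<open>(5 / 4, 3 / 2)\<close>, where
  \<open>c\<close> tests for a bump.\<close>

lemma complement_mem_commuting_sets:
  "- S \<in> commuting_sets (Homeo_plus_real\<lparr>carrier := derived Homeo_plus_real (chain S)\<rparr>)"
proof -
  let ?D = "derived Homeo_plus_real (chain S)"
  note cl = subgroup_real_closed[OF subgroup_chain[of S]]
  note dcl = subgroup_real_closed[OF subgroup_derived_chain[of S]]
  define T where "T = mid_map \<circ> left_map"
  have T: "T \<in> chain S" unfolding T_def by (rule shift_map_mem)
  define h where "h = T \<circ> mid_map \<circ> hinv T"
  have h: "h \<in> chain S" unfolding h_def by (intro cl T chain_gens_mem)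
  note hs = real_carrier_simps[OF cl(4)[OF h]]
  have h_eq: "h t = 2 * t - 1" if "1 \<le> t" "t \<le> 3 / 2" for t
  proof -
    have 1: "hinv T t = t - 1" unfolding T_def using that by (intro shift_map(2)) simp
    have 2: "mid_map (t - 1) = 2 * t - 2" using that by (simp add: mid_map_def)
    have "T (2 * t - 2) = 2 * t - 2 + 1" unfolding T_def using that by (intro shift_map(1)) simp
    then show ?thesis using 1 2 by (simp add: h_def)
  qed
  obtain a where a: "a \<in> ?D" "\<And>t. 1 \<le> t \<and> t \<le> 3 / 2 \<Longrightarrow> a t = hinv h t"
    using derived_chain_agrees[OF cl(3)[OF h]] by blast
  have a_eq: "a t = (t + 1) / 2" if "1 \<le> t" "t \<le> 3 / 2" for t
  proof -
    have "h ((t + 1) / 2) = t" using h_eq[of "(t + 1) / 2"] that by (simp add: field_simps)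
    then have "hinv h t = (t + 1) / 2" by (simp only: hs(14))
    then show ?thesis using a(2) that by simp
  qed
  \<comment> \<open>On \<open>[1, 3 / 2]\<close> the map \<open>h\<close> agrees with
    \<open>doubling_map\<close>, so \<open>hinv h\<close> strips it from \<open>right_map S\<close>
    and leaves the bump.\<close>
  obtain b where b: "b \<in> ?D" "\<And>t. 1 \<le> t \<and> t \<le> 3 / 2 \<Longrightarrow> b t = (hinv h \<circ> right_map S) t"
    using derived_chain_agrees[OF cl(2)[OF cl(3)[OF h] chain_gens_mem(3)]] by blast
  note bps = real_carrier_simps[OF bump_closed[of S]]
  have b_eq: "b t = bump S t" if "1 \<le> t" "t \<le> 3 / 2" for t
  proof -
    have bb: "1 \<le> bump S t" "bump S t \<le> 3 / 2"
      using that bps(6)[of 1 t] bps(6)[of t "3 / 2"] bump_fixed[OF gaps_le_1, of 1 S]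
        bump_fixed[OF gaps_ge, of "3 / 2" S] by simp_all
    then have "right_map S t = h (bump S t)" by (simp add: right_map_def doubling_map_def h_eq)
    then have "hinv h (right_map S t) = bump S t" by (simp only: hs(14))
    then show ?thesis using b(2)[of t] that by simp
  qed
  obtain c where c: "c \<in> ?D" "\<And>t. c t = t \<longleftrightarrow> t \<le> 11 / 8 \<or> 3 / 2 \<le> t"
    using derived_chain_interval_support by blast
  note cs = real_carrier_simps[OF dcl(4)[OF c(1)]]
  have a_pow: "(a ^^ n) (1 + u) = 1 + u / 2 ^ n" if u: "0 \<le> u" "u \<le> 1 / 2" for n u
  proof (induction n)
    case (Suc n)
    have "u / 2 ^ n \<le> u / 1" using u by (intro divide_left_mono) auto
    moreover have "0 \<le> u / 2 ^ n" using u by simp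
    ultimately have "u / 2 ^ n \<le> 1 / 2" "0 \<le> u / 2 ^ n" using u by linarith+
    then have "a (1 + u / 2 ^ n) = 1 + u / 2 ^ Suc n"
      by (subst a_eq) (simp_all add: field_simps)
    then show ?case using Suc by simp
  qed simp
  define z where "z n = hinv (a ^^ n) \<circ> b \<circ> (a ^^ n)" for n
  have z: "z n \<in> ?D" for n unfolding z_def by (intro dcl a b)
  have z_eq: "z n (1 + u) = 1 + v"
    if u: "0 \<le> u" "u \<le> 1 / 2" and v: "0 \<le> v" "v \<le> 1 / 2"
      and uv: "bump S (1 + u / 2 ^ n) = 1 + v / 2 ^ n" for n u v
  proof -
    note ps = real_carrier_simps[OF dcl(4)[OF dcl(5)[OF a(1), of n]]]
    have "u / 2 ^ n \<le> u / 1" using u by (intro divide_left_mono) auto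
    moreover have "0 \<le> u / 2 ^ n" using u by simp
    ultimately have "1 \<le> 1 + u / 2 ^ n" "1 + u / 2 ^ n \<le> 3 / 2" using u by linarith+
    then have "b (1 + u / 2 ^ n) = (a ^^ n) (1 + v)" using b_eq uv a_pow[OF v] by simp
    then have "hinv (a ^^ n) (b (1 + u / 2 ^ n)) = 1 + v" by (simp only: ps(14))
    then show ?thesis using a_pow[OF u] by (simp add: z_def)
  qed
  have z_out: "z n t = t" if "n \<notin> S" "5 / 4 \<le> t" "t \<le> 3 / 2" for n t
  proof -
    have "1 + (t - 1) / 2 ^ n \<in> gaps S"
    proof (rule gaps_closed_interval[OF that(1)])
      have "1 / 2 ^ (n + 2) = (1 / 4 :: real) / 2 ^ n" "1 / 2 ^ (n + 1) = (1 / 2 :: real) / 2 ^ n"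
        by (simp_all add: field_simps)
      then show "1 + 1 / 2 ^ (n + 2) \<le> 1 + (t - 1) / 2 ^ n" "1 + (t - 1) / 2 ^ n \<le> 1 + 1 / 2 ^ (n + 1)"
        using that by (simp_all only: add_le_cancel_left) (intro divide_right_mono; simp)+
    qed
    from bump_fixed[OF this] have "z n (1 + (t - 1)) = 1 + (t - 1)"
      using that by (intro z_eq) auto
    then show ?thesis by simp
  qed
  have comm: "c \<circ> z n = z n \<circ> c \<longleftrightarrow> n \<notin> S" for n
  proof
    assume eq: "c \<circ> z n = z n \<circ> c"
    show "n \<notin> S"
    proof
      assume "n \<in> S"
      \<comment> \<open>A map that commutes with \<open>c\<close> preserves its fixed points, but
        \<open>z n\<close> carries the fixed point \<open>11 / 8\<close> to \<open>23 / 16\<close>,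
        which \<open>c\<close> moves.\<close>
      from bump_moved[OF this] have "z n (1 + 3 / 8) = 1 + 7 / 16" by (intro z_eq) auto
      then have zp: "z n (11 / 8) = 23 / 16" by simp
      have "c (z n (11 / 8)) = z n (c (11 / 8))" using eq by (metis comp_apply)
      moreover have "c (11 / 8) = 11 / 8" unfolding c(2) by simp
      ultimately have "c (23 / 16) = 23 / 16" using zp by simp
      then show False unfolding c(2) by simp
    qed
  next
    assume n: "n \<notin> S"
    note zs = real_carrier_simps[OF dcl(4)[OF z[of n]]]
    \<comment> \<open>\<open>z n\<close> is the identity on \<open>[5 / 4, 3 / 2]\<close>, which
      contains the support of \<open>c\<close>, and it preserves the two rays outside.\<close>
    show "c \<circ> z n = z n \<circ> c"
    proof
      fix t :: real
      consider "t < 5 / 4" | "5 / 4 \<le> t" "t \<le> 3 / 2" | "3 / 2 < t" by linarith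
      then show "(c \<circ> z n) t = (z n \<circ> c) t"
      proof cases
        case 1
        then have "z n t < 5 / 4" using zs(5)[of t "5 / 4"] z_out[OF n, of "5 / 4"] by simp
        then have "c (z n t) = z n t" "c t = t" unfolding c(2) using 1 by simp_all
        then show ?thesis by simp
      next
        case 2
        have "c (5 / 4) = 5 / 4" "c (3 / 2) = 3 / 2" unfolding c(2) by simp_all
        then have "5 / 4 \<le> c t" "c t \<le> 3 / 2"
          using 2 cs(6)[of "5 / 4" t] cs(6)[of t "3 / 2"] by simp_all
        then show ?thesis using z_out[OF n] 2 by simp
      next
        case 3
        then have "3 / 2 < z n t" using zs(5)[of "3 / 2" t] z_out[OF n, of "3 / 2"] by simp
        then have "c (z n t) = z n t" "c t = t" unfolding c(2) using 3 by simp_all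
        then show ?thesis by simp
      qed
    qed
  qed
  let ?G = "Homeo_plus_real\<lparr>carrier := ?D\<rparr>"
  have pow: "a [^]\<^bsub>?G\<^esub> n = a ^^ n" for n :: nat
  proof (induction n)
    case (Suc n)
    have "a [^]\<^bsub>?G\<^esub> Suc n = (a ^^ n) \<circ> a"
      using Suc mult_real[OF dcl(4)[OF dcl(5)[OF a(1)]] dcl(4)[OF a(1)]] by simp
    then show ?case by (simp only: funpow_Suc_right)
  qed (simp add: id_def)
  have conj: "inv\<^bsub>?G\<^esub> (a [^]\<^bsub>?G\<^esub> n) \<otimes>\<^bsub>?G\<^esub> b \<otimes>\<^bsub>?G\<^esub> a [^]\<^bsub>?G\<^esub> n = z n" for n :: nat
  proof -
    have p: "a ^^ n \<in> ?D" by (intro dcl a)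
    have "inv\<^bsub>?G\<^esub> (a ^^ n) = hinv (a ^^ n)"
      using HR.m_inv_consistent[OF subgroup_derived_chain p] inv_real[OF dcl(4)[OF p]] by simp
    then show ?thesis
      using mult_real[OF dcl(4)[OF dcl(3)[OF p]] dcl(4)[OF b(1)]]
        mult_real[OF dcl(4)[OF dcl(2)[OF dcl(3)[OF p] b(1)]] dcl(4)[OF p]]
      by (simp add: pow z_def)
  qed
  have "- S = {n. c \<otimes>\<^bsub>?G\<^esub> (inv\<^bsub>?G\<^esub> (a [^]\<^bsub>?G\<^esub> n) \<otimes>\<^bsub>?G\<^esub> b \<otimes>\<^bsub>?G\<^esub> a [^]\<^bsub>?G\<^esub> n) =
      (inv\<^bsub>?G\<^esub> (a [^]\<^bsub>?G\<^esub> n) \<otimes>\<^bsub>?G\<^esub> b \<otimes>\<^bsub>?G\<^esub> a [^]\<^bsub>?G\<^esub> n) \<otimes>\<^bsub>?G\<^esub> c}"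
    unfolding conj using comm dcl(4)[OF c(1)] dcl(4)[OF z] by auto
  moreover have "(a, b, c) \<in> carrier ?G \<times> carrier ?G \<times> carrier ?G" using a(1) b(1) c(1) by simp
  ultimately show ?thesis
    unfolding commuting_sets_def by (intro image_eqI[where x = "(a, b, c)"]) (simp_all only: prod.case)
qed

lemma simple_derived_chain:
  "simple (Homeo_plus_real\<lparr>carrier := derived Homeo_plus_real (chain S)\<rparr>)"
proof (rule simple_real[OF subgroup_derived_chain derived_chain_bounded derived_chain_transitive
      derived_chain_perfect])
  obtain c where c: "c \<in> derived Homeo_plus_real (chain S)"
    "\<And>t. c t = t \<longleftrightarrow> t \<le> 11 / 8 \<or> 3 / 2 \<le> t"
    using derived_chain_interval_support by blast
  have "c (23 / 16) \<noteq> 23 / 16" unfolding c(2) by simp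
  then show "derived Homeo_plus_real (chain S) \<noteq> {id}" using c(1) by auto
qed

lemma (in group) countable_generate:
  assumes "countable S" "S \<subseteq> carrier G" shows "countable (generate G S)"
proof (cases "S = {}")
  case True
  then show ?thesis using generate_empty by simp
next
  case False
  then have S: "range (from_nat_into S) = S" using assms(1) by (rule range_from_nat_into)
  then have "generate G S = range (word_value G (from_nat_into S))"
    using range_word_value[of "from_nat_into S"] assms(2) by simp
  then show ?thesis by simp
qed

lemma countable_derived_chain: "countable (derived Homeo_plus_real (chain S))"
proof (rule countable_subset)
  show "derived Homeo_plus_real (chain S) \<subseteq> chain S"
    by (rule HR.derived_incl[OF _ subgroup_chain]) simp
  show "countable (chain S)"
    unfolding chain_def
    by (rule group.countable_generate[OF group_real _ chain_gens_closed]) simp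
qed

section \<open>Transplanting homeomorphisms of bounded support into a manifold\<close>

lemma line_open_interval_coordinates:
  fixes p q :: real assumes "p < q"
  obtains \<sigma> \<rho> :: "real \<Rightarrow> real" where "strict_mono \<sigma>" "continuous_on UNIV \<sigma>" "range \<sigma> = {p<..<q}"
    "continuous_on {p<..<q} \<rho>" "\<forall>t. \<rho> (\<sigma> t) = t"
proof -
  define \<sigma> where "\<sigma> t = (p + q) / 2 + (q - p) / pi * arctan t" for t
  define \<rho> where "\<rho> y = tan ((y - (p + q) / 2) * pi / (q - p))" for y
  have pos: "0 < (q - p) / pi" using assms by simp
  have mono: "strict_mono \<sigma>"
    unfolding \<sigma>_def
    by (intro strict_monoI add_strict_left_mono mult_strict_left_mono arctan_monotone pos)
  have inner: "(\<sigma> t - (p + q) / 2) * pi / (q - p) = arctan t" for t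
    using assms by (simp add: \<sigma>_def)
  have \<rho>\<sigma>: "\<rho> (\<sigma> t) = t" for t
    unfolding \<rho>_def inner by (rule tan_arctan)
  have angle: "- (pi / 2) < (y - (p + q) / 2) * pi / (q - p)"
    "(y - (p + q) / 2) * pi / (q - p) < pi / 2" if "p < y" "y < q" for y
  proof -
    define r where "r = (y - (p + q) / 2) / (q - p)"
    have "- (1 / 2) < r" "r < 1 / 2" using that assms by (simp_all add: r_def field_simps)
    then have "- (1 / 2) * pi < r * pi" "r * pi < 1 / 2 * pi"
      by (intro mult_strict_right_mono; simp)+
    then show "- (pi / 2) < (y - (p + q) / 2) * pi / (q - p)"
      "(y - (p + q) / 2) * pi / (q - p) < pi / 2" by (simp_all add: r_def)
  qed
  have range: "range \<sigma> = {p<..<q}"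
  proof (intro equalityI subsetI)
    fix y assume "y \<in> range \<sigma>"
    then obtain t where t: "y = \<sigma> t" by blast
    have "(q - p) / pi * - (pi / 2) < (q - p) / pi * arctan t"
      "(q - p) / pi * arctan t < (q - p) / pi * (pi / 2)"
      using arctan_bounded[of t] by (intro mult_strict_left_mono pos; simp)+
    moreover have "(q - p) / pi * - (pi / 2) = (p - q) / 2" "(q - p) / pi * (pi / 2) = (q - p) / 2"
      by (simp_all add: field_simps)
    ultimately have "(p - q) / 2 < \<sigma> t - (p + q) / 2" "\<sigma> t - (p + q) / 2 < (q - p) / 2"
      by (simp_all only: \<sigma>_def add_diff_cancel_left')
    then show "y \<in> {p<..<q}" by (simp add: t field_simps)
  next
    fix y assume "y \<in> {p<..<q}"
    then have "arctan (\<rho> y) = (y - (p + q) / 2) * pi / (q - p)"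
      unfolding \<rho>_def by (intro arctan_tan angle) auto
    then have "\<sigma> (\<rho> y) = y" using assms by (simp add: \<sigma>_def)
    then show "y \<in> range \<sigma>" by (metis rangeI)
  qed
  have \<sigma>c: "continuous_on UNIV \<sigma>" unfolding \<sigma>_def by (intro continuous_intros) auto
  have \<rho>c: "continuous_on {p<..<q} \<rho>"
    unfolding \<rho>_def
  proof (intro continuous_intros)
    have "cos ((y - (p + q) / 2) * pi / (q - p)) \<noteq> 0" if "p < y" "y < q" for y
      using cos_gt_zero_pi[OF angle[OF that]] by simp
    then show "\<forall>y \<in> {p<..<q}. cos ((y - (p + q) / 2) * pi / (q - p)) \<noteq> 0" by simp
  qed (use assms in auto)
  show thesis by (rule that[OF mono \<sigma>c range \<rho>c]) (simp add: \<rho>\<sigma>)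
qed

text \<open>A chart image is only known to have nonempty interior, so the chart is shrunk to the
  preimage of an open interval, which also avoids boundary points. That \<open>\<theta>\<close> and
  \<open>\<phi>\<close> order points alike ties \<open>\<theta>\<close> to the orientation.\<close>

lemma manifold_line_coordinates:
  fixes M :: "'a topology"
  assumes M: "one_manifold M" and A: "oriented_atlas M A"
  obtains U \<phi> V \<theta> and e :: "real \<Rightarrow> 'a" where "(U, \<phi>) \<in> A" "openin M V" "V \<subseteq> U"
    "homeomorphic_maps (subtopology M V) euclideanreal \<theta> e"
    "\<forall>x \<in> V. \<forall>y \<in> V. \<theta> x < \<theta> y \<longleftrightarrow> \<phi> x < \<phi> y"
proof -
  obtain z where "z \<in> topspace M" using M unfolding one_manifold_def by blast
  then have "z \<in> (\<Union>(U, \<phi>) \<in> A. U)" using A by (simp add: oriented_atlas_def)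
  then obtain U \<phi> where U: "(U, \<phi>) \<in> A" by blast
  then have "chart M U \<phi>" using A by (auto simp: oriented_atlas_def)
  then have Uo: "openin M U" and int: "interior (\<phi> ` U) \<noteq> {}"
    and hom: "homeomorphic_map (subtopology M U) (top_of_set (\<phi> ` U)) \<phi>"
    by (auto simp: chart_def)
  have "U \<subseteq> topspace M" using Uo by (rule openin_subset)
  then have topU: "topspace (subtopology M U) = U" by auto
  obtain c where "c \<in> interior (\<phi> ` U)" using int by blast
  then obtain \<epsilon> where \<epsilon>: "\<epsilon> > 0" "ball c \<epsilon> \<subseteq> \<phi> ` U" unfolding mem_interior by blast
  define p where "p = c - \<epsilon>"
  define q where "q = c + \<epsilon>"
  have pq: "p < q" "{p<..<q} \<subseteq> \<phi> ` U"
    using \<epsilon> by (auto simp: p_def q_def ball_eq_greaterThanLessThan)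
  obtain \<sigma> \<rho> :: "real \<Rightarrow> real" where \<sigma>: "strict_mono \<sigma>" "continuous_on UNIV \<sigma>" "range \<sigma> = {p<..<q}"
    and \<rho>: "continuous_on {p<..<q} \<rho>" "\<forall>t. \<rho> (\<sigma> t) = t"
    using line_open_interval_coordinates[OF pq(1)] .
  obtain \<psi> where "homeomorphic_maps (subtopology M U) (top_of_set (\<phi> ` U)) \<phi> \<psi>"
    using hom homeomorphic_map_maps by blast
  then have \<phi>c: "continuous_map (subtopology M U) (top_of_set (\<phi> ` U)) \<phi>"
    and \<psi>c: "continuous_map (top_of_set (\<phi> ` U)) (subtopology M U) \<psi>"
    and \<psi>\<phi>: "\<And>x. x \<in> U \<Longrightarrow> \<psi> (\<phi> x) = x"
    using topU by (simp_all add: homeomorphic_maps_def)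
  define V where "V = {x \<in> U. \<phi> x \<in> {p<..<q}}"
  have VU: "V \<subseteq> U" by (auto simp: V_def)
  have \<phi>e: "continuous_map (subtopology M U) euclideanreal \<phi>"
    using \<phi>c by (simp add: continuous_map_in_subtopology)
  have "openin (subtopology M U) {x \<in> topspace (subtopology M U). \<phi> x \<in> {p<..<q}}"
    by (rule openin_continuous_map_preimage[OF \<phi>e]) simp
  then have "openin (subtopology M U) V" by (simp only: V_def topU)
  then have Vo: "openin M V" using Uo openin_trans_full by blast
  define e where "e t = \<psi> (\<sigma> t)" for t
  define \<theta> where "\<theta> x = \<rho> (\<phi> x)" for x
  have \<sigma>m: "\<sigma> t \<in> {p<..<q}" for t using \<sigma>(3) by blast
  have eV: "e t \<in> V" and \<phi>e_eq: "\<phi> (e t) = \<sigma> t" for t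
  proof -
    obtain x where x: "x \<in> U" "\<sigma> t = \<phi> x" using \<sigma>m pq(2) by blast
    then have "e t = x" by (simp add: e_def \<psi>\<phi>)
    then show "e t \<in> V" "\<phi> (e t) = \<sigma> t" using x \<sigma>m[of t] by (simp_all add: V_def)
  qed
  have "continuous_map euclideanreal (top_of_set (\<phi> ` U)) \<sigma>"
    unfolding continuous_map_in_subtopology using \<sigma>(2) subsetD[OF pq(2) \<sigma>m] by simp
  from continuous_map_compose[OF this \<psi>c] have "continuous_map euclideanreal M e"
    unfolding continuous_map_in_subtopology by (simp add: e_def[abs_def] o_def)
  then have ec: "continuous_map euclideanreal (subtopology M V) e"
    unfolding continuous_map_in_subtopology using eV by simp
  have "continuous_map (subtopology M V) euclideanreal \<phi>"
    using continuous_map_from_subtopology_mono[OF \<phi>e VU] .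
  then have "continuous_map (subtopology M V) (top_of_set {p<..<q}) \<phi>"
    unfolding continuous_map_in_subtopology by (simp add: V_def Pi_def)
  moreover have "continuous_map (top_of_set {p<..<q}) euclideanreal \<rho>" using \<rho>(1) by simp
  ultimately have "continuous_map (subtopology M V) euclideanreal (\<rho> \<circ> \<phi>)"
    by (rule continuous_map_compose)
  then have \<theta>c: "continuous_map (subtopology M V) euclideanreal \<theta>"
    by (simp only: \<theta>_def[abs_def] o_def)
  have \<theta>e: "\<theta> (e t) = t" for t by (simp add: \<theta>_def \<phi>e_eq \<rho>(2))
  have e\<theta>: "e (\<theta> x) = x" if "x \<in> V" for x
  proof -
    have "\<phi> x \<in> range \<sigma>" unfolding \<sigma>(3) using that by (simp add: V_def)
    then obtain t where t: "\<phi> x = \<sigma> t" by blast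
    then have "e (\<theta> x) = \<psi> (\<phi> x)" by (simp add: \<theta>_def e_def \<rho>(2))
    then show ?thesis using \<psi>\<phi>[OF subsetD[OF VU that]] by simp
  qed
  have hm: "homeomorphic_maps (subtopology M V) euclideanreal \<theta> e"
    unfolding homeomorphic_maps_def using \<theta>c ec by (simp add: \<theta>e e\<theta>)
  have "\<theta> x < \<theta> y \<longleftrightarrow> \<phi> x < \<phi> y" if "x \<in> V" "y \<in> V" for x y
  proof -
    have "\<phi> x = \<sigma> (\<theta> x)" "\<phi> y = \<sigma> (\<theta> y)"
      using \<phi>e_eq[of "\<theta> x"] \<phi>e_eq[of "\<theta> y"] e\<theta> that by simp_all
    then show ?thesis using strict_mono_less[OF \<sigma>(1)] by simp
  qed
  then show thesis by (intro that[OF U Vo VU hm] ballI)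
qed

text \<open>\<open>\<Phi> h\<close> acts through the coordinate on \<open>V\<close> and as the
  identity elsewhere. For bounded support the moved points lie in a compact set, closed since
  \<open>M\<close> is Hausdorff. Thus \<open>V\<close> and the complement of this set form an open
  cover on whose members continuity and orientation can be checked.\<close>

lemma transplant:
  fixes M :: "'a topology"
  assumes M: "one_manifold M" and A: "oriented_atlas M A"
  obtains \<Phi> :: "(real \<Rightarrow> real) \<Rightarrow> 'a \<Rightarrow> 'a" where
    "\<forall>h \<in> carrier Homeo_plus_real. (\<exists>a b. \<forall>t. t < a \<or> b < t \<longrightarrow> h t = t) \<longrightarrow>
      \<Phi> h \<in> carrier (Homeo_plus M A)"
    "\<forall>h k. \<Phi> (h \<circ> k) = compose (topspace M) (\<Phi> h) (\<Phi> k)"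
    "inj \<Phi>"
proof -
  obtain U \<phi> V \<theta> e where U: "(U, \<phi>) \<in> A" and Vo: "openin M V" and VU: "V \<subseteq> U"
    and hm: "homeomorphic_maps (subtopology M V) euclideanreal \<theta> e"
    and order: "\<forall>x \<in> V. \<forall>y \<in> V. \<theta> x < \<theta> y \<longleftrightarrow> \<phi> x < \<phi> y"
    using manifold_line_coordinates[OF M A] .
  have less: "\<theta> x < \<theta> y \<longleftrightarrow> \<phi> x < \<phi> y" if "x \<in> V" "y \<in> V" for x y
    using order that by blast
  have VM: "V \<subseteq> topspace M" using Vo by (rule openin_subset)
  have V: "topspace (subtopology M V) = V" using VM by auto
  have \<theta>c: "continuous_map (subtopology M V) euclideanreal \<theta>"
    and ec: "continuous_map euclideanreal (subtopology M V) e"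
    and e\<theta>: "\<And>x. x \<in> V \<Longrightarrow> e (\<theta> x) = x" and \<theta>e: "\<And>t. \<theta> (e t) = t"
    using hm V by (simp_all add: homeomorphic_maps_def)
  have eV: "e t \<in> V" for t
    using continuous_map_image_subset_topspace[OF ec] V by auto
  have eM: "continuous_map euclideanreal M e"
    using ec by (simp add: continuous_map_in_subtopology)
  \<comment> \<open>Elements of \<open>Bij\<close> are extensional, hence the restriction to
    \<open>topspace M\<close>.\<close>
  define \<Phi> where "\<Phi> h = (\<lambda>x \<in> topspace M. if x \<in> V then e (h (\<theta> x)) else x)" for h
  have \<Phi>V: "\<Phi> h x = e (h (\<theta> x))" if "x \<in> V" for h x using that VM by (auto simp: \<Phi>_def)
  have \<Phi>nV: "\<Phi> h x = x" if "x \<notin> V" "x \<in> topspace M" for h x using that by (simp add: \<Phi>_def)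
  have \<Phi>m: "\<Phi> h x \<in> topspace M" if "x \<in> topspace M" for h x
    using that eV VM by (cases "x \<in> V") (auto simp: \<Phi>V \<Phi>nV)
  have comp: "\<Phi> (h \<circ> k) = compose (topspace M) (\<Phi> h) (\<Phi> k)" for h k
  proof
    fix x show "\<Phi> (h \<circ> k) x = compose (topspace M) (\<Phi> h) (\<Phi> k) x"
    proof (cases "x \<in> topspace M")
      case True
      then show ?thesis using \<Phi>V[of x] \<Phi>V[OF eV] \<Phi>nV
        by (cases "x \<in> V") (simp_all add: compose_def \<theta>e)
    qed (simp add: \<Phi>_def compose_def)
  qed
  have inj: "inj \<Phi>"
  proof (rule injI)
    fix h k assume "\<Phi> h = \<Phi> k"
    then have "\<Phi> h (e t) = \<Phi> k (e t)" for t by simp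
    then have "e (h t) = e (k t)" for t by (simp add: \<Phi>V eV \<theta>e)
    then have "\<theta> (e (h t)) = \<theta> (e (k t))" for t by simp
    then show "h = k" by (simp add: \<theta>e fun_eq_iff)
  qed
  have off: "\<exists>T. openin M T \<and> V \<union> T = topspace M \<and> (\<forall>x \<in> T. \<Phi> h x = x)"
    if bd: "\<exists>a b. \<forall>t. t < a \<or> b < t \<longrightarrow> h t = t" for h
  proof -
    obtain a b where ab: "\<And>t. t < a \<or> b < t \<Longrightarrow> h t = t" using bd by blast
    have "compactin M (e ` {a..b})" by (rule image_compactin[OF _ eM]) simp
    moreover have "Hausdorff_space M" using M by (simp add: one_manifold_def)
    ultimately have "closedin M (e ` {a..b})" using compactin_imp_closedin by blast
    then have "openin M (topspace M - e ` {a..b})" by blast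
    moreover have "V \<union> (topspace M - e ` {a..b}) = topspace M" using eV VM by auto
    moreover have "\<Phi> h x = x" if x: "x \<in> topspace M - e ` {a..b}" for x
    proof (cases "x \<in> V")
      case True
      then have "\<not> (a \<le> \<theta> x \<and> \<theta> x \<le> b)" using x e\<theta>[of x] by (metis DiffD2 atLeastAtMost_iff imageI)
      then have "h (\<theta> x) = \<theta> x" by (intro ab) linarith
      then show ?thesis using True by (simp add: \<Phi>V e\<theta>)
    qed (use x \<Phi>nV in auto)
    ultimately show ?thesis by blast
  qed
  have cont: "continuous_map M M (\<Phi> h)"
    if h: "h \<in> carrier Homeo_plus_real" and bd: "\<exists>a b. \<forall>t. t < a \<or> b < t \<longrightarrow> h t = t" for h
  proof -
    obtain T where T: "openin M T" "V \<union> T = topspace M" "\<forall>x \<in> T. \<Phi> h x = x"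
      using off[OF bd] by blast
    have "homeomorphic_map euclideanreal euclideanreal h"
      using h by (simp add: carrier_Homeo_plus_real)
    then have "continuous_map euclideanreal euclideanreal h"
      by (rule homeomorphic_imp_continuous_map)
    from continuous_map_compose[OF continuous_map_compose[OF \<theta>c this] eM]
    have c1: "continuous_map (subtopology M V) M (\<lambda>x. e (h (\<theta> x)))" by (simp add: o_def)
    have c2: "continuous_map (subtopology M T) M (\<lambda>x. x)"
      by (simp add: continuous_map_from_subtopology)
    show ?thesis
    proof (rule pasting_lemma[where I = "{True, False}" and T = "\<lambda>i. if i then V else T"
          and f = "\<lambda>i. if i then (\<lambda>x. e (h (\<theta> x))) else (\<lambda>x. x)"])
      show "openin M (if i then V else T)" if "i \<in> {True, False}" for i
        using Vo T(1) by simp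
      show "continuous_map (subtopology M (if i then V else T)) M
          (if i then (\<lambda>x. e (h (\<theta> x))) else (\<lambda>x. x))" if "i \<in> {True, False}" for i
        using c1 c2 by simp
      have VT: "e (h (\<theta> x)) = x" if "x \<in> V" "x \<in> T" for x
        using T(3) \<Phi>V[OF that(1), of h] that by simp
      then show "(if i then (\<lambda>x. e (h (\<theta> x))) else (\<lambda>x. x)) x = (if j then (\<lambda>x. e (h (\<theta> x))) else (\<lambda>x. x)) x"
        if "i \<in> {True, False}" "j \<in> {True, False}"
          "x \<in> topspace M \<inter> (if i then V else T) \<inter> (if j then V else T)" for i j x
        using that by (cases i; cases j) auto
      show "\<exists>j. j \<in> {True, False} \<and> x \<in> (if j then V else T) \<and>
          \<Phi> h x = (if j then (\<lambda>x. e (h (\<theta> x))) else (\<lambda>x. x)) x" if "x \<in> topspace M" for x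
      proof (cases "x \<in> V")
        case True
        then show ?thesis by (intro exI[of _ True]) (simp add: \<Phi>V)
      next
        case False
        then show ?thesis using T that by (intro exI[of _ False]) auto
      qed
    qed
  qed
  have carr: "\<Phi> h \<in> carrier (Homeo_plus M A)"
    if h: "h \<in> carrier Homeo_plus_real" and bd: "\<exists>a b. \<forall>t. t < a \<or> b < t \<longrightarrow> h t = t" for h
  proof -
    note hs = real_carrier_simps[OF h]
    have bd': "\<exists>a b. \<forall>t. t < a \<or> b < t \<longrightarrow> hinv h t = t" using bd unfolding hs(14) by metis
    have inv1: "\<Phi> (hinv h) (\<Phi> h x) = x" and inv2: "\<Phi> h (\<Phi> (hinv h) x) = x"
      if "x \<in> topspace M" for x
    proof -
      have "\<Phi> (hinv h) (\<Phi> h x) = \<Phi> (hinv h \<circ> h) x" "\<Phi> h (\<Phi> (hinv h) x) = \<Phi> (h \<circ> hinv h) x"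
        using that by (simp_all add: comp compose_def)
      moreover have "hinv h \<circ> h = id" "h \<circ> hinv h = id" using hs by (simp_all add: fun_eq_iff)
      moreover have "\<Phi> id x = x" using that by (cases "x \<in> V") (simp_all add: \<Phi>V \<Phi>nV e\<theta>)
      ultimately show "\<Phi> (hinv h) (\<Phi> h x) = x" "\<Phi> h (\<Phi> (hinv h) x) = x" by simp_all
    qed
    have "homeomorphic_maps M M (\<Phi> h) (\<Phi> (hinv h))"
      unfolding homeomorphic_maps_def
      using cont[OF h bd] cont[OF inv_real_closed[OF h] bd'] inv1 inv2 by simp
    then have homeo: "homeomorphic_map M M (\<Phi> h)" by (rule homeomorphic_maps_imp_map)
    have "bij_betw (\<Phi> h) (topspace M) (topspace M)"
      by (rule bij_betwI[where g = "\<Phi> (hinv h)"]) (use \<Phi>m inv1 inv2 in auto)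
    then have bij: "\<Phi> h \<in> Bij (topspace M)" by (simp add: Bij_def) (simp add: \<Phi>_def)
    obtain T where T: "openin M T" "V \<union> T = topspace M" "\<forall>x \<in> T. \<Phi> h x = x"
      using off[OF bd] by blast
    have idop: "orientation_preserving M A (\<lambda>x. x)" using A by (simp add: oriented_atlas_def)
    have "orientation_preserving M A (\<Phi> h)"
      unfolding orientation_preserving_def
    proof (clarify)
      fix U1 \<phi>1 U2 \<phi>2 p
      assume *: "(U1, \<phi>1) \<in> A" "(U2, \<phi>2) \<in> A" "p \<in> U1" "\<Phi> h p \<in> U2"
      have "chart M U1 \<phi>1" using A *(1) by (auto simp: oriented_atlas_def)
      then have "U1 \<subseteq> topspace M" by (auto simp: chart_def dest: openin_subset)
      then have pM: "p \<in> topspace M" using *(3) by blast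
      show "\<exists>W. openin M W \<and> p \<in> W \<and> W \<subseteq> U1 \<and> \<Phi> h ` W \<subseteq> U2 \<and>
          (\<forall>x \<in> W. \<forall>y \<in> W. \<phi>1 x < \<phi>1 y \<longrightarrow> \<phi>2 (\<Phi> h x) < \<phi>2 (\<Phi> h y))"
      proof (cases "p \<in> V")
        case True
        \<comment> \<open>Pass from \<open>\<phi>1\<close> to \<open>\<phi>\<close>, apply the
          increasing map \<open>h\<close> in the coordinate, then pass to \<open>\<phi>2\<close>;
          both changes of chart are locally increasing because the atlas is oriented.\<close>
        have pU: "p \<in> U" and qV: "\<Phi> h p \<in> V" using True VU eV by (auto simp: \<Phi>V)
        then have qU: "\<Phi> h p \<in> U" using VU by blast
        obtain W1 where W1: "openin M W1" "p \<in> W1" "W1 \<subseteq> U1"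
          "\<forall>x \<in> W1. \<forall>y \<in> W1. \<phi>1 x < \<phi>1 y \<longrightarrow> \<phi> x < \<phi> y"
          using orientation_preservingD[OF idop *(1) U *(3) pU] by blast
        obtain W2 where W2: "openin M W2" "\<Phi> h p \<in> W2" "(\<lambda>x. x) ` W2 \<subseteq> U2"
          "\<forall>x \<in> W2. \<forall>y \<in> W2. \<phi> x < \<phi> y \<longrightarrow> \<phi>2 x < \<phi>2 y"
          using orientation_preservingD[OF idop U *(2) qU *(4)] by blast
        define W where "W = W1 \<inter> V \<inter> {x \<in> topspace M. \<Phi> h x \<in> W2}"
        have "openin M {x \<in> topspace M. \<Phi> h x \<in> W2}"
          by (rule openin_continuous_map_preimage[OF cont[OF h bd] W2(1)])
        then have "openin M W" unfolding W_def using W1(1) Vo by blast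
        moreover have "\<phi>2 (\<Phi> h x) < \<phi>2 (\<Phi> h y)" if xy: "x \<in> W" "y \<in> W" "\<phi>1 x < \<phi>1 y" for x y
        proof -
          have xV: "x \<in> V" "y \<in> V" using xy by (auto simp: W_def)
          have "\<phi> x < \<phi> y" using xy W1(4) by (auto simp: W_def)
          then have "h (\<theta> x) < h (\<theta> y)" unfolding hs(5) using less[OF xV] by simp
          then have "\<phi> (\<Phi> h x) < \<phi> (\<Phi> h y)"
            using less[OF eV eV] by (simp add: \<Phi>V xV \<theta>e)
          then show ?thesis using W2(4) xy by (auto simp: W_def)
        qed
        ultimately show ?thesis
          using W1 W2 True pM by (intro exI[of _ W]) (auto simp: W_def)
      next
        case False
        then have pT: "p \<in> T" using T(2) pM by blast
        then have "p \<in> U2" using T(3) *(4) by simp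
        then obtain W where W: "openin M W" "p \<in> W" "W \<subseteq> U1" "(\<lambda>x. x) ` W \<subseteq> U2"
          "\<forall>x \<in> W. \<forall>y \<in> W. \<phi>1 x < \<phi>1 y \<longrightarrow> \<phi>2 x < \<phi>2 y"
          using orientation_preservingD[OF idop *(1,2,3)] by blast
        then show ?thesis using T pT by (intro exI[of _ "W \<inter> T"]) auto
      qed
    qed
    then show ?thesis using bij homeo by (simp add: Homeo_plus_def)
  qed
  show thesis
    by (intro that[OF _ _ inj] ballI impI allI comp carr)
qed

section \<open>Simplicity and the number of isomorphism types\<close>

lemma simple_iso:
  assumes G: "simple G" and H: "group H" and iso: "G \<cong> H"
  shows "simple H"
  unfolding simple_def
proof (intro conjI allI impI)
  obtain h where h: "h \<in> iso G H" using iso by (auto simp: is_iso_def)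
  have grp: "group G" using G by (simp add: simple_def)
  interpret h: group_hom G H h
    using grp H h by (auto simp: group_hom_def group_hom_axioms_def iso_def)
  have bij: "bij_betw h (carrier G) (carrier H)" using h by (simp add: iso_def)
  show "group H" by fact
  have "carrier G \<noteq> {\<one>\<^bsub>G\<^esub>}" using G by (simp add: simple_def)
  then obtain g where g: "g \<in> carrier G" "g \<noteq> \<one>\<^bsub>G\<^esub>" using h.G.one_closed by auto
  then have "h g \<noteq> h \<one>\<^bsub>G\<^esub>"
    using inj_on_eq_iff[OF bij_betw_imp_inj_on[OF bij] g(1) h.G.one_closed] by simp
  then show "carrier H \<noteq> {\<one>\<^bsub>H\<^esub>}" using h.hom_closed[OF g(1)] by auto
  fix N assume N: "N \<lhd> H"
  note Nsub = normal_imp_subgroup[OF N]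
  define P where "P = {x \<in> carrier G. h x \<in> N}"
  have "P \<lhd> G"
    unfolding h.G.normal_inv_iff
  proof (intro conjI ballI)
    show "subgroup P G"
      using subgroup.m_closed[OF Nsub] subgroup.one_closed[OF Nsub] subgroup.m_inv_closed[OF Nsub]
      by (intro h.G.subgroupI) (auto simp: P_def)
    fix x y assume "x \<in> carrier G" "y \<in> P"
    then show "x \<otimes>\<^bsub>G\<^esub> y \<otimes>\<^bsub>G\<^esub> inv\<^bsub>G\<^esub> x \<in> P"
      using normal.inv_op_closed2[OF N] by (simp add: P_def)
  qed
  then have "P = carrier G \<or> P = {\<one>\<^bsub>G\<^esub>}" using G by (simp add: simple_def)
  moreover have NP: "N = h ` P"
    using subgroup.subset[OF Nsub] bij_betw_imp_surj_on[OF bij] by (auto simp: P_def)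
  ultimately show "N = carrier H \<or> N = {\<one>\<^bsub>H\<^esub>}"
    using bij_betw_imp_surj_on[OF bij] by auto
qed

theorem corollary1p8:
  fixes M :: "'a topology" and A :: "('a set \<times> ('a \<Rightarrow> real)) set"
  assumes "one_manifold M" and "oriented_atlas M A"
  shows "\<exists>\<H>. \<H> \<subseteq> {H. subgroup H (Homeo_plus M A) \<and> countable H \<and>
                       simple ((Homeo_plus M A)\<lparr>carrier := H\<rparr>)} \<and>
           uncountable (iso_types (Homeo_plus M A) \<H>) \<and>
           (\<forall>H \<in> \<H>. \<exists>K. chain_group 3 K \<and>
              (Homeo_plus M A)\<lparr>carrier := H\<rparr> \<cong>
              Homeo_plus_real\<lparr>carrier := derived Homeo_plus_real K\<rparr>)"
proof -
  let ?G = "Homeo_plus M A"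
  let ?D = "\<lambda>S. derived Homeo_plus_real (chain S)"
  interpret G: group ?G using group_Homeo_plus[OF assms(2)] .
  obtain \<Phi> where carr: "\<forall>h \<in> carrier Homeo_plus_real.
        (\<exists>a b. \<forall>t. t < a \<or> b < t \<longrightarrow> h t = t) \<longrightarrow> \<Phi> h \<in> carrier ?G"
    and comp: "\<forall>h k. \<Phi> (h \<circ> k) = compose (topspace M) (\<Phi> h) (\<Phi> k)" and inj: "inj \<Phi>"
    using transplant[OF assms] .
  define J where "J S = \<Phi> ` ?D S" for S
  have J_hom: "\<Phi> \<in> hom (Homeo_plus_real\<lparr>carrier := ?D S\<rparr>) ?G" for S
  proof (rule homI)
    note dcl = subgroup_real_closed[OF subgroup_derived_chain[of S]]
    show c: "\<Phi> h \<in> carrier ?G" if "h \<in> carrier (Homeo_plus_real\<lparr>carrier := ?D S\<rparr>)" for h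
      using that carr dcl(4)[of h] derived_chain_bounded[of h S] by simp
    fix h k
    assume hk: "h \<in> carrier (Homeo_plus_real\<lparr>carrier := ?D S\<rparr>)"
      "k \<in> carrier (Homeo_plus_real\<lparr>carrier := ?D S\<rparr>)"
    have "h \<otimes>\<^bsub>Homeo_plus_real\<lparr>carrier := ?D S\<rparr>\<^esub> k = h \<circ> k"
      using hk mult_real[of h k] dcl(4)[of h] dcl(4)[of k] by simp
    moreover have "\<Phi> h \<otimes>\<^bsub>?G\<^esub> \<Phi> k = compose (topspace M) (\<Phi> h) (\<Phi> k)"
      using c[OF hk(1)] c[OF hk(2)] by (simp add: Homeo_plus_def BijGroup_def)
    ultimately show "\<Phi> (h \<otimes>\<^bsub>Homeo_plus_real\<lparr>carrier := ?D S\<rparr>\<^esub> k) = \<Phi> h \<otimes>\<^bsub>?G\<^esub> \<Phi> k"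
      using comp by (simp only:)
  qed
  have D_group: "group (Homeo_plus_real\<lparr>carrier := ?D S\<rparr>)" for S
    using subgroup.subgroup_is_group[OF subgroup_derived_chain group_real] .
  have J_sub: "subgroup (J S) ?G" for S
  proof -
    have "group_hom (Homeo_plus_real\<lparr>carrier := ?D S\<rparr>) ?G \<Phi>"
      using J_hom D_group G.group_axioms by (intro group_hom.intro group_hom_axioms.intro)
    from group_hom.img_is_subgroup[OF this] show ?thesis by (simp add: J_def)
  qed
  have J_group: "group (?G\<lparr>carrier := J S\<rparr>)" for S
    using subgroup.subgroup_is_group[OF J_sub G.group_axioms] .
  have iso: "Homeo_plus_real\<lparr>carrier := ?D S\<rparr> \<cong> ?G\<lparr>carrier := J S\<rparr>" for S
  proof -
    have "\<Phi> \<in> hom (Homeo_plus_real\<lparr>carrier := ?D S\<rparr>) (?G\<lparr>carrier := J S\<rparr>)"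
      using J_hom[of S] by (auto simp: hom_def J_def)
    moreover have "bij_betw \<Phi> (?D S) (J S)"
      unfolding J_def by (intro inj_on_imp_bij_betw inj_on_subset[OF inj]) simp
    ultimately show ?thesis by (auto simp: is_iso_def iso_def)
  qed
  have iso': "?G\<lparr>carrier := J S\<rparr> \<cong> Homeo_plus_real\<lparr>carrier := ?D S\<rparr>" for S
    using group.iso_sym[OF D_group iso] .
  have J_countable: "countable (J S)" for S
    unfolding J_def by (intro countable_image countable_derived_chain)
  define r where "r = {(H, K). H \<in> range J \<and> K \<in> range J \<and> ?G\<lparr>carrier := H\<rparr> \<cong> ?G\<lparr>carrier := K\<rparr>}"
  have "uncountable (range J // r)"
  proof
    assume ct: "countable (range J // r)"
    \<comment> \<open>Each class contributes a countable family of sets, computed from a chosen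
      representative. Countably many classes would cover all sets of natural numbers, against
      Cantor's theorem.\<close>
    define F where "F C = commuting_sets (?G\<lparr>carrier := (SOME K. K \<in> C)\<rparr>)" for C
    have F: "(SOME K. K \<in> r `` {J S}) \<in> r `` {J S}" for S
    proof -
      have "J S \<in> r `` {J S}" by (auto simp: r_def iso_refl)
      then show ?thesis by (rule someI)
    qed
    have mem: "- S \<in> F (r `` {J S})" for S
    proof -
      obtain T where T: "(SOME K. K \<in> r `` {J S}) = J T" "?G\<lparr>carrier := J S\<rparr> \<cong> ?G\<lparr>carrier := J T\<rparr>"
        using F[of S] by (auto simp: r_def)
      have "- S \<in> commuting_sets (?G\<lparr>carrier := J S\<rparr>)"
        using subsetD[OF commuting_sets_iso[OF D_group J_group iso] complement_mem_commuting_sets] .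
      then show ?thesis
        unfolding F_def T(1) by (rule subsetD[OF commuting_sets_iso[OF J_group J_group T(2)]])
    qed
    have "S \<in> (\<Union>C \<in> range J // r. F C)" for S
    proof (rule UN_I)
      show "r `` {J (- S)} \<in> range J // r" by (rule quotientI) simp
      show "S \<in> F (r `` {J (- S)})" using mem[of "- S"] by simp
    qed
    then have sub: "(UNIV :: nat set set) \<subseteq> (\<Union>C \<in> range J // r. F C)" by blast
    have "countable (F C)" if C: "C \<in> range J // r" for C
    proof -
      obtain S where "C = r `` {J S}" using C by (auto simp: quotient_def)
      then obtain T where "(SOME K. K \<in> C) = J T" using F[of S] by (auto simp: r_def)
      then show ?thesis
        unfolding F_def using J_countable by (intro countable_commuting_sets) simp
    qed
    then have "countable (\<Union>C \<in> range J // r. F C)" by (intro countable_UN ct)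
    with sub have "countable (UNIV :: nat set set)" by (rule countable_subset)
    then have "range (from_nat_into (UNIV :: nat set set)) = Pow UNIV"
      by (simp add: range_from_nat_into)
    then show False using Cantors_theorem[of "UNIV :: nat set"] by blast
  qed
  then have "uncountable (iso_types ?G (range J))" by (simp add: iso_types_def r_def)
  moreover have "range J \<subseteq> {H. subgroup H ?G \<and> countable H \<and> simple (?G\<lparr>carrier := H\<rparr>)}"
    by (intro subsetI CollectI conjI; elim rangeE; hypsubst)
      (intro J_sub J_countable simple_iso[OF simple_derived_chain J_group iso])+
  moreover have "\<forall>H \<in> range J. \<exists>K. chain_group 3 K \<and>
      ?G\<lparr>carrier := H\<rparr> \<cong> Homeo_plus_real\<lparr>carrier := derived Homeo_plus_real K\<rparr>"
    using chain_group_chain iso' by blast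
  ultimately show ?thesis by (intro exI[of _ "range J"] conjI)
qed

end
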